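(* Let $(X,d)$ be a complete length space and $T>0$. Assume that $H\in C(X\times[0,\infty))$ satisfies (H1) and that $L(x,q)=\sup_{p\ge0}\{pq-H(x,p)\}$ belongs to $C(X\times[0,\infty))$ and satisfies (H2)--(H4), where (H1)--(H4) are the ($t$-independent) conditions listed in the context. Let $u_0:X\to\mathbb{R}$ be bounded and Lipschitz and let $u\in C(X\times[0,T))$ satisfy $\sup_{x\in X}|u(x,t)-u_0(x)|\to0$ as $t\to0+$. Then $u$ is a Monge solution of $$\partial_tu+H(x,|\nabla u|)=0\quad\text{in }X\times(0,T)$$ if and only if it is a curve-based viscosity solution of this equation.
   Context: Conditions: (H1) $p\mapsto H(x,p)$ is convex and nondecreasing in $[0,\infty)$ for all $x\in X$, and $\inf\{H(x,p)/p:x\in X,\ p\ge R\}\to\infty$ as $R\to\infty$. (H2) There is a convex $m\in C(\mathbb{R})$ with $\inf_{x\in X}L(x,q)\ge m(q)$ for all $q\ge0$ and $m(q)/q\to\infty$ as $q\to\infty$. (H3) $\sup_{x\in X}L(x,0)<+\infty$. (H4) $L$ is locally uniformly continuous (uniformly continuous on bounded subsets) in $X\times[0,\infty)$, and there is a modulus of continuity $\omega_L$ with $|L(x,q)-L(y,q)|\le\omega_L(d(x,y))(1+|m(q)|)$ for all $x,y\in X$, $q\ge0$. Write $Y_T=X\times(0,T)$. Monge solutions. For $k\ge0$, $S_k(Y_T)$ is the set of locally Lipschitz $u:Y_T\to\mathbb{R}$ with $u(x,t)-u(x,s)\ge-k(t-s)$ for all $x\in X$, $0<s<t<T$; $S(Y_T)=\bigcup_{k\ge0}S_k(Y_T)$.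 For $v\in S_0(Y_T)$, $$|D_L^-v|(x,t)=\limsup_{y\to x,\ s\to t-}\left\{\frac{v(x,t)-v(y,s)}{t-s}-L\left(x,\frac{d(x,y)}{t-s}\right)\right\}$$ (over $(y,s)\in Y_T$ with $s<t$, $y=x$ allowed). $u$ is a Monge solution if $u\in S(Y_T)$ (restricted to $Y_T$) and there is $k\ge0$ with $u\in S_k(Y_T)$ such that $v(x,t)=u(x,t)+kt$ satisfies $|D_L^-v|(x,t)=k$ for all $(x,t)\in Y_T$. Curve-based solutions. $\mathcal A_x(X)$ is the set of absolutely continuous curves $\gamma:[0,\infty)\to X$ with $\gamma(0)=x$ whose metric speed $|\gamma'|$ is piecewise constant: there are finitely many $r_1<\dots<r_n$ such that on each $I=[0,r_1],[r_1,r_2],\dots,[r_n,\infty)$ one has $|\gamma'|=v_I$ a.e. for a constant $v_I$ and $\sigma\mapsto L(\gamma(\sigma),v_I)$ is continuous on $I$ (automatic here since $L$ is continuous). A function $u$ on $Y_T$ is arcwise continuous if $(s,t)\mapsto u(\gamma(s),t)$ is continuous on $\mathbb{R}\times(0,T)$ for every absolutely continuous $\gamma:\mathbb{R}\to X$. An arcwise continuous $u$ is a curve-based viscosity subsolution if for all $(x,t)\in Y_T$ and all $\gamma\in\mathcal A_x(X)$, $u(x,t)\le\int_0^\delta L(\gamma(\sigma),|\gamma'|(\sigma))\,d\sigma+u(\gamma(\delta),t-\delta)$ for all $\delta\in[0,t)$; a curve-based viscosity supersolution if for all $(x,t)\in Y_T$ and $\varepsilon>0$ there is $\gamma\in\mathcal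 A_x(X)$ with $u(x,t)\ge\int_0^\delta L(\gamma(\sigma),|\gamma'|(\sigma))\,d\sigma+u(\gamma(\delta),t-\delta)-\varepsilon$ for all $\delta\in[0,t)$; and a curve-based viscosity solution if it is both. *)

theory Defs
  imports "HOL-Analysis.Analysis"
begin

section \<open>Curves in metric spaces\<close>

definition path_length :: "(real \<Rightarrow> 'a::metric_space) \<Rightarrow> ereal" where
  "path_length g =
    (SUP (n, r) \<in> {(n::nat, r). mono_on {..n} r \<and> r ` {..n} \<subseteq> {0..1}}.
       ereal (\<Sum>i<n. dist (g (r i)) (g (r (Suc i)))))"

definition length_space :: "'a::metric_space itself \<Rightarrow> bool" where
  "length_space _ \<longleftrightarrow>
    (\<forall>x y :: 'a. ereal (dist x y) =
      (INF g \<in> {g. path g \<and> pathstart g = x \<and> pathfinish g = y}. path_length g))"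

definition abs_cont_on_interval :: "real \<Rightarrow> real \<Rightarrow> (real \<Rightarrow> 'a::metric_space) \<Rightarrow> bool" where
  "abs_cont_on_interval a b \<gamma> \<longleftrightarrow>
    (\<forall>\<epsilon>>0. \<exists>\<delta>>0. \<forall>D. finite D
        \<and> (\<forall>(p, q)\<in>D. a \<le> p \<and> p \<le> q \<and> q \<le> b)
        \<and> disjoint_family_on (\<lambda>(p, q). {p<..<q}) D
        \<and> (\<Sum>(p, q)\<in>D. q - p) < \<delta>
      \<longrightarrow> (\<Sum>(p, q)\<in>D. dist (\<gamma> p) (\<gamma> q)) < \<epsilon>)"

text \<open>On the unbounded intervals \<open>[0, \<infinity>)\<close> and \<open>\<real>\<close>, absolute continuity is understood
  on every compact subinterval.\<close>

definition abs_cont_on :: "real set \<Rightarrow> (real \<Rightarrow> 'a::metric_space) \<Rightarrow> bool" where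
  "abs_cont_on S \<gamma> \<longleftrightarrow> (\<forall>a b. {a..b} \<subseteq> S \<longrightarrow> abs_cont_on_interval a b \<gamma>)"

text \<open>Curves on \<open>[0, \<infinity>)\<close> are represented by functions on \<open>\<real>\<close> whose values at negative
  arguments are never used; hence the metric derivative is taken within \<open>[0, \<infinity>)\<close>.\<close>

definition has_metric_speed :: "(real \<Rightarrow> 'a::metric_space) \<Rightarrow> real \<Rightarrow> real \<Rightarrow> bool" where
  "has_metric_speed \<gamma> v \<sigma> \<longleftrightarrow>
    ((\<lambda>s. dist (\<gamma> s) (\<gamma> \<sigma>) / \<bar>s - \<sigma>\<bar>) \<longlongrightarrow> v) (at \<sigma> within {0..})"

text \<open>Unspecified at the points (a null set for absolutely continuous curves) where the
  metric derivative does not exist.\<close>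

definition metric_speed :: "(real \<Rightarrow> 'a::metric_space) \<Rightarrow> real \<Rightarrow> real" where
  "metric_speed \<gamma> \<sigma> = (THE v. has_metric_speed \<gamma> v \<sigma>)"

section \<open>Hamiltonian and Lagrangian\<close>

text \<open>The supremum is finite whenever \<open>H x\<close> is continuous and superlinear, as under \<open>H1\<close>.\<close>

definition lagrangian :: "('a \<Rightarrow> real \<Rightarrow> real) \<Rightarrow> 'a \<Rightarrow> real \<Rightarrow> real" where
  "lagrangian H x q = (SUP p\<in>{0..}. p * q - H x p)"

text \<open>The infimum is extended-real valued: for small \<open>R\<close> it may be \<open>-\<infinity>\<close>.\<close>

definition H1 :: "('a \<Rightarrow> real \<Rightarrow> real) \<Rightarrow> bool" where
  "H1 H \<longleftrightarrow>
    (\<forall>x. convex_on {0..} (H x) \<and> mono_on {0..} (H x))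
    \<and> ((\<lambda>R. INF (x, p) \<in> UNIV \<times> {R..}. ereal (H x p / p)) \<longlongrightarrow> \<infinity>) at_top"

text \<open>The function \<open>m\<close> is a parameter because \<open>H4\<close> refers to the same function as \<open>H2\<close>.\<close>

definition H2 :: "('a \<Rightarrow> real \<Rightarrow> real) \<Rightarrow> (real \<Rightarrow> real) \<Rightarrow> bool" where
  "H2 L m \<longleftrightarrow>
    convex_on UNIV m \<and> continuous_on UNIV m
    \<and> (\<forall>q\<ge>0. ereal (m q) \<le> (INF x. ereal (L x q)))
    \<and> filterlim (\<lambda>q. m q / q) at_top at_top"

definition H3 :: "('a \<Rightarrow> real \<Rightarrow> real) \<Rightarrow> bool" where
  "H3 L \<longleftrightarrow> (SUP x. ereal (L x 0)) < \<infinity>"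

definition modulus_of_continuity :: "(real \<Rightarrow> real) \<Rightarrow> bool" where
  "modulus_of_continuity \<omega> \<longleftrightarrow>
    mono_on {0..} \<omega> \<and> \<omega> 0 = 0 \<and> (\<omega> \<longlongrightarrow> 0) (at_right 0)"

definition H4 :: "('a::metric_space \<Rightarrow> real \<Rightarrow> real) \<Rightarrow> (real \<Rightarrow> real) \<Rightarrow> bool" where
  "H4 L m \<longleftrightarrow>
    (\<forall>B \<subseteq> UNIV \<times> {0..}. bounded B \<longrightarrow> uniformly_continuous_on B (\<lambda>(x, q). L x q))
    \<and> (\<exists>\<omega>. modulus_of_continuity \<omega> \<and>
          (\<forall>x y. \<forall>q\<ge>0. \<bar>L x q - L y q\<bar> \<le> \<omega> (dist x y) * (1 + \<bar>m q\<bar>)))"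

section \<open>Monge solutions\<close>

definition locally_lipschitz_on ::
    "'a::metric_space set \<Rightarrow> ('a \<Rightarrow> 'b::metric_space) \<Rightarrow> bool" where
  "locally_lipschitz_on S f \<longleftrightarrow> (\<forall>z\<in>S. \<exists>r>0. \<exists>C. C-lipschitz_on (S \<inter> ball z r) f)"

definition S_class :: "real \<Rightarrow> real \<Rightarrow> ('a::metric_space \<Rightarrow> real \<Rightarrow> real) set" where
  "S_class k T = {u.
    locally_lipschitz_on (UNIV \<times> {0<..<T}) (\<lambda>(x, t). u x t)
    \<and> (\<forall>x s t. 0 < s \<and> s < t \<and> t < T \<longrightarrow> u x t - u x s \<ge> - k * (t - s))}"

definition D_L_minus ::
    "('a::metric_space \<Rightarrow> real \<Rightarrow> real) \<Rightarrow> ('a \<Rightarrow> real \<Rightarrow> real) \<Rightarrow> 'a \<Rightarrow> real \<Rightarrow> ereal" where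
  "D_L_minus L v x t =
    Limsup (at (x, t) within UNIV \<times> {0<..<t})
      (\<lambda>(y, s). ereal ((v x t - v y s) / (t - s) - L x (dist x y / (t - s))))"

text \<open>The equation enters only through the Lagrangian \<open>L\<close> of its Hamiltonian. The
  requirement that \<open>u\<close> belong to the union of all \<open>S_class k T\<close> is implied by the
  existence of \<open>k\<close>.\<close>

definition monge_solution ::
    "('a::metric_space \<Rightarrow> real \<Rightarrow> real) \<Rightarrow> real \<Rightarrow> ('a \<Rightarrow> real \<Rightarrow> real) \<Rightarrow> bool" where
  "monge_solution L T u \<longleftrightarrow>
    (\<exists>k\<ge>0. u \<in> S_class k T \<and>
      (\<forall>x. \<forall>t\<in>{0<..<T}. D_L_minus L (\<lambda>x t. u x t + k * t) x t = ereal k))"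

section \<open>Curve-based viscosity solutions\<close>

text \<open>With \<open>r 0 = 0\<close>, the pieces are \<open>[0, r 1], \<dots>, [r (n-1), r n], [r n, \<infinity>)\<close>; the case
  \<open>n = 0\<close> is a curve of constant speed.\<close>

definition admissible_curves ::
    "('a::metric_space \<Rightarrow> real \<Rightarrow> real) \<Rightarrow> 'a \<Rightarrow> (real \<Rightarrow> 'a) set" where
  "admissible_curves L x = {\<gamma>.
    \<gamma> 0 = x \<and> abs_cont_on {0..} \<gamma>
    \<and> (\<exists>(n::nat) r. r 0 = 0 \<and> strict_mono_on {..n} r \<and>
        (\<forall>I \<in> insert {r n..} ((\<lambda>i. {r i..r (Suc i)}) ` {..<n}).
          \<exists>v\<ge>0. (AE \<sigma> in lebesgue. \<sigma> \<in> I \<longrightarrow> has_metric_speed \<gamma> v \<sigma>)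
               \<and> continuous_on I (\<lambda>\<sigma>. L (\<gamma> \<sigma>) v)))}"

definition arcwise_continuous ::
    "real \<Rightarrow> ('a::metric_space \<Rightarrow> real \<Rightarrow> real) \<Rightarrow> bool" where
  "arcwise_continuous T u \<longleftrightarrow>
    (\<forall>\<gamma>. abs_cont_on UNIV \<gamma> \<longrightarrow>
      continuous_on (UNIV \<times> {0<..<T}) (\<lambda>(s, t). u (\<gamma> s) t))"

definition curve_action ::
    "('a::metric_space \<Rightarrow> real \<Rightarrow> real) \<Rightarrow> (real \<Rightarrow> 'a) \<Rightarrow> real \<Rightarrow> real" where
  "curve_action L \<gamma> \<delta> = (LINT \<sigma>:{0..\<delta>}|lebesgue. L (\<gamma> \<sigma>) (metric_speed \<gamma> \<sigma>))"

definition curve_subsolution ::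
    "('a::metric_space \<Rightarrow> real \<Rightarrow> real) \<Rightarrow> real \<Rightarrow> ('a \<Rightarrow> real \<Rightarrow> real) \<Rightarrow> bool" where
  "curve_subsolution L T u \<longleftrightarrow>
    arcwise_continuous T u \<and>
    (\<forall>x. \<forall>t\<in>{0<..<T}. \<forall>\<gamma>\<in>admissible_curves L x. \<forall>\<delta>\<in>{0..<t}.
      u x t \<le> curve_action L \<gamma> \<delta> + u (\<gamma> \<delta>) (t - \<delta>))"

definition curve_supersolution ::
    "('a::metric_space \<Rightarrow> real \<Rightarrow> real) \<Rightarrow> real \<Rightarrow> ('a \<Rightarrow> real \<Rightarrow> real) \<Rightarrow> bool" where
  "curve_supersolution L T u \<longleftrightarrow>
    arcwise_continuous T u \<and>
    (\<forall>x. \<forall>t\<in>{0<..<T}. \<forall>\<epsilon>>0. \<exists>\<gamma>\<in>admissible_curves L x. \<forall>\<delta>\<in>{0..<t}.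
      u x t \<ge> curve_action L \<gamma> \<delta> + u (\<gamma> \<delta>) (t - \<delta>) - \<epsilon>)"

definition curve_solution ::
    "('a::metric_space \<Rightarrow> real \<Rightarrow> real) \<Rightarrow> real \<Rightarrow> ('a \<Rightarrow> real \<Rightarrow> real) \<Rightarrow> bool" where
  "curve_solution L T u \<longleftrightarrow> curve_subsolution L T u \<and> curve_supersolution L T u"

end

theory Submission
  imports Defs
begin

text \<open>
  Both notions of solution express the same dynamic programming inequalities, one infinitesimally and
  the other along curves. The common ground is that \<open>L x\<close> is the supremum of the affine functions
  \<open>p * q - H x p\<close> with \<open>p \<ge> 0\<close>: it is nondecreasing, and affine lower bounds can be
  summed along a curve by the triangle inequality.

  Let \<open>u\<close> be a Monge solution. Pieces of admissible curves are Lipschitz with their speed as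
  constant (\<open>abs_cont_metric_speed_imp_lipschitz\<close>), so the upper Monge inequality bounds
  the difference quotients of \<open>u\<close> along the curve at every parameter, and an elementary monotonicity
  argument integrates it (\<open>monge_subsolution_along_lipschitz\<close>). Conversely, the lower Monge inequality
  produces, from each point, an earlier nearby point for which \<open>u\<close> drops by almost the cost
  of the move. In a small neighbourhood of \<open>x\<close> this cost may be measured by the single function \<open>L x\<close>, up
  to a factor close to \<open>1\<close>. Moves measured in this way can be composed and form a closed preorder, so
  completeness of the space yields a single move across a whole time interval of fixed small length
  (\<open>descend_to_bottom\<close>, \<open>monge_supersolution_step\<close>). Finitely many such moves lead down to time \<open>0\<close>. In a
  length space each of them is realized by a curve of constant speed
  (\<open>length_space_constant_speed_curve\<close>), which gives an admissible curve that is
  almost optimal (\<open>monge_imp_curve_supersolution\<close>).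

  Let \<open>u\<close> be a curve-based solution. Its values near time \<open>0\<close> and a shift in time along almost optimal
  curves show that it loses at most a fixed rate in time, and short curves of speed about \<open>1\<close> show that
  it is Lipschitz in space away from time \<open>0\<close> (\<open>curve_solution_time_monotone\<close>,
  \<open>curve_solution_lipschitz\<close>). Constant speed curves give the upper Monge
  inequality at bounded speeds, and superlinear growth gives it at large ones. The lower inequality comes
  from an almost optimal curve over a short time, which stays near its starting point \<open>x\<close>, where the
  Lagrangian is close to \<open>L x\<close> (\<open>curve_solution_imp_monge_supersolution\<close>).
\<close>

section \<open>Absolutely continuous curves with constant metric speed\<close>

lemma AE_lebesgue_iff_negligible: "(AE x::real in lebesgue. P x) \<longleftrightarrow> negligible {x. \<not> P x}"
  by (simp add: completion.AE_iff_null_sets negligible_iff_null_sets)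

text \<open>
  Cousin's lemma takes the place of integrating a derivative. It gives a tagged partition of \<open>[a, b]\<close> whose tags outside the null set \<open>N\<close> see difference
  quotients below \<open>v + e\<close>, while the cells with tags in \<open>N\<close> lie in an open set of small measure,
  where absolute continuity makes the increments add up to less than \<open>e\<close>.
\<close>
lemma abs_cont_metric_speed_imp_lipschitz:
  fixes g :: "real \<Rightarrow> 'a::metric_space"
  assumes ac: "abs_cont_on_interval a b g" and N: "negligible N" and v: "0 \<le> v"
    and speed: "\<And>\<sigma>. \<sigma> \<in> {a..b} - N \<Longrightarrow> has_metric_speed g v \<sigma>"
    and ab: "0 \<le> a" "a \<le> b"
  shows "dist (g a) (g b) \<le> v * (b - a)"
proof -
  have main: "dist (g a) (g b) \<le> (v + e) * (b - a) + e" if e: "e > 0" for e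
  proof -
    obtain d where d: "d > 0" and dD': "\<forall>D. finite D
        \<and> (\<forall>(p, q)\<in>D. a \<le> p \<and> p \<le> q \<and> q \<le> b)
        \<and> disjoint_family_on (\<lambda>(p, q). {p<..<q}) D
        \<and> (\<Sum>(p, q)\<in>D. q - p) < d
      \<longrightarrow> (\<Sum>(p, q)\<in>D. dist (g p) (g q)) < e"
      using ac[unfolded abs_cont_on_interval_def, THEN spec, THEN mp, OF e] by (elim exE conjE) rule
    have dD: "(\<Sum>(p, q)\<in>D. dist (g p) (g q)) < e"
      if "finite D" "\<And>p q. (p, q) \<in> D \<Longrightarrow> a \<le> p \<and> p \<le> q \<and> q \<le> b"
        "disjoint_family_on (\<lambda>(p, q). {p<..<q}) D" "(\<Sum>(p, q)\<in>D. q - p) < d" for D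
      by (rule dD'[THEN spec, THEN mp]) (use that in auto)
    have Nnull: "N \<in> null_sets lebesgue"
      using N by (simp add: negligible_iff_null_sets)
    then have Nset: "N \<in> sets lebesgue" by auto
    obtain U where U: "open U" "N \<subseteq> U" "U - N \<in> lmeasurable" "emeasure lebesgue (U - N) < ennreal d"
      using sets_lebesgue_outer_open[OF Nset d] by blast
    have Ueq: "U = (U - N) \<union> N" using U(2) by auto
    have Umeas: "U \<in> lmeasurable"
      by (metis Ueq U(3) N fmeasurable.Un negligible_imp_measurable)
    have "emeasure lebesgue U = emeasure lebesgue (U - N)"
      using Nnull Umeas by (simp add: emeasure_Diff_null_set)
    then have Ud: "measure lebesgue U < d"
      using U(4) emeasure_eq_measure2[OF Umeas] by (metis ennreal_less_iff measure_nonneg)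
    have "\<exists>r>0. \<forall>s\<ge>0. \<bar>s - \<sigma>\<bar> < r \<longrightarrow> dist (g s) (g \<sigma>) \<le> (v + e) * \<bar>s - \<sigma>\<bar>"
      if "\<sigma> \<in> {a..b} - N" for \<sigma>
    proof -
      have "eventually (\<lambda>s. dist (g s) (g \<sigma>) / \<bar>s - \<sigma>\<bar> < v + e) (at \<sigma> within {0..})"
        using speed[OF that] e unfolding has_metric_speed_def
        by (intro order_tendstoD(2)) auto
      then obtain r where r: "r > 0" "\<And>s. s \<ge> 0 \<Longrightarrow> s \<noteq> \<sigma> \<Longrightarrow> \<bar>s - \<sigma>\<bar> < r \<Longrightarrow> dist (g s) (g \<sigma>) / \<bar>s - \<sigma>\<bar> < v + e"
        unfolding eventually_at by (auto simp: dist_real_def)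
      have "dist (g s) (g \<sigma>) \<le> (v + e) * \<bar>s - \<sigma>\<bar>" if "s \<ge> 0" "\<bar>s - \<sigma>\<bar> < r" for s
      proof (cases "s = \<sigma>")
        case False
        then show ?thesis using r(2)[OF that(1) False that(2)] by (simp add: divide_simps)
      qed auto
      then show ?thesis using r(1) by blast
    qed
    then obtain r where r: "\<And>\<sigma>. \<sigma> \<in> {a..b} - N \<Longrightarrow> r \<sigma> > 0"
      "\<And>\<sigma> s. \<sigma> \<in> {a..b} - N \<Longrightarrow> s \<ge> 0 \<Longrightarrow> \<bar>s - \<sigma>\<bar> < r \<sigma> \<Longrightarrow> dist (g s) (g \<sigma>) \<le> (v + e) * \<bar>s - \<sigma>\<bar>"
      by metis
    \<comment> \<open>Near a point of \<open>N\<close> a cell only has to stay in the small open set \<open>U\<close>.\<close>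
    define G where "G = (\<lambda>\<sigma>. if \<sigma> \<in> N then U else if \<sigma> \<in> {a..b} then ball \<sigma> (r \<sigma>) else ball \<sigma> 1)"
    have "gauge G"
      using U(1,2) r(1) by (auto simp: gauge_def G_def)
    then obtain p where p: "p tagged_division_of {a..b}" "G fine p"
      using fine_division_exists_real by blast
    have pfin: "finite p" using p(1) by auto
    have pK: "\<exists>l u. K = {l..u} \<and> l \<le> x \<and> x \<le> u \<and> a \<le> l \<and> u \<le> b \<and> K \<subseteq> G x"
      if "(x, K) \<in> p" for x K
    proof -
      from tagged_division_ofD(4)[OF p(1) that] obtain l u where K: "K = {l..u}"
        by (auto simp: box_real)
      moreover have "x \<in> K" "K \<subseteq> {a..b}"
        using tagged_division_ofD(2,3)[OF p(1) that] by auto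
      moreover have "K \<subseteq> G x" using p(2) that by (auto simp: fine_def)
      ultimately show ?thesis by auto
    qed
    define f where "f = (\<lambda>s. dist (g a) (g s))"
    \<comment> \<open>Degenerate cells are left out, because several tags may share one of them; they contribute nothing.\<close>
    define p1 where "p1 = {(x, K) \<in> p. x \<in> N \<and> interior K \<noteq> {}}"
    define F where "F = (\<lambda>(x::real, K::real set). (Inf K, Sup K))"
    define D where "D = F ` p1"
    have p1p: "p1 \<subseteq> p" by (auto simp: p1_def)
    have disj: "{Inf K<..<Sup K} \<inter> {Inf K'<..<Sup K'} = {}"
      if "(x, K) \<in> p" "(x', K') \<in> p" "(x, K) \<noteq> (x', K')" for x K x' K'
      using tagged_division_ofD(5)[OF p(1) that(1,2)] that(3) pK[OF that(1)] pK[OF that(2)]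
      by (auto simp: interior_atLeastAtMost_real)
    have ne: "Inf K < Sup K" if "(x, K) \<in> p1" for x K
      using that pK[of x K] by (auto simp: p1_def interior_atLeastAtMost_real)
    have inj: "inj_on F p1"
    proof (rule inj_onI, clarify)
      fix x K x' K' assume A: "(x, K) \<in> p1" "(x', K') \<in> p1" "F (x, K) = F (x', K')"
      show "x = x' \<and> K = K'"
      proof (rule ccontr)
        assume "\<not> ?thesis"
        then have "{Inf K<..<Sup K} \<inter> {Inf K'<..<Sup K'} = {}"
          using disj A p1p by blast
        then show False using ne[OF A(1)] A(3) by (simp add: F_def)
      qed
    qed
    have Dfin: "finite D" using pfin p1p by (auto simp: D_def intro: finite_subset)
    have Ddisj: "disjoint_family_on (\<lambda>(p, q). {p<..<q}) D"
      unfolding disjoint_family_on_def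
    proof (intro ballI impI)
      fix m n assume A: "m \<in> D" "n \<in> D" "m \<noteq> n"
      then obtain x K x' K' where "(x, K) \<in> p1" "(x', K') \<in> p1" "m = F (x, K)" "n = F (x', K')"
        by (auto simp: D_def)
      then show "(case m of (p, q) \<Rightarrow> {p<..<q}) \<inter> (case n of (p, q) \<Rightarrow> {p<..<q}) = {}"
        using disj[of x K x' K'] p1p A(3) by (auto simp: F_def)
    qed
    have DU: "{l<..<u} \<subseteq> U \<and> a \<le> l \<and> l \<le> u \<and> u \<le> b" if lu: "(l, u) \<in> D" for l u
    proof -
      obtain x K where xK: "(x, K) \<in> p1" "F (x, K) = (l, u)" using lu by (auto simp: D_def)
      then have "(x, K) \<in> p" "x \<in> N" by (auto simp: p1_def)
      from pK[OF this(1)] obtain l' u' where *: "K = {l'..u'}" "l' \<le> x" "x \<le> u'" "a \<le> l'" "u' \<le> b" "K \<subseteq> G x"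
        by blast
      then have "l' = l" "u' = u" using xK(2) by (auto simp: F_def)
      with * \<open>x \<in> N\<close> show ?thesis by (auto simp: G_def greaterThanLessThan_subseteq_atLeastAtMost_iff intro: subset_trans[of _ "{l..u}"])
    qed
    have "(\<Sum>(l, u)\<in>D. u - l) = (\<Sum>i\<in>D. measure lebesgue (case i of (l, u) \<Rightarrow> {l<..<u}))"
      using DU by (intro sum.cong) auto
    also have "\<dots> = measure lebesgue (\<Union>i\<in>D. case i of (l, u) \<Rightarrow> {l<..<u})"
      using DU by (intro measure_finite_Union[symmetric, OF Dfin _ Ddisj]) force+
    also have "\<dots> \<le> measure lebesgue U"
      using DU Dfin Umeas by (intro measure_mono_fmeasurable sets.finite_UN) auto
    finally have "(\<Sum>(l, u)\<in>D. u - l) < d" using Ud by simp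
    then have "(\<Sum>(l, u)\<in>D. dist (g l) (g u)) < e"
      using DU by (intro dD[OF Dfin _ Ddisj]) auto
    moreover have "(\<Sum>(l, u)\<in>D. dist (g l) (g u)) = (\<Sum>(x, K)\<in>p1. dist (g (Inf K)) (g (Sup K)))"
      unfolding D_def using inj by (subst sum.reindex) (auto simp: F_def intro!: sum.cong)
    ultimately have s1: "(\<Sum>(x, K)\<in>p1. dist (g (Inf K)) (g (Sup K))) < e" by simp
    have s2: "(\<Sum>(x, K)\<in>p. (v + e) * measure lborel K) = (v + e) * (b - a)"
    proof -
      have "(\<Sum>(x, K)\<in>p. measure lborel K) = b - a"
        using additive_content_tagged_division[of p a b] p(1) ab by (simp add: box_real)
      then show ?thesis by (simp add: sum_distrib_left[symmetric] case_prod_unfold)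
    qed
    have "dist (g a) (g b) = f b - f a" by (simp add: f_def)
    also have "\<dots> = (\<Sum>(x, K)\<in>p. f (Sup K) - f (Inf K))"
      using additive_tagged_division_1[OF ab(2) p(1), of f] by simp
    also have "\<dots> \<le> (\<Sum>(x, K)\<in>p. (v + e) * measure lborel K + (if (x, K) \<in> p1 then dist (g (Inf K)) (g (Sup K)) else 0))"
    proof (rule sum_mono, clarify)
      fix x K assume xK: "(x, K) \<in> p"
      from pK[OF xK] obtain l u where K: "K = {l..u}" "l \<le> x" "x \<le> u" "a \<le> l" "u \<le> b" "K \<subseteq> G x"
        by blast
      have fd: "f u - f l \<le> dist (g l) (g u)"
        unfolding f_def using dist_triangle[of "g a" "g u" "g l"] by simp
      show "f (Sup K) - f (Inf K) \<le> (v + e) * measure lborel K + (if (x, K) \<in> p1 then dist (g (Inf K)) (g (Sup K)) else 0)"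
      proof (cases "x \<in> N")
        case True
        show ?thesis
        proof (cases "l < u")
          case True
          then have "interior K \<noteq> {}" using K(1) by (simp add: interior_atLeastAtMost_real)
          with xK \<open>x \<in> N\<close> have "(x, K) \<in> p1" by (simp add: p1_def)
          moreover have "0 \<le> (v + e) * measure lborel K" using v e by simp
          moreover have "f (Sup K) - f (Inf K) \<le> dist (g (Inf K)) (g (Sup K))" using fd K(1-3) by simp
          ultimately show ?thesis by simp
        next
          case False
          then have "l = u" "Inf K = l" "Sup K = l" "measure lborel K = 0" using K(1-3) by auto
          then show ?thesis by simp
        qed
      next
        case False
        then have xN: "x \<in> {a..b} - N" using K by auto
        have "l \<in> K" "u \<in> K" using K(1-3) by auto
        moreover have "G x = ball x (r x)" using False K(2-5) by (simp add: G_def)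
        ultimately have "l \<in> ball x (r x)" "u \<in> ball x (r x)" using K(6) by auto
        then have "dist (g l) (g x) \<le> (v + e) * \<bar>l - x\<bar>" "dist (g u) (g x) \<le> (v + e) * \<bar>u - x\<bar>"
          using r(2)[OF xN, of l] r(2)[OF xN, of u] K(2-5) ab(1)
          by (simp_all add: dist_real_def)
        then have "dist (g l) (g u) \<le> (v + e) * \<bar>l - x\<bar> + (v + e) * \<bar>u - x\<bar>"
          using dist_triangle2[of "g l" "g u" "g x"] by linarith
        also have "\<dots> = (v + e) * (u - l)" using K by (simp add: algebra_simps)
        finally have "f (Sup K) - f (Inf K) \<le> (v + e) * measure lborel K"
          using fd K(1-3) by simp
        moreover have "(x, K) \<notin> p1" using False by (simp add: p1_def)
        ultimately show ?thesis by simp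
      qed
    qed
    also have "\<dots> = (\<Sum>(x, K)\<in>p. (v + e) * measure lborel K) + (\<Sum>(x, K)\<in>p. if (x, K) \<in> p1 then dist (g (Inf K)) (g (Sup K)) else 0)"
      by (simp add: sum.distrib case_prod_unfold)
    also have "(\<Sum>(x, K)\<in>p. if (x, K) \<in> p1 then dist (g (Inf K)) (g (Sup K)) else 0)
       = (\<Sum>(x, K)\<in>p1. dist (g (Inf K)) (g (Sup K)))"
      using sum.inter_restrict[OF pfin, of "\<lambda>z. dist (g (Inf (snd z))) (g (Sup (snd z)))" p1] p1p
      by (simp add: Int_absorb1 case_prod_unfold)
    finally show ?thesis using s1 s2 by linarith
  qed
  have le: "dist (g a) (g b) - v * (b - a) \<le> e * (b - a + 1)" if "e > 0" for e
  proof -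
    have "(v + e) * (b - a) + e = v * (b - a) + e * (b - a + 1)" by (simp add: algebra_simps)
    then show ?thesis using main[OF that] by linarith
  qed
  have "dist (g a) (g b) - v * (b - a) \<le> e" if "e > 0" for e
    using le[of "e / (b - a + 1)"] that ab by simp
  then have "dist (g a) (g b) - v * (b - a) \<le> 0" by (rule field_le_epsilon[of _ 0, simplified])
  then show ?thesis by simp
qed

section \<open>Lengths of inscribed polygons\<close>

fun chords :: "(real \<Rightarrow> 'a::metric_space) \<Rightarrow> real list \<Rightarrow> real" where
  "chords g (x # y # zs) = dist (g x) (g y) + chords g (y # zs)"
| "chords g _ = 0"

lemma chords_append: "chords g (xs @ y # ys) = chords g (xs @ [y]) + chords g (y # ys)"
proof (induction xs)
  case (Cons x xs) then show ?case by (cases xs) auto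
qed simp

lemma chords_insert_head: "chords g (x # ys) \<le> dist (g x) (g z) + chords g (z # ys)"
proof (cases ys)
  case (Cons y zs)
  then show ?thesis using dist_triangle[of "g x" "g y" "g z"] by simp
qed simp

lemma chords_insert: "chords g (xs @ ys) \<le> chords g (xs @ [z]) + chords g (z # ys)"
proof (induction xs)
  case Nil then show ?case by (cases ys) (auto)
next
  case (Cons x xs)
  then show ?case using chords_insert_head[of g x ys z] by (cases xs) auto
qed

lemma chords_map: "chords g (map f xs) = chords (\<lambda>x. g (f x)) xs"
  by (induction "\<lambda>x. g (f x)" xs rule: chords.induct) auto

lemma chords_cong: "(\<And>x. x \<in> set xs \<Longrightarrow> f x = g x) \<Longrightarrow> chords f xs = chords g xs"
  by (induction f xs rule: chords.induct) auto

lemma chords_eq_sum: "chords g xs = (\<Sum>i<length xs - 1. dist (g (xs ! i)) (g (xs ! Suc i)))"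
proof (induction g xs rule: chords.induct)
  case (1 g x y zs)
  then show ?case by (simp add: sum.lessThan_Suc_shift del: sum.lessThan_Suc)
qed auto

lemma chords_le_path_length:
  assumes "sorted xs" "set xs \<subseteq> {0..1}" "xs \<noteq> []"
  shows "ereal (chords g xs) \<le> path_length g"
proof -
  define n where "n = length xs - 1"
  have n: "i \<le> n \<longleftrightarrow> i < length xs" for i using assms(3) by (cases xs) (auto simp: n_def)
  have "mono_on {..n} ((!) xs)"
    using assms(1) by (auto intro!: mono_onI simp: n sorted_nth_mono)
  moreover have "(!) xs ` {..n} \<subseteq> {0..1}"
    using assms(2) n nth_mem by blast
  ultimately have "(n, (!) xs) \<in> {(n::nat, r). mono_on {..n} r \<and> r ` {..n} \<subseteq> {0..1}}"
    by simp
  from SUP_upper[OF this, of "\<lambda>(n, r). ereal (\<Sum>i<n. dist (g (r i)) (g (r (Suc i))))"]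
  show ?thesis unfolding path_length_def by (simp add: chords_eq_sum n_def)
qed

text \<open>
  The function \<open>G s = v s - dist (g p) (g s)\<close> is nondecreasing since \<open>g\<close> is \<open>v\<close>-Lipschitz, and its total
  increase on \<open>[p, q]\<close> is what the chord of \<open>g\<close> lacks from full length. Every point of \<open>E\<close> is an endpoint
  of arbitrarily short intervals over which \<open>G\<close> grows by at least \<open>\<eta>\<close> times their length. By Vitali's
  covering theorem, disjoint intervals of this kind cover almost all of \<open>E\<close>, so the measure of \<open>E\<close>
  is at most the increase of \<open>G\<close> divided by \<open>\<eta>\<close>.
\<close>
lemma slow_points_cover:
  fixes g :: "real \<Rightarrow> 'a::metric_space"
  assumes pq: "p \<le> q" and eta: "0 < \<eta>"
    and lip: "\<And>s t. \<lbrakk>s \<in> {p..q}; t \<in> {p..q}\<rbrakk> \<Longrightarrow> dist (g s) (g t) \<le> v * \<bar>s - t\<bar>"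
    and E: "E \<subseteq> {p<..<q}"
    and slow: "\<And>\<sigma> d. \<lbrakk>\<sigma> \<in> E; 0 < d\<rbrakk> \<Longrightarrow>
      \<exists>s. s \<noteq> \<sigma> \<and> \<bar>s - \<sigma>\<bar> < d \<and> dist (g s) (g \<sigma>) < (v - \<eta>) * \<bar>s - \<sigma>\<bar>"
  obtains U where "U \<in> lmeasurable" "E \<subseteq> U"
    "measure lebesgue U \<le> (v * (q - p) - dist (g p) (g q)) / \<eta>"
proof -
  define K where "K = {(x, y). p \<le> x \<and> x < y \<and> y \<le> q \<and> dist (g x) (g y) < (v - \<eta>) * (y - x)}"
  define c where "c = (\<lambda>(x::real, y::real). (x + y) / 2)"
  define r where "r = (\<lambda>(x::real, y::real). (y - x) / 2)"
  have cball: "cball (c i) (r i) = {fst i..snd i}" for i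
    by (cases i) (auto simp: c_def r_def cball_eq_atLeastAtMost field_simps)
  have rpos: "0 < r i" if "i \<in> K" for i using that by (auto simp: K_def r_def)
  have ex: "\<exists>i. i \<in> K \<and> x \<in> cball (c i) (r i) \<and> r i < d" if x: "x \<in> E" and d: "0 < d" for x d
  proof -
    have "p < x" "x < q" using E x by auto
    then have "0 < min d (min (x - p) (q - x))" using d by simp
    from slow[OF x this] obtain s where s: "s \<noteq> x" "\<bar>s - x\<bar> < d" "\<bar>s - x\<bar> < x - p" "\<bar>s - x\<bar> < q - x"
      "dist (g s) (g x) < (v - \<eta>) * \<bar>s - x\<bar>" by auto
    then have "(min s x, max s x) \<in> K" by (auto simp: K_def min_def max_def dist_commute)
    moreover have "r (min s x, max s x) < d" using s d by (auto simp: r_def min_def max_def)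
    ultimately show ?thesis unfolding cball by (intro exI[of _ "(min s x, max s x)"]) auto
  qed
  obtain C where C: "countable C" "C \<subseteq> K"
    "pairwise (\<lambda>i j. disjnt (cball (c i) (r i)) (cball (c j) (r j))) C"
    "negligible (E - (\<Union>i\<in>C. cball (c i) (r i)))"
    by (rule Vitali_covering_theorem_cballs[of K r E c, OF rpos ex])
  define G where "G = (\<lambda>s. v * s - dist (g p) (g s))"
  have G_mono: "G s \<le> G t" if "s \<in> {p..q}" "t \<in> {p..q}" "s \<le> t" for s t
  proof -
    have "dist (g s) (g t) \<le> v * t - v * s"
      using lip[OF that(1,2)] that(3) by (simp add: abs_real_def right_diff_distrib split: if_splits)
    then show ?thesis using dist_triangle[of "g p" "g t" "g s"] by (simp add: G_def)
  qed
  have G_incr: "\<eta> * (y - x) \<le> G y - G x" if "(x, y) \<in> K" for x y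
    using that dist_triangle[of "g p" "g y" "g x"] by (simp add: K_def G_def algebra_simps)
  have fin: "measure lebesgue (\<Union>i\<in>J. cball (c i) (r i)) \<le> (G q - G p) / \<eta>"
    if J: "J \<subseteq> C" "finite J" for J
  proof -
    have sep: "y \<le> x' \<or> y' \<le> x" if "(x, y) \<in> J" "(x', y') \<in> J" "(x, y) \<noteq> (x', y')" for x y x' y'
    proof -
      have "disjnt {x..y} {x'..y'}" using C(3) J(1) that unfolding cball pairwise_def by force
      moreover have "x < y" "x' < y'" using that J C(2) by (auto simp: K_def)
      ultimately show ?thesis by (auto simp: disjnt_def)
    qed
    have KJ: "p \<le> x \<and> x < y \<and> y \<le> q" "(x, y) \<in> K" if "(x, y) \<in> J" for x y
      using that J C(2) by (auto simp: K_def)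
    have disj: "disjoint_family_on (\<lambda>(x, y). {G x<..<G y}) J"
      unfolding disjoint_family_on_def
    proof (intro ballI impI)
      fix i j assume ij: "i \<in> J" "j \<in> J" "i \<noteq> j"
      obtain x y x' y' where "i = (x, y)" "j = (x', y')" by (cases i, cases j)
      moreover from this ij sep[of x y x' y'] have "G y \<le> G x' \<or> G y' \<le> G x"
        using KJ(1)[of x y] KJ(1)[of x' y'] by (auto intro!: G_mono)
      ultimately show "(case i of (x, y) \<Rightarrow> {G x<..<G y}) \<inter> (case j of (x, y) \<Rightarrow> {G x<..<G y}) = {}"
        by auto
    qed
    have Gle: "G x \<le> G y" if "(x, y) \<in> J" for x y using KJ(1)[OF that] by (intro G_mono) auto
    have "measure lebesgue (\<Union>i\<in>J. cball (c i) (r i)) \<le> (\<Sum>i\<in>J. measure lebesgue (cball (c i) (r i)))"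
      using J(2) by (intro measure_UNION_le) auto
    also have "\<dots> \<le> (\<Sum>(x, y)\<in>J. (G y - G x) / \<eta>)"
    proof (rule sum_mono)
      fix i assume "i \<in> J"
      moreover obtain x y where "i = (x, y)" by (cases i)
      ultimately have "x < y" "(x, y) \<in> K" using KJ by auto
      then show "measure lebesgue (cball (c i) (r i)) \<le> (case i of (x, y) \<Rightarrow> (G y - G x) / \<eta>)"
        using G_incr[of x y] eta \<open>i = (x, y)\<close> by (simp add: cball pos_le_divide_eq mult.commute)
    qed
    also have "\<dots> = (\<Sum>(x, y)\<in>J. G y - G x) / \<eta>"
      by (simp add: sum_divide_distrib case_prod_unfold)
    also have "(\<Sum>(x, y)\<in>J. G y - G x) = (\<Sum>i\<in>J. measure lebesgue (case i of (x, y) \<Rightarrow> {G x<..<G y}))"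
      using Gle by (intro sum.cong) auto
    also have "\<dots> = measure lebesgue (\<Union>i\<in>J. case i of (x, y) \<Rightarrow> {G x<..<G y})"
      using Gle by (intro measure_finite_Union[symmetric] J(2) disj) force+
    also have "\<dots> \<le> measure lebesgue {G p..G q}"
    proof (rule measure_mono_fmeasurable)
      show "(\<Union>i\<in>J. case i of (x, y) \<Rightarrow> {G x<..<G y}) \<subseteq> {G p..G q}"
      proof
        fix z assume "z \<in> (\<Union>i\<in>J. case i of (x, y) \<Rightarrow> {G x<..<G y})"
        then obtain x y where xy: "(x, y) \<in> J" "G x < z" "z < G y" by auto
        then have "G p \<le> G x" "G y \<le> G q" using KJ(1)[OF xy(1)] by (auto intro!: G_mono)
        then show "z \<in> {G p..G q}" using xy by auto
      qed
      show "(\<Union>i\<in>J. case i of (x, y) \<Rightarrow> {G x<..<G y}) \<in> sets lebesgue"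
        using J(2) by (intro sets.finite_UN) auto
    qed simp
    also have "\<dots> = G q - G p" using G_mono[of p q] pq by simp
    finally show ?thesis using eta by (simp add: divide_right_mono)
  qed
  let ?V = "\<Union>i\<in>C. cball (c i) (r i)"
  have V: "?V \<in> lmeasurable" "measure lebesgue ?V \<le> (G q - G p) / \<eta>"
    using fmeasurable_UN_bound[OF C(1), of "\<lambda>i. cball (c i) (r i)" lebesgue "(G q - G p) / \<eta>"]
      measure_UN_bound[OF C(1), of "\<lambda>i. cball (c i) (r i)" lebesgue "(G q - G p) / \<eta>"] fin by auto
  show thesis
  proof
    show "?V \<union> (E - ?V) \<in> lmeasurable"
      by (rule fmeasurable.Un[OF V(1) negligible_imp_measurable[OF C(4)]])
    have "measure lebesgue (?V \<union> (E - ?V)) \<le> measure lebesgue ?V + measure lebesgue (E - ?V)"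
      using fmeasurableD[OF V(1)] negligible_imp_sets[OF C(4)] by (intro measure_Un_le)
    also have "measure lebesgue (E - ?V) = 0" using C(4) by (rule negligible_imp_measure0)
    finally show "measure lebesgue (?V \<union> (E - ?V)) \<le> (v * (q - p) - dist (g p) (g q)) / \<eta>"
      using V(2) by (simp add: G_def algebra_simps)
  qed auto
qed

text \<open>
  Cell by cell, the measure of the set of slow points is controlled by the difference between
  \<open>v\<close> times the length of the interval and the length of an inscribed polygon.
\<close>
lemma slow_points_cover_chords:
  fixes g :: "real \<Rightarrow> 'a::metric_space"
  assumes eta: "0 < \<eta>" and xs: "sorted (a # xs)"
    and lip: "\<And>s t. \<lbrakk>s \<in> {a..last (a # xs)}; t \<in> {a..last (a # xs)}\<rbrakk> \<Longrightarrow> dist (g s) (g t) \<le> v * \<bar>s - t\<bar>"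
    and slow: "\<And>\<sigma> d. \<lbrakk>\<sigma> \<in> E; 0 < d\<rbrakk> \<Longrightarrow>
      \<exists>s. s \<noteq> \<sigma> \<and> \<bar>s - \<sigma>\<bar> < d \<and> dist (g s) (g \<sigma>) < (v - \<eta>) * \<bar>s - \<sigma>\<bar>"
  shows "\<exists>U \<in> lmeasurable. E \<inter> {a..last (a # xs)} \<subseteq> U \<and>
    measure lebesgue U \<le> (v * (last (a # xs) - a) - chords g (a # xs)) / \<eta>"
  using xs lip
proof (induction xs arbitrary: a)
  case Nil
  then show ?case by (intro bexI[of _ "{a}"]) (auto intro: negligible_imp_measurable)
next
  case (Cons b xs)
  let ?l = "last (b # xs)"
  have ab: "a \<le> b" "b \<le> ?l" using Cons.prems(1) by (cases xs rule: rev_cases; auto)+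
  have "\<exists>U \<in> lmeasurable. E \<inter> {b..?l} \<subseteq> U \<and>
    measure lebesgue U \<le> (v * (?l - b) - chords g (b # xs)) / \<eta>"
    using Cons.prems ab by (intro Cons.IH) auto
  then obtain U1 where U1: "U1 \<in> lmeasurable" "E \<inter> {b..?l} \<subseteq> U1"
    "measure lebesgue U1 \<le> (v * (?l - b) - chords g (b # xs)) / \<eta>" by blast
  have "\<exists>U. U \<in> lmeasurable \<and> E \<inter> {a<..<b} \<subseteq> U \<and> measure lebesgue U \<le> (v * (b - a) - dist (g a) (g b)) / \<eta>"
    by (rule slow_points_cover[of a b \<eta> g v "E \<inter> {a<..<b}"]) (use Cons.prems(2) ab eta slow in auto)
  then obtain U2 where U2: "U2 \<in> lmeasurable" "E \<inter> {a<..<b} \<subseteq> U2"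
    "measure lebesgue U2 \<le> (v * (b - a) - dist (g a) (g b)) / \<eta>" by blast
  let ?U = "U1 \<union> U2 \<union> {a}"
  have "measure lebesgue ?U \<le> measure lebesgue U1 + measure lebesgue U2 + measure lebesgue {a}"
    using measure_Un_le[of "U1 \<union> U2" lebesgue "{a}"] measure_Un_le[of U1 lebesgue U2] U1(1) U2(1)
    by (simp add: fmeasurableD)
  also have "\<dots> \<le> (v * (?l - b) - chords g (b # xs)) / \<eta> + (v * (b - a) - dist (g a) (g b)) / \<eta>"
    using U1(3) U2(3) by simp
  also have "\<dots> = (v * (?l - a) - chords g (a # b # xs)) / \<eta>"
    by (simp add: add_divide_distrib[symmetric] algebra_simps)
  finally have "measure lebesgue ?U \<le> (v * (last (a # b # xs) - a) - chords g (a # b # xs)) / \<eta>"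
    by simp
  moreover have "?U \<in> lmeasurable"
    using U1(1) U2(1) by (intro fmeasurable.Un) (auto intro: negligible_imp_measurable)
  moreover have "E \<inter> {a..last (a # b # xs)} \<subseteq> ?U"
  proof
    fix x assume x: "x \<in> E \<inter> {a..last (a # b # xs)}"
    then have "x \<in> E" "a \<le> x" "x \<le> ?l" by simp_all
    then consider "x = a" | "x \<in> E \<inter> {a<..<b}" | "x \<in> E \<inter> {b..?l}"
      by (metis IntI atLeastAtMost_iff greaterThanLessThan_iff less_le not_le)
    then show "x \<in> ?U" using U1(2) U2(2) by cases blast+
  qed
  ultimately show ?case by blast
qed

section \<open>Constant speed curves in length spaces\<close>

text \<open>
  A Lipschitz curve whose inscribed polygons come arbitrarily close to the largest possible length
  has no set of slow points of positive outer measure, so its metric speed equals the Lipschitz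
  constant almost everywhere.
\<close>
lemma full_length_imp_speed:
  fixes g :: "real \<Rightarrow> 'a::metric_space"
  assumes lip: "\<And>s t. \<lbrakk>s \<in> {a..b}; t \<in> {a..b}\<rbrakk> \<Longrightarrow> dist (g s) (g t) \<le> v * \<bar>s - t\<bar>"
    and full: "\<And>\<kappa>. 0 < \<kappa> \<Longrightarrow> \<exists>xs. sorted (a # xs @ [b]) \<and> v * (b - a) - \<kappa> < chords g (a # xs @ [b])"
  shows "negligible {\<sigma> \<in> {a<..<b}. \<not> ((\<lambda>s. dist (g s) (g \<sigma>) / \<bar>s - \<sigma>\<bar>) \<longlongrightarrow> v) (at \<sigma>)}"
proof -
  define E where "E = (\<lambda>\<eta>. {\<sigma> \<in> {a<..<b}. \<forall>d>0. \<exists>s. s \<noteq> \<sigma> \<and> \<bar>s - \<sigma>\<bar> < d \<and> dist (g s) (g \<sigma>) < (v - \<eta>) * \<bar>s - \<sigma>\<bar>})"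
  have neg: "negligible (E \<eta>)" if eta: "0 < \<eta>" for \<eta>
    unfolding negligible_outer_le
  proof (intro allI impI)
    fix e :: real assume "0 < e"
    then obtain xs where xs: "sorted (a # xs @ [b])" "v * (b - a) - e * \<eta> < chords g (a # xs @ [b])"
      using full[of "e * \<eta>"] eta by auto
    have "\<exists>U \<in> lmeasurable. E \<eta> \<inter> {a..last (a # xs @ [b])} \<subseteq> U \<and>
      measure lebesgue U \<le> (v * (last (a # xs @ [b]) - a) - chords g (a # xs @ [b])) / \<eta>"
      by (rule slow_points_cover_chords[OF eta xs(1)]) (use lip in \<open>auto simp: E_def\<close>)
    then obtain U where U: "U \<in> lmeasurable" "E \<eta> \<inter> {a..b} \<subseteq> U"
      "measure lebesgue U \<le> (v * (b - a) - chords g (a # xs @ [b])) / \<eta>" by auto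
    note U(3)
    also have "(v * (b - a) - chords g (a # xs @ [b])) / \<eta> \<le> e"
      using xs(2) eta by (simp add: field_simps)
    finally show "\<exists>T. E \<eta> \<subseteq> T \<and> T \<in> lmeasurable \<and> measure lebesgue T \<le> e"
      using U by (intro exI[of _ U]) (auto simp: E_def)
  qed
  have "{\<sigma> \<in> {a<..<b}. \<not> ((\<lambda>s. dist (g s) (g \<sigma>) / \<bar>s - \<sigma>\<bar>) \<longlongrightarrow> v) (at \<sigma>)} \<subseteq> (\<Union>n. E (1 / real (Suc n)))"
  proof (rule subsetI, rule ccontr)
    fix \<sigma> assume A: "\<sigma> \<in> {\<sigma> \<in> {a<..<b}. \<not> ((\<lambda>s. dist (g s) (g \<sigma>) / \<bar>s - \<sigma>\<bar>) \<longlongrightarrow> v) (at \<sigma>)}"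
      and B: "\<sigma> \<notin> (\<Union>n. E (1 / real (Suc n)))"
    have \<sigma>: "a < \<sigma>" "\<sigma> < b" using A by auto
    have "((\<lambda>s. dist (g s) (g \<sigma>) / \<bar>s - \<sigma>\<bar>) \<longlongrightarrow> v) (at \<sigma>)"
    proof (rule tendstoI)
      fix e :: real assume e: "0 < e"
      obtain n where n: "1 / real (Suc n) < e" using e nat_approx_posE by blast
      from B \<sigma> have "\<not> (\<forall>d>0. \<exists>s. s \<noteq> \<sigma> \<and> \<bar>s - \<sigma>\<bar> < d \<and> dist (g s) (g \<sigma>) < (v - 1 / real (Suc n)) * \<bar>s - \<sigma>\<bar>)"
        by (auto simp: E_def simp del: of_nat_Suc)
      then obtain d where d: "d > 0" "\<And>s. s \<noteq> \<sigma> \<Longrightarrow> \<bar>s - \<sigma>\<bar> < d \<Longrightarrow> (v - 1 / real (Suc n)) * \<bar>s - \<sigma>\<bar> \<le> dist (g s) (g \<sigma>)"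
        by (meson not_le)
      show "\<forall>\<^sub>F s in at \<sigma>. dist (dist (g s) (g \<sigma>) / \<bar>s - \<sigma>\<bar>) v < e"
        unfolding eventually_at
      proof (intro exI[of _ "min d (min (\<sigma> - a) (b - \<sigma>))"] conjI ballI impI)
        fix s assume s: "s \<noteq> \<sigma> \<and> dist s \<sigma> < min d (min (\<sigma> - a) (b - \<sigma>))"
        have "dist (g s) (g \<sigma>) \<le> v * \<bar>s - \<sigma>\<bar>" using s \<sigma> by (intro lip) (auto simp: dist_real_def)
        then have "dist (g s) (g \<sigma>) / \<bar>s - \<sigma>\<bar> \<le> v" using s by (simp add: field_simps)
        moreover have "v - 1 / real (Suc n) \<le> dist (g s) (g \<sigma>) / \<bar>s - \<sigma>\<bar>"
          using d(2)[of s] s by (simp add: dist_real_def pos_le_divide_eq)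
        ultimately show "dist (dist (g s) (g \<sigma>) / \<bar>s - \<sigma>\<bar>) v < e"
          using n by (simp add: dist_real_def del: of_nat_Suc)
      qed (use d(1) \<sigma> in auto)
    qed
    with A show False by simp
  qed
  moreover have "negligible (\<Union>n. E (1 / real (Suc n)))"
    using neg by (intro negligible_countable_Union) auto
  ultimately show ?thesis by (rule negligible_subset[rotated])
qed

lemma sorted_map_of_mono:
  "\<lbrakk>sorted xs; \<And>x y. \<lbrakk>x \<in> set xs; y \<in> set xs; x \<le> y\<rbrakk> \<Longrightarrow> f x \<le> f y\<rbrakk> \<Longrightarrow> sorted (map f xs)"
  by (induction xs) auto

definition arclength :: "(real \<Rightarrow> 'a::metric_space) \<Rightarrow> real \<Rightarrow> real" where
  "arclength g t = (SUP xs\<in>{xs. sorted (0 # xs @ [t])}. chords g (0 # xs @ [t]))"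

text \<open>
  Reparametrization of a rectifiable path by arc length. The only delicate point is the continuity
  of the arc length, which makes it map onto a full interval.
\<close>
locale rectifiable_path =
  fixes g :: "real \<Rightarrow> 'a::metric_space" and B :: real
  assumes cont: "continuous_on {0..1} g"
    and bound: "\<And>xs. \<lbrakk>sorted xs; set xs \<subseteq> {0..1}\<rbrakk> \<Longrightarrow> chords g xs \<le> B"
begin

lemma arclength_upper:
  assumes "sorted (0 # xs @ [t])" "t \<le> 1"
  shows "chords g (0 # xs @ [t]) \<le> arclength g t"
proof -
  have "chords g (0 # ys @ [t]) \<le> B" if "sorted (0 # ys @ [t])" for ys
  proof (rule bound[OF that])
    show "set (0 # ys @ [t]) \<subseteq> {0..1}" using that assms(2) by (auto simp: sorted_append)
  qed
  then have "bdd_above ((\<lambda>xs. chords g (0 # xs @ [t])) ` {xs. sorted (0 # xs @ [t])})"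
    by (intro bdd_aboveI2[of _ _ B]) simp
  from cSUP_upper[OF _ this, of xs] assms(1) show ?thesis unfolding arclength_def by blast
qed

lemma arclength_least:
  assumes "0 \<le> t" "\<And>xs. sorted (0 # xs @ [t]) \<Longrightarrow> chords g (0 # xs @ [t]) \<le> c"
  shows "arclength g t \<le> c"
  unfolding arclength_def using assms by (intro cSUP_least) (auto intro!: exI[of _ "[]"])

lemma arclength_approx:
  assumes "0 \<le> t" "t \<le> 1" "0 < \<kappa>"
  obtains xs where "sorted (0 # xs @ [t])" "arclength g t - \<kappa> < chords g (0 # xs @ [t])"
proof -
  have "\<not> (\<forall>xs. sorted (0 # xs @ [t]) \<longrightarrow> chords g (0 # xs @ [t]) \<le> arclength g t - \<kappa>)"
    using arclength_least[of t "arclength g t - \<kappa>"] assms by auto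
  then show thesis using that by (auto simp: not_le)
qed

lemma arclength_0: "arclength g 0 = 0"
proof (rule antisym)
  show "arclength g 0 \<le> 0"
  proof (rule arclength_least)
    fix xs :: "real list" assume "sorted (0 # xs @ [0])"
    then have "x = 0" if "x \<in> set (0 # xs @ [0])" for x
      using that by (force simp: sorted_append)
    then have "chords g (0 # xs @ [0]) = chords (\<lambda>_. g 0) (0 # xs @ [0])"
      by (intro chords_cong) metis
    then show "chords g (0 # xs @ [0]) \<le> 0" by (simp add: chords_eq_sum)
  qed simp
  show "0 \<le> arclength g 0" using arclength_upper[of "[]" 0] by simp
qed

lemma sorted_join:
  assumes "sorted (xs @ [a])" "sorted (a # ys)"
  shows "sorted (xs @ a # (ys :: real list))"
proof -
  have "x \<le> y" if "x \<in> set xs" "y \<in> set ys" for x y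
  proof -
    have "x \<le> a" using assms(1) that by (simp add: sorted_append)
    also have "a \<le> y" using assms(2) that by simp
    finally show ?thesis .
  qed
  then show ?thesis using assms by (simp add: sorted_append)
qed

lemma chords_le_arclength_diff:
  assumes "0 \<le> t" "sorted (t # xs @ [t'])" "t' \<le> 1"
  shows "arclength g t + chords g (t # xs @ [t']) \<le> arclength g t'"
proof -
  have "arclength g t \<le> arclength g t' - chords g (t # xs @ [t'])"
  proof (rule arclength_least[OF assms(1)])
    fix ys assume ys: "sorted (0 # ys @ [t])"
    then have "sorted (0 # (ys @ t # xs) @ [t'])"
      using sorted_join[of "0 # ys" t "xs @ [t']"] assms(2) by simp
    from arclength_upper[OF this assms(3)]
    show "chords g (0 # ys @ [t]) \<le> arclength g t' - chords g (t # xs @ [t'])"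
      using chords_append[of g "0 # ys" t "xs @ [t']"] by simp
  qed
  then show ?thesis by simp
qed

lemma dist_le_arclength:
  assumes "0 \<le> t" "t \<le> t'" "t' \<le> 1"
  shows "dist (g t) (g t') \<le> arclength g t' - arclength g t"
  using chords_le_arclength_diff[of t "[]" t'] assms by simp

lemma arclength_mono: "\<lbrakk>0 \<le> t; t \<le> t'; t' \<le> 1\<rbrakk> \<Longrightarrow> arclength g t \<le> arclength g t'"
  using dist_le_arclength[of t t'] zero_le_dist[of "g t" "g t'"] by linarith

text \<open>
  Let a polygon have no vertex strictly between \<open>t\<close> and \<open>t'\<close>. Inserting these two points as vertices
  does not shorten it, and all of it except the chord from \<open>t\<close> to \<open>t'\<close> is bounded by arc length. For a polygon
  that is almost as long as the path, this leaves little room for an increase of the arc length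
  between \<open>t\<close> and \<open>t'\<close> beyond \<open>dist (g t) (g t')\<close>, whence continuity.
\<close>
lemma arclength_gap:
  assumes xs: "sorted (0 # xs @ [1])" and t: "0 \<le> t" "t < t'" "t' \<le> 1"
    and gap: "\<And>x. x \<in> set xs \<Longrightarrow> x \<le> t \<or> t' \<le> x"
  shows "chords g (0 # xs @ [1]) \<le> arclength g t + dist (g t) (g t') + (arclength g 1 - arclength g t')"
proof -
  define A where "A = takeWhile (\<lambda>x. x \<le> t) xs"
  define B where "B = dropWhile (\<lambda>x. x \<le> t) xs"
  have AB: "xs = A @ B" by (simp add: A_def B_def)
  have sxs: "sorted xs" "set xs \<subseteq> {0..1}" using xs by (auto simp: sorted_append)
  have sAB: "sorted A" "sorted B" "set A \<subseteq> {0..1}" "set B \<subseteq> {0..1}"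
    using sxs by (simp_all add: AB sorted_append)
  have "x \<le> t" if "x \<in> set A" for x using that unfolding A_def by (auto dest: set_takeWhileD)
  then have A: "sorted (0 # A @ [t])" using sAB t(1) by (auto simp: sorted_append)
  have Bt: "t' \<le> x" if x: "x \<in> set B" for x
  proof -
    have "B \<noteq> []" using x by auto
    then have "\<not> hd B \<le> t" unfolding B_def by (rule hd_dropWhile)
    moreover have "hd B \<le> x" using sAB(2) x by (cases B) auto
    moreover have "x \<le> t \<or> t' \<le> x" using gap[of x] x by (simp add: AB)
    ultimately show ?thesis by linarith
  qed
  have B: "sorted (t' # B @ [1])" using sAB(2,4) t(3) Bt by (auto simp: sorted_append)
  have "chords g (0 # xs @ [1]) \<le> chords g (0 # A @ [t]) + chords g (t # B @ [1])"
    using chords_insert[of g "0 # A" "B @ [1]" t] by (simp add: AB)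
  also have "chords g (t # B @ [1]) \<le> dist (g t) (g t') + chords g (t' # B @ [1])"
    by (rule chords_insert_head)
  also have "chords g (0 # A @ [t]) \<le> arclength g t"
    using A t by (intro arclength_upper) auto
  also have "chords g (t' # B @ [1]) \<le> arclength g 1 - arclength g t'"
    using chords_le_arclength_diff[OF _ B] t by simp
  finally show ?thesis by simp
qed

lemma continuous_arclength: "continuous_on {0..1} (arclength g)"
  unfolding continuous_on_iff
proof (intro ballI allI impI)
  fix t e :: real assume t: "t \<in> {0..1}" and e: "0 < e"
  obtain xs where xs: "sorted (0 # xs @ [1])" "arclength g 1 - e / 2 < chords g (0 # xs @ [1])"
    using arclength_approx[of 1 "e / 2"] e by auto
  obtain d1 where d1: "d1 > 0" "\<And>x. x \<in> set xs \<Longrightarrow> x \<noteq> t \<Longrightarrow> d1 \<le> dist t x"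
    using finite_set_avoid[of "set xs" t] by auto
  obtain d2 where d2: "d2 > 0" "\<And>s. s \<in> {0..1} \<Longrightarrow> dist s t < d2 \<Longrightarrow> dist (g s) (g t) < e / 2"
    using cont[unfolded continuous_on_iff, rule_format, OF t, of "e / 2"] e by auto
  have gap: "arclength g b - arclength g a < e"
    if "0 \<le> a" "a < b" "b \<le> 1" "a = t \<or> b = t" "b - a < min d1 d2" for a b
  proof -
    have "x \<le> a \<or> b \<le> x" if "x \<in> set xs" for x
      using d1(2)[OF that] \<open>a = t \<or> b = t\<close> \<open>b - a < min d1 d2\<close> \<open>a < b\<close>
      by (cases "x = t") (auto simp: dist_real_def abs_if split: if_splits)
    then have "chords g (0 # xs @ [1]) \<le> arclength g a + dist (g a) (g b) + (arclength g 1 - arclength g b)"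
      using that xs(1) by (intro arclength_gap) auto
    moreover have "dist (g a) (g b) < e / 2"
      using d2(2)[of a] d2(2)[of b] that t by (auto simp: dist_real_def dist_commute)
    ultimately show ?thesis using xs(2) by linarith
  qed
  show "\<exists>d>0. \<forall>s\<in>{0..1}. dist s t < d \<longrightarrow> dist (arclength g s) (arclength g t) < e"
  proof (intro exI[of _ "min d1 d2"] conjI ballI impI)
    fix s :: real assume s: "s \<in> {0..1}" "dist s t < min d1 d2"
    consider "s < t" | "s = t" | "t < s" by linarith
    then show "dist (arclength g s) (arclength g t) < e"
    proof cases
      case 1
      then show ?thesis using gap[of s t] arclength_mono[of s t] s t by (auto simp: dist_real_def)
    next
      case 2
      then show ?thesis using e by simp
    next
      case 3
      then show ?thesis using gap[of t s] arclength_mono[of t s] s t by (auto simp: dist_real_def)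
    qed
  qed (use d1 d2 in auto)
qed

text \<open>
  The choice of the inverse image under arc length is immaterial, since \<open>g\<close> is constant wherever
  arc length is.
\<close>
lemma unit_speed_reparametrization:
  obtains \<gamma> where "\<gamma> 0 = g 0" "\<gamma> (arclength g 1) = g 1"
    "\<And>s t. \<lbrakk>s \<in> {0..arclength g 1}; t \<in> {0..arclength g 1}\<rbrakk> \<Longrightarrow> dist (\<gamma> s) (\<gamma> t) \<le> \<bar>s - t\<bar>"
    "\<And>\<kappa>. 0 < \<kappa> \<Longrightarrow> \<exists>xs. sorted (0 # xs @ [arclength g 1])
        \<and> arclength g 1 - \<kappa> < chords \<gamma> (0 # xs @ [arclength g 1])"
proof -
  define \<tau> where "\<tau> = (\<lambda>\<sigma>. SOME t. t \<in> {0..1} \<and> arclength g t = \<sigma>)"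
  have \<tau>: "\<tau> \<sigma> \<in> {0..1} \<and> arclength g (\<tau> \<sigma>) = \<sigma>" if "\<sigma> \<in> {0..arclength g 1}" for \<sigma>
  proof -
    have "\<exists>t\<ge>0. t \<le> 1 \<and> arclength g t = \<sigma>"
      using IVT'[of "arclength g" 0 \<sigma> 1] that arclength_0 continuous_arclength by auto
    then have "\<exists>t. t \<in> {0..1} \<and> arclength g t = \<sigma>" by auto
    then show ?thesis unfolding \<tau>_def by (rule someI_ex)
  qed
  have dd: "dist (g s) (g t) \<le> \<bar>arclength g s - arclength g t\<bar>" if "s \<in> {0..1}" "t \<in> {0..1}" for s t
    using dist_le_arclength[of s t] dist_le_arclength[of t s] that dist_commute[of "g s" "g t"]
    by (cases "s \<le> t") auto
  have rng: "arclength g t \<in> {0..arclength g 1}" if "t \<in> {0..1}" for t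
    using arclength_mono[of 0 t] arclength_mono[of t 1] that arclength_0 by auto
  have eq: "g (\<tau> (arclength g t)) = g t" if "t \<in> {0..1}" for t
    using dd[of "\<tau> (arclength g t)" t] \<tau>[OF rng[OF that]] that by simp
  show thesis
  proof (rule that[of "\<lambda>\<sigma>. g (\<tau> \<sigma>)"])
    show "g (\<tau> 0) = g 0" using eq[of 0] arclength_0 by simp
    show "g (\<tau> (arclength g 1)) = g 1" using eq[of 1] by simp
    show "dist (g (\<tau> s)) (g (\<tau> t)) \<le> \<bar>s - t\<bar>" if "s \<in> {0..arclength g 1}" "t \<in> {0..arclength g 1}" for s t
      using dd[of "\<tau> s" "\<tau> t"] \<tau>[OF that(1)] \<tau>[OF that(2)] by simp
    fix \<kappa> :: real assume "0 < \<kappa>"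
    then obtain xs where xs: "sorted (0 # xs @ [1])" "arclength g 1 - \<kappa> < chords g (0 # xs @ [1])"
      using arclength_approx[of 1 \<kappa>] by auto
    have "set (0 # xs @ [1]) \<subseteq> {0..1}" using xs(1) by (auto simp: sorted_append)
    then have "chords (\<lambda>t. g (\<tau> (arclength g t))) (0 # xs @ [1]) = chords g (0 # xs @ [1])"
      by (intro chords_cong eq) auto
    then have "chords (\<lambda>\<sigma>. g (\<tau> \<sigma>)) (map (arclength g) (0 # xs @ [1])) = chords g (0 # xs @ [1])"
      by (simp only: chords_map)
    moreover have "sorted (map (arclength g) (0 # xs @ [1]))"
      using xs(1) \<open>set (0 # xs @ [1]) \<subseteq> {0..1}\<close>
      by (intro sorted_map_of_mono arclength_mono) auto
    ultimately show "\<exists>ys. sorted (0 # ys @ [arclength g 1])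
        \<and> arclength g 1 - \<kappa> < chords (\<lambda>\<sigma>. g (\<tau> \<sigma>)) (0 # ys @ [arclength g 1])"
      using xs(2) arclength_0 by (intro exI[of _ "map (arclength g) xs"]) auto
  qed
qed

end

definition constant_speed :: "real \<Rightarrow> real \<Rightarrow> (real \<Rightarrow> 'a::metric_space) \<Rightarrow> bool" where
  "constant_speed h v c \<longleftrightarrow> 0 \<le> v
    \<and> (\<forall>s\<in>{0..h}. \<forall>t\<in>{0..h}. dist (c s) (c t) \<le> v * \<bar>s - t\<bar>)
    \<and> negligible {\<sigma> \<in> {0<..<h}. \<not> ((\<lambda>s. dist (c s) (c \<sigma>) / \<bar>s - \<sigma>\<bar>) \<longlongrightarrow> v) (at \<sigma>)}"

text \<open>
  Admissible curves need exactly constant speed. An almost shortest path has it once it is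
  parametrized proportionally to arc length.
\<close>
lemma length_space_constant_speed_curve:
  fixes x y :: "'a::metric_space"
  assumes len: "length_space TYPE('a)" and h: "0 < h" and \<eta>: "0 < \<eta>"
  obtains c v where "constant_speed h v c" "c 0 = x" "c h = y"
    "dist x y \<le> v * h" "v * h < dist x y + \<eta>"
proof -
  have "(INF g \<in> {g. path g \<and> pathstart g = x \<and> pathfinish g = y}. path_length g) < ereal (dist x y + \<eta>)"
    using len \<eta> unfolding length_space_def by (metis less_ereal.simps(1) less_add_same_cancel1)
  then obtain g where g: "path g" "g 0 = x" "g 1 = y" "path_length g < ereal (dist x y + \<eta>)"
    by (auto simp: INF_less_iff pathstart_def pathfinish_def)
  define B where "B = real_of_ereal (path_length g)"
  have "ereal 0 \<le> path_length g" using chords_le_path_length[of "[0]" g] by simp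
  then have B: "path_length g = ereal B" using g(4) unfolding B_def
    by (cases "path_length g") auto
  interpret rectifiable_path g B
  proof
    show "continuous_on {0..1} g" using g(1) by (simp add: path_def)
    fix xs :: "real list" assume xs: "sorted xs" "set xs \<subseteq> {0..1}"
    show "chords g xs \<le> B"
    proof (cases "xs = []")
      case True
      then show ?thesis using \<open>ereal 0 \<le> path_length g\<close> B by simp
    next
      case False
      then show ?thesis using chords_le_path_length[OF xs False, of g] B by simp
    qed
  qed
  define l where "l = arclength g 1"
  obtain \<gamma> where \<gamma>: "\<gamma> 0 = x" "\<gamma> l = y"
    "\<And>s t. \<lbrakk>s \<in> {0..l}; t \<in> {0..l}\<rbrakk> \<Longrightarrow> dist (\<gamma> s) (\<gamma> t) \<le> \<bar>s - t\<bar>"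
    "\<And>\<kappa>. 0 < \<kappa> \<Longrightarrow> \<exists>xs. sorted (0 # xs @ [l]) \<and> l - \<kappa> < chords \<gamma> (0 # xs @ [l])"
    by (rule unit_speed_reparametrization[folded l_def, unfolded g(2,3)], rule that) assumption+
  have l0: "0 \<le> l" using arclength_mono[of 0 1] arclength_0 by (simp add: l_def)
  have lB: "l \<le> B" unfolding l_def
    by (rule arclength_least) (auto intro!: bound simp: sorted_append)
  define v where "v = l / h"
  define c where "c = (\<lambda>\<sigma>. \<gamma> (v * \<sigma>))"
  have v0: "0 \<le> v" and vh: "v * h = l" using l0 h by (auto simp: v_def)
  have in_l: "v * s \<in> {0..l}" if "s \<in> {0..h}" for s
    using that v0 vh mult_left_mono[of s h v] by auto
  have lip: "dist (c s) (c t) \<le> v * \<bar>s - t\<bar>" if "s \<in> {0..h}" "t \<in> {0..h}" for s t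
    using \<gamma>(3)[OF in_l[OF that(1)] in_l[OF that(2)]] v0
    by (simp add: c_def abs_mult right_diff_distrib[symmetric])
  have full: "\<exists>xs. sorted (0 # xs @ [h]) \<and> v * (h - 0) - \<kappa> < chords c (0 # xs @ [h])" if \<kappa>: "0 < \<kappa>" for \<kappa>
  proof (cases "v = 0")
    case True
    then show ?thesis using \<kappa> h
      by (intro exI[of _ "[]"]) (auto intro: less_le_trans[OF _ zero_le_dist])
  next
    case False
    then have v: "v > 0" using v0 by simp
    from \<gamma>(4)[OF \<kappa>] obtain xs where xs: "sorted (0 # xs @ [l])" "l - \<kappa> < chords \<gamma> (0 # xs @ [l])"
      by blast
    let ?f = "\<lambda>z. z / v"
    have lv: "l / v = h" using vh v by (simp add: field_simps)
    have "chords c (map ?f (0 # xs @ [l])) = chords (\<lambda>z. c (z / v)) (0 # xs @ [l])"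
      by (rule chords_map)
    also have "(\<lambda>z. c (z / v)) = \<gamma>" using v by (simp add: c_def)
    finally have "chords c (0 # map ?f xs @ [h]) = chords \<gamma> (0 # xs @ [l])"
      by (simp add: lv)
    moreover have "sorted (map ?f (0 # xs @ [l]))"
      using xs(1) v by (intro sorted_map_of_mono) (auto intro: divide_right_mono)
    ultimately show ?thesis using xs(2) vh lv by (intro exI[of _ "map ?f xs"]) auto
  qed
  have "constant_speed h v c"
    unfolding constant_speed_def using v0 lip full_length_imp_speed[of 0 h c v, OF lip full] by blast
  moreover have "c 0 = x" "c h = y" using \<gamma> vh by (auto simp: c_def)
  moreover have "dist x y \<le> v * h"
    using lip[of 0 h] h \<open>c 0 = x\<close> \<open>c h = y\<close> by simp
  moreover have "v * h < dist x y + \<eta>" using vh lB B g(4) by simp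
  ultimately show thesis by (rule that)
qed

section \<open>Admissible curves and their action\<close>

lemma has_metric_speed_interior:
  "0 < \<sigma> \<Longrightarrow> has_metric_speed \<gamma> v \<sigma> \<longleftrightarrow> ((\<lambda>s. dist (\<gamma> s) (\<gamma> \<sigma>) / \<bar>s - \<sigma>\<bar>) \<longlongrightarrow> v) (at \<sigma>)"
  unfolding has_metric_speed_def by (subst at_within_interior) (auto simp: interior_real_atLeast)

lemma metric_speed_eq:
  assumes "has_metric_speed \<gamma> v \<sigma>" "0 \<le> \<sigma>"
  shows "metric_speed \<gamma> \<sigma> = v"
  unfolding metric_speed_def
proof (rule the_equality)
  show "has_metric_speed \<gamma> v \<sigma>" by fact
  fix w assume "has_metric_speed \<gamma> w \<sigma>"
  then show "w = v"
    using assms unfolding has_metric_speed_def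
    by (intro tendsto_unique[OF trivial_limit_at_right_real[of \<sigma>],
          of "\<lambda>s. dist (\<gamma> s) (\<gamma> \<sigma>) / \<bar>s - \<sigma>\<bar>"])
       (auto elim!: tendsto_within_subset)
qed

lemma abs_cont_on_lipschitz:
  assumes "V-lipschitz_on S g"
  shows "abs_cont_on S g"
  unfolding abs_cont_on_def abs_cont_on_interval_def
proof (intro allI impI)
  fix a b e :: real assume ab: "{a..b} \<subseteq> S" and e: "0 < e"
  have V: "0 \<le> V" using assms by (rule lipschitz_on_nonneg)
  show "\<exists>d>0. \<forall>D. finite D \<and> (\<forall>(p, q)\<in>D. a \<le> p \<and> p \<le> q \<and> q \<le> b)
      \<and> disjoint_family_on (\<lambda>(p, q). {p<..<q}) D \<and> (\<Sum>(p, q)\<in>D. q - p) < d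
      \<longrightarrow> (\<Sum>(p, q)\<in>D. dist (g p) (g q)) < e"
  proof (intro exI[of _ "e / (V + 1)"] conjI allI impI)
    show "0 < e / (V + 1)" using V e by simp
    fix D assume D: "finite D \<and> (\<forall>(p, q)\<in>D. a \<le> p \<and> p \<le> q \<and> q \<le> b)
      \<and> disjoint_family_on (\<lambda>(p, q). {p<..<q}) D \<and> (\<Sum>(p, q)\<in>D. q - p) < e / (V + 1)"
    have "(\<Sum>(p, q)\<in>D. dist (g p) (g q)) \<le> (\<Sum>(p, q)\<in>D. V * (q - p))"
    proof (rule sum_mono, clarify)
      fix p q assume "(p, q) \<in> D"
      then have "a \<le> p" "p \<le> q" "q \<le> b" using D by auto
      then have "p \<in> S" "q \<in> S" using ab by auto
      then show "dist (g p) (g q) \<le> V * (q - p)"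
        using lipschitz_onD[OF assms, of p q] \<open>p \<le> q\<close> by (simp add: dist_real_def)
    qed
    also have "\<dots> = V * (\<Sum>(p, q)\<in>D. q - p)" by (simp add: sum_distrib_left case_prod_unfold)
    also have "\<dots> \<le> V * (e / (V + 1))" using D V by (intro mult_left_mono) auto
    also have "\<dots> < e" using V e by (simp add: field_simps)
    finally show "(\<Sum>(p, q)\<in>D. dist (g p) (g q)) < e" .
  qed
qed

lemma abs_cont_on_imp_continuous:
  assumes "abs_cont_on UNIV g"
  shows "continuous_on UNIV g"
  unfolding continuous_on_iff
proof (intro ballI allI impI)
  fix x e :: real assume e: "0 < e"
  have "abs_cont_on_interval (x - 1) (x + 1) g" using assms by (simp add: abs_cont_on_def)
  from this[unfolded abs_cont_on_interval_def, THEN spec, THEN mp, OF e]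
  obtain d where d: "d > 0" and dD: "\<forall>D. finite D
        \<and> (\<forall>(p, q)\<in>D. x - 1 \<le> p \<and> p \<le> q \<and> q \<le> x + 1)
        \<and> disjoint_family_on (\<lambda>(p, q). {p<..<q}) D
        \<and> (\<Sum>(p, q)\<in>D. q - p) < d
      \<longrightarrow> (\<Sum>(p, q)\<in>D. dist (g p) (g q)) < e"
    by (elim exE conjE) rule
  have one: "dist (g p) (g q) < e" if "x - 1 \<le> p" "p \<le> q" "q \<le> x + 1" "q - p < d" for p q
    using dD[THEN spec, of "{(p, q)}"] that by (simp add: disjoint_family_on_def)
  show "\<exists>d>0. \<forall>y\<in>UNIV. dist y x < d \<longrightarrow> dist (g y) (g x) < e"
  proof (intro exI[of _ "min 1 d"] conjI ballI impI)
    fix y assume "dist y x < min 1 d"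
    then have y: "\<bar>y - x\<bar> < 1" "\<bar>y - x\<bar> < d" by (auto simp: dist_real_def)
    show "dist (g y) (g x) < e"
    proof (cases "y \<le> x")
      case True
      then show ?thesis using one[of y x] y by linarith
    next
      case False
      then show ?thesis using one[of x y] y by (simp add: dist_commute)
    qed
  qed (use d in auto)
qed

abbreviation pieces :: "(nat \<Rightarrow> real) \<Rightarrow> nat \<Rightarrow> real set set" where
  "pieces r n \<equiv> insert {r n..} ((\<lambda>i. {r i..r (Suc i)}) ` {..<n})"
lemma pieces_nonneg:
  fixes r :: "nat \<Rightarrow> real"
  assumes "r 0 = 0" "strict_mono_on {..n} r" "I \<in> pieces r n"
  shows "I \<subseteq> {0..}"
proof -
  have r: "0 \<le> r i" if "i \<le> n" for i
    using strict_mono_onD[OF assms(2), of 0 i] assms(1) that by (cases "i = 0") auto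
  show ?thesis
  proof
    fix x assume "x \<in> I"
    then obtain i where "i \<le> n" "r i \<le> x" using assms(3) by (auto dest: less_imp_le)
    then show "x \<in> {0..}" using r[of i] by simp
  qed
qed

text \<open>
  A relation between parameters that is transitive and holds inside each piece of a subdivision of
  \<open>[0, \<infinity>)\<close> holds throughout. All estimates along admissible curves are proved in this form.
\<close>
lemma breakpoint_induct:
  fixes r :: "nat \<Rightarrow> real"
  assumes r0: "r 0 = 0" and mono: "strict_mono_on {..n} r"
    and piece: "\<And>a b I. \<lbrakk>I \<in> pieces r n; {a..b} \<subseteq> I; a \<le> b\<rbrakk> \<Longrightarrow> P a b"
    and trans: "\<And>a b c. \<lbrakk>0 \<le> a; a \<le> b; b \<le> c; P a b; P b c\<rbrakk> \<Longrightarrow> P a c"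
    and ab: "0 \<le> a" "a \<le> b"
  shows "P a b"
proof -
  have split: "P a b"
    if I: "I \<in> pieces r n" "{t..b} \<subseteq> I"
      and left: "\<And>a b. \<lbrakk>0 \<le> a; a \<le> b; b \<le> t\<rbrakk> \<Longrightarrow> P a b" and "0 \<le> a" "a \<le> b" for a b t I
  proof -
    consider "b \<le> t" | "t \<le> a" | "a < t" "t < b" by linarith
    then show ?thesis
    proof cases
      case 1 then show ?thesis using left \<open>0 \<le> a\<close> \<open>a \<le> b\<close> by simp
    next
      case 2
      then have "{a..b} \<subseteq> I" using I(2) by (auto intro: order_trans)
      then show ?thesis using piece[OF I(1)] \<open>a \<le> b\<close> by simp
    next
      case 3
      then have "P a t" using left[of a t] \<open>0 \<le> a\<close> by simp
      moreover have "P t b" using piece[OF I(1,2)] 3 by simp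
      ultimately show ?thesis using trans[of a t b] 3 \<open>0 \<le> a\<close> by simp
    qed
  qed
  have below: "P a b" if "i \<le> n" "0 \<le> a" "a \<le> b" "b \<le> r i" for i a b
    using that
  proof (induction i arbitrary: a b)
    case 0
    then have ab: "a = 0" "b = 0" using r0 by simp_all
    show ?case
    proof (cases "n = 0")
      case True
      then show ?thesis using piece[of "{r n..}" a b] r0 ab by simp
    next
      case False
      then have "r 0 < r (Suc 0)" using strict_mono_onD[OF mono, of 0 "Suc 0"] by simp
      then show ?thesis using piece[of "{r 0..r (Suc 0)}" a b] r0 ab False by simp
    qed
  next
    case (Suc i)
    show ?case
    proof (rule split)
      show "{r i..r (Suc i)} \<in> pieces r n" "{r i..b} \<subseteq> {r i..r (Suc i)}"
        using Suc.prems by auto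
      show "P a b" if "0 \<le> a" "a \<le> b" "b \<le> r i" for a b
        using Suc.IH that Suc.prems(1) by simp
    qed (use Suc.prems in simp_all)
  qed
  show ?thesis
  proof (rule split)
    show "{r n..} \<in> pieces r n" "{r n..b} \<subseteq> {r n..}" by auto
    show "P a b" if "0 \<le> a" "a \<le> b" "b \<le> r n" for a b using below[OF order_refl that] .
  qed (use ab in simp_all)
qed

locale continuous_lagrangian =
  fixes L :: "'a::metric_space \<Rightarrow> real \<Rightarrow> real"
  assumes cont_L: "continuous_on (UNIV \<times> {0..}) (\<lambda>(x, q). L x q)"
begin

abbreviation integrand :: "(real \<Rightarrow> 'a) \<Rightarrow> real \<Rightarrow> real" where
  "integrand \<gamma> \<sigma> \<equiv> L (\<gamma> \<sigma>) (metric_speed \<gamma> \<sigma>)"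

lemma continuous_on_L:
  "\<lbrakk>0 \<le> v; continuous_on S \<gamma>\<rbrakk> \<Longrightarrow> continuous_on S (\<lambda>\<sigma>. L (\<gamma> \<sigma>) v)"
  using continuous_on_compose2[OF cont_L, of S "\<lambda>\<sigma>. (\<gamma> \<sigma>, v)"]
  by (simp add: continuous_on_Pair image_subset_iff)

text \<open>
  On a piece with speed \<open>v\<close>, the curve is \<open>v\<close>-Lipschitz everywhere and the integrand of the action
  agrees almost everywhere with the continuous function \<open>L (\<gamma> \<sigma>) v\<close>.
\<close>
lemma admissible_induct [consumes 1, case_names piece trans]:
  assumes \<gamma>: "\<gamma> \<in> admissible_curves L x" and ab: "0 \<le> a" "a \<le> b"
    and piece: "\<And>a b v. \<lbrakk>0 \<le> a; a \<le> b; 0 \<le> v; v-lipschitz_on {a..b} \<gamma>;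
        integrand \<gamma> absolutely_integrable_on {a..b};
        integral {a..b} (integrand \<gamma>) = integral {a..b} (\<lambda>\<sigma>. L (\<gamma> \<sigma>) v)\<rbrakk> \<Longrightarrow> P a b"
    and trans: "\<And>a b c. \<lbrakk>0 \<le> a; a \<le> b; b \<le> c; P a b; P b c\<rbrakk> \<Longrightarrow> P a c"
  shows "P a b"
proof -
  obtain n r where r: "r 0 = 0" "strict_mono_on {..n} r" and ac: "abs_cont_on {0..} \<gamma>" and
    I: "\<And>I. I \<in> pieces r n \<Longrightarrow>
        \<exists>v\<ge>0. (AE \<sigma> in lebesgue. \<sigma> \<in> I \<longrightarrow> has_metric_speed \<gamma> v \<sigma>)
               \<and> continuous_on I (\<lambda>\<sigma>. L (\<gamma> \<sigma>) v)"
    using \<gamma> unfolding admissible_curves_def by blast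
  show ?thesis
  proof (rule breakpoint_induct[where P = P, OF r _ trans ab])
    fix a b J assume J: "J \<in> pieces r n" and abJ: "{a..b} \<subseteq> J" and "a \<le> b"
    have "J \<subseteq> {0..}" using pieces_nonneg[OF r J] .
    then have a0: "0 \<le> a" using abJ \<open>a \<le> b\<close> by auto
    obtain v where v: "0 \<le> v" "AE \<sigma> in lebesgue. \<sigma> \<in> J \<longrightarrow> has_metric_speed \<gamma> v \<sigma>" using I[OF J] by blast
    define N where "N = {\<sigma>. \<not> (\<sigma> \<in> J \<longrightarrow> has_metric_speed \<gamma> v \<sigma>)}"
    have N: "negligible N" using v(2) unfolding N_def AE_lebesgue_iff_negligible .
    have sp: "has_metric_speed \<gamma> v \<sigma>" if "\<sigma> \<in> {a..b} - N" for \<sigma>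
      using that abJ by (auto simp: N_def)
    have lip: "dist (\<gamma> s) (\<gamma> t) \<le> v * (t - s)" if "a \<le> s" "s \<le> t" "t \<le> b" for s t
    proof (rule abs_cont_metric_speed_imp_lipschitz[OF _ N v(1)])
      show "abs_cont_on_interval s t \<gamma>" using ac that a0 by (auto simp: abs_cont_on_def)
    qed (use that a0 sp in auto)
    have Lip: "v-lipschitz_on {a..b} \<gamma>"
    proof (rule lipschitz_onI[OF _ v(1)])
      fix s t assume "s \<in> {a..b}" "t \<in> {a..b}"
      then show "dist (\<gamma> s) (\<gamma> t) \<le> v * dist s t"
        using lip[of s t] lip[of t s] dist_commute[of "\<gamma> s" "\<gamma> t"]
        by (cases "s \<le> t") (auto simp: dist_real_def)
    qed
    have eq: "integrand \<gamma> \<sigma> = L (\<gamma> \<sigma>) v" if "\<sigma> \<in> {a..b} - N" for \<sigma>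
      using metric_speed_eq[OF sp[OF that]] that a0 by auto
    have "(\<lambda>\<sigma>. L (\<gamma> \<sigma>) v) absolutely_integrable_on {a..b}"
      by (intro absolutely_integrable_continuous_real continuous_on_L v(1) lipschitz_on_continuous_on[OF Lip])
    then have "integrand \<gamma> absolutely_integrable_on {a..b}"
      by (rule absolutely_integrable_spike[OF _ N eq])
    moreover have "integral {a..b} (integrand \<gamma>) = integral {a..b} (\<lambda>\<sigma>. L (\<gamma> \<sigma>) v)"
      by (rule integral_spike[OF N eq[symmetric]])
    ultimately show "P a b" using a0 \<open>a \<le> b\<close> v(1) Lip by (intro piece)
  qed
qed

lemma admissible_integrable:
  assumes "\<gamma> \<in> admissible_curves L x" "0 \<le> a" "a \<le> b"
  shows "integrand \<gamma> absolutely_integrable_on {a..b}"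
  using assms by (rule admissible_induct) (auto intro: absolutely_integrable_on_combine)

lemma curve_action_eq_integral:
  assumes "\<gamma> \<in> admissible_curves L x" "0 \<le> d"
  shows "curve_action L \<gamma> d = integral {0..d} (integrand \<gamma>)"
  unfolding curve_action_def
  using admissible_integrable[OF assms(1) order_refl assms(2)]
  by (rule set_lebesgue_integral_eq_integral)

lemma integral_integrand_split:
  assumes "\<gamma> \<in> admissible_curves L x" "0 \<le> a" "a \<le> b" "b \<le> c"
  shows "integral {a..c} (integrand \<gamma>) = integral {a..b} (integrand \<gamma>) + integral {b..c} (integrand \<gamma>)"
  using Henstock_Kurzweil_Integration.integral_combine[of a b c "integrand \<gamma>"]
    admissible_integrable[OF assms(1,2), of c] assms
  by (simp add: set_lebesgue_integral_eq_integral(1))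

text \<open>
  An affine lower bound for the Lagrangian along the curve replaces Jensen's inequality: integrated,
  its slope multiplies the length of the curve, which is at least the distance between its endpoints.
\<close>
lemma integral_integrand_ge_affine:
  assumes "\<gamma> \<in> admissible_curves L x" "0 \<le> a" "a \<le> b" and p: "0 \<le> p"
    and ge: "\<And>\<sigma> q. \<lbrakk>\<sigma> \<in> {a..b}; 0 \<le> q\<rbrakk> \<Longrightarrow> p * q - c \<le> L (\<gamma> \<sigma>) q"
  shows "p * dist (\<gamma> a) (\<gamma> b) - c * (b - a) \<le> integral {a..b} (integrand \<gamma>)"
proof -
  define P where "P = (\<lambda>s t. a \<le> s \<longrightarrow> t \<le> b \<longrightarrow>
    p * dist (\<gamma> s) (\<gamma> t) - c * (t - s) \<le> integral {s..t} (integrand \<gamma>))"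
  have "P a b"
    using assms(1-3)
  proof (rule admissible_induct)
    fix s t v assume st: "0 \<le> s" "s \<le> t" "0 \<le> v" and lip: "v-lipschitz_on {s..t} \<gamma>"
      and int: "integral {s..t} (integrand \<gamma>) = integral {s..t} (\<lambda>\<sigma>. L (\<gamma> \<sigma>) v)"
    show "P s t" unfolding P_def
    proof (intro impI)
      assume ab: "a \<le> s" "t \<le> b"
      have "p * dist (\<gamma> s) (\<gamma> t) \<le> p * (v * (t - s))"
        using lipschitz_onD[OF lip, of s t] st p by (intro mult_left_mono) (auto simp: dist_real_def)
      then have "p * dist (\<gamma> s) (\<gamma> t) - c * (t - s) \<le> (p * v - c) * (t - s)"
        by (simp add: algebra_simps)
      also have "\<dots> = integral {s..t} (\<lambda>_. p * v - c)" using st by simp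
      also have "\<dots> \<le> integral {s..t} (\<lambda>\<sigma>. L (\<gamma> \<sigma>) v)"
      proof (rule integral_le)
        show "(\<lambda>\<sigma>. L (\<gamma> \<sigma>) v) integrable_on {s..t}"
          by (intro integrable_continuous_real continuous_on_L st lipschitz_on_continuous_on[OF lip])
      qed (use ge ab st in auto)
      finally show "p * dist (\<gamma> s) (\<gamma> t) - c * (t - s) \<le> integral {s..t} (integrand \<gamma>)"
        by (simp add: int)
    qed
  next
    fix s t w assume *: "0 \<le> s" "s \<le> t" "t \<le> w" "P s t" "P t w"
    show "P s w" unfolding P_def
    proof (intro impI)
      assume "a \<le> s" "w \<le> b"
      then have "p * dist (\<gamma> s) (\<gamma> t) - c * (t - s) \<le> integral {s..t} (integrand \<gamma>)"
        "p * dist (\<gamma> t) (\<gamma> w) - c * (w - t) \<le> integral {t..w} (integrand \<gamma>)"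
        using * by (auto simp: P_def)
      moreover have "p * dist (\<gamma> s) (\<gamma> w) \<le> p * (dist (\<gamma> s) (\<gamma> t) + dist (\<gamma> t) (\<gamma> w))"
        using p dist_triangle by (intro mult_left_mono)
      ultimately show "p * dist (\<gamma> s) (\<gamma> w) - c * (w - s) \<le> integral {s..w} (integrand \<gamma>)"
        using integral_integrand_split[OF assms(1), of s t w] * by (simp add: algebra_simps)
    qed
  qed
  then show ?thesis by (simp add: P_def)
qed

lemma constant_curve:
  shows "(\<lambda>_. x) \<in> admissible_curves L x"
    and "0 \<le> d \<Longrightarrow> integral {0..d} (integrand (\<lambda>_. x)) = d * L x 0"
proof -
  have sp: "has_metric_speed (\<lambda>_. x) 0 \<sigma>" for \<sigma> by (simp add: has_metric_speed_def)
  show mem: "(\<lambda>_. x) \<in> admissible_curves L x"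
    unfolding admissible_curves_def
    using sp by (auto intro!: abs_cont_on_lipschitz[of 0] lipschitz_onI exI[of _ 0] exI[of _ "\<lambda>_. 0"] strict_mono_onI)
  have "integral {0..d} (integrand (\<lambda>_. x)) = integral {0..d} (\<lambda>_. L x 0)"
    by (intro integral_cong) (simp add: metric_speed_eq[OF sp])
  then show "integral {0..d} (integrand (\<lambda>_. x)) = d * L x 0" if "0 \<le> d" using that by simp
qed

end

definition prepend :: "real \<Rightarrow> (real \<Rightarrow> 'a) \<Rightarrow> (real \<Rightarrow> 'a) \<Rightarrow> real \<Rightarrow> 'a" where
  "prepend h c \<gamma> \<sigma> = (if \<sigma> \<le> h then c \<sigma> else \<gamma> (\<sigma> - h))"

lemma prepend_has_metric_speed_left:
  assumes "0 < \<sigma>" "\<sigma> < h"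
  shows "has_metric_speed (prepend h c \<gamma>) v \<sigma> \<longleftrightarrow> ((\<lambda>s. dist (c s) (c \<sigma>) / \<bar>s - \<sigma>\<bar>) \<longlongrightarrow> v) (at \<sigma>)"
  unfolding has_metric_speed_interior[OF assms(1)]
proof (rule tendsto_cong)
  have "\<forall>\<^sub>F s in at \<sigma>. s < h" using assms order_tendstoD(2)[OF tendsto_ident_at] by blast
  then show "\<forall>\<^sub>F s in at \<sigma>. dist (prepend h c \<gamma> s) (prepend h c \<gamma> \<sigma>) / \<bar>s - \<sigma>\<bar> = dist (c s) (c \<sigma>) / \<bar>s - \<sigma>\<bar>"
    by eventually_elim (use assms in \<open>auto simp: prepend_def\<close>)
qed

lemma prepend_has_metric_speed_right:
  assumes "0 \<le> h" "h < \<sigma>"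
  shows "has_metric_speed (prepend h c \<gamma>) v \<sigma> \<longleftrightarrow> has_metric_speed \<gamma> v (\<sigma> - h)"
proof -
  let ?Q = "\<lambda>s. dist (\<gamma> s) (\<gamma> (\<sigma> - h)) / \<bar>s - (\<sigma> - h)\<bar>"
  have "\<forall>\<^sub>F s in at \<sigma>. h < s" using assms order_tendstoD(1)[OF tendsto_ident_at] by blast
  then have "\<forall>\<^sub>F s in at \<sigma>. dist (prepend h c \<gamma> s) (prepend h c \<gamma> \<sigma>) / \<bar>s - \<sigma>\<bar> = ?Q (s - h)"
    by eventually_elim (use assms in \<open>auto simp: prepend_def\<close>)
  then have "has_metric_speed (prepend h c \<gamma>) v \<sigma> \<longleftrightarrow> ((\<lambda>s. ?Q (s - h)) \<longlongrightarrow> v) (at \<sigma>)"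
    using assms by (simp add: has_metric_speed_interior tendsto_cong)
  also have "\<dots> \<longleftrightarrow> (?Q \<longlongrightarrow> v) (at (\<sigma> - h))"
    using LIM_offset[of "\<lambda>s. ?Q (s - h)" v \<sigma> h] LIM_offset[of ?Q v "\<sigma> - h" "- h"] by auto
  also have "\<dots> \<longleftrightarrow> has_metric_speed \<gamma> v (\<sigma> - h)"
    using assms by (simp add: has_metric_speed_interior)
  finally show ?thesis .
qed

text \<open>
  For parameters beyond \<open>h\<close> the equality holds literally, even at points where the metric speed does
  not exist, because the two limits defining it are the same.
\<close>
lemma metric_speed_prepend:
  "\<lbrakk>0 \<le> h; h < \<sigma>\<rbrakk> \<Longrightarrow> metric_speed (prepend h c \<gamma>) \<sigma> = metric_speed \<gamma> (\<sigma> - h)"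
  by (simp add: metric_speed_def prepend_has_metric_speed_right)

lemma lipschitz_on_prepend:
  assumes h: "0 < h" and c: "\<And>s t. \<lbrakk>s \<in> {0..h}; t \<in> {0..h}\<rbrakk> \<Longrightarrow> dist (c s) (c t) \<le> v * \<bar>s - t\<bar>"
    and join: "c h = \<gamma> 0" and \<gamma>: "V-lipschitz_on {0..} \<gamma>" and v: "0 \<le> v"
  shows "(max v V)-lipschitz_on {0..} (prepend h c \<gamma>)"
proof -
  let ?W = "max v V" and ?g = "prepend h c \<gamma>"
  have left: "dist (?g s) (?g t) \<le> ?W * \<bar>s - t\<bar>" if "0 \<le> s" "s \<le> h" "0 \<le> t" "t \<le> h" for s t
  proof -
    have "dist (?g s) (?g t) \<le> v * \<bar>s - t\<bar>" using c[of s t] that by (simp add: prepend_def)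
    also have "\<dots> \<le> ?W * \<bar>s - t\<bar>" by (intro mult_right_mono) auto
    finally show ?thesis .
  qed
  have right: "dist (?g s) (?g t) \<le> ?W * \<bar>s - t\<bar>" if "h \<le> s" "h \<le> t" for s t
  proof -
    have *: "?g z = \<gamma> (z - h)" if "h \<le> z" for z using that join by (auto simp: prepend_def)
    have "dist (?g s) (?g t) \<le> V * \<bar>s - t\<bar>"
      using lipschitz_onD[OF \<gamma>, of "s - h" "t - h"] that by (simp add: * dist_real_def)
    also have "\<dots> \<le> ?W * \<bar>s - t\<bar>" by (intro mult_right_mono) auto
    finally show ?thesis .
  qed
  have mixed: "dist (?g s) (?g t) \<le> ?W * \<bar>s - t\<bar>" if "0 \<le> s" "s \<le> h" "h \<le> t" for s t
  proof -
    have "dist (?g s) (?g t) \<le> ?W * \<bar>s - h\<bar> + ?W * \<bar>h - t\<bar>"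
      using dist_triangle[of "?g s" "?g t" "?g h"] left[of s h] right[of h t] that h by linarith
    also have "\<dots> = ?W * \<bar>s - t\<bar>" using that by (simp add: algebra_simps)
    finally show ?thesis .
  qed
  show ?thesis
  proof (rule lipschitz_onI)
    fix s t :: real assume st: "s \<in> {0..}" "t \<in> {0..}"
    consider "s \<le> h" "t \<le> h" | "h \<le> s" "h \<le> t" | "s \<le> h" "h \<le> t" | "h \<le> s" "t \<le> h" by linarith
    then show "dist (?g s) (?g t) \<le> ?W * dist s t" unfolding dist_real_def
    proof cases
      case 4
      then show "dist (?g s) (?g t) \<le> ?W * \<bar>s - t\<bar>"
        using mixed[of t s] st by (simp add: dist_commute abs_minus_commute)
    qed (use left right mixed st in auto)
  qed (use v in simp)
qed

context continuous_lagrangian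
begin

text \<open>
  The Lipschitz constant is carried along because it makes absolute continuity of the concatenated
  curve immediate.
\<close>
lemma prepend_admissible:
  assumes h: "0 < h" and c: "constant_speed h v c" and join: "c h = \<gamma> 0"
    and \<gamma>: "\<gamma> \<in> admissible_curves L (c h)" and lip: "V-lipschitz_on {0..} \<gamma>"
  shows "prepend h c \<gamma> \<in> admissible_curves L (c 0)"
    and "(max v V)-lipschitz_on {0..} (prepend h c \<gamma>)"
    and "0 \<le> d \<Longrightarrow> integral {0..h + d} (integrand (prepend h c \<gamma>)) =
      integral {0..h} (\<lambda>\<sigma>. L (c \<sigma>) v) + integral {0..d} (integrand \<gamma>)"
proof -
  let ?g = "prepend h c \<gamma>"
  let ?E = "{\<sigma> \<in> {0<..<h}. \<not> ((\<lambda>s. dist (c s) (c \<sigma>) / \<bar>s - \<sigma>\<bar>) \<longlongrightarrow> v) (at \<sigma>)}"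
  have v: "0 \<le> v" and clip: "\<And>s t. \<lbrakk>s \<in> {0..h}; t \<in> {0..h}\<rbrakk> \<Longrightarrow> dist (c s) (c t) \<le> v * \<bar>s - t\<bar>"
    and cneg: "negligible ?E"
    using c by (auto simp: constant_speed_def)
  show Lip: "(max v V)-lipschitz_on {0..} ?g" by (rule lipschitz_on_prepend[OF h clip join lip v])
  have gcont: "continuous_on S ?g" if "S \<subseteq> {0..}" for S
    using lipschitz_on_continuous_on[OF Lip] that by (rule continuous_on_subset)
  have sp0: "negligible {\<sigma>. \<not> (\<sigma> \<in> {0..h} \<longrightarrow> has_metric_speed ?g v \<sigma>)}"
  proof (rule negligible_subset)
    show "negligible ({0, h} \<union> ?E)"
      using cneg by (intro negligible_Un) auto
    show "{\<sigma>. \<not> (\<sigma> \<in> {0..h} \<longrightarrow> has_metric_speed ?g v \<sigma>)} \<subseteq>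
      {0, h} \<union> ?E"
    proof
      fix \<sigma> assume \<sigma>: "\<sigma> \<in> {\<sigma>. \<not> (\<sigma> \<in> {0..h} \<longrightarrow> has_metric_speed ?g v \<sigma>)}"
      then consider "\<sigma> = 0" | "\<sigma> = h" | "0 < \<sigma>" "\<sigma> < h" by fastforce
      then show "\<sigma> \<in> {0, h} \<union> ?E"
        using \<sigma> by cases (simp_all add: prepend_has_metric_speed_left)
    qed
  qed
  obtain n r where r: "r 0 = 0" "strict_mono_on {..n} r" and
    I: "\<And>I. I \<in> pieces r n \<Longrightarrow>
        \<exists>v\<ge>0. (AE \<sigma> in lebesgue. \<sigma> \<in> I \<longrightarrow> has_metric_speed \<gamma> v \<sigma>)"
    using \<gamma> unfolding admissible_curves_def by blast
  have r_nonneg: "0 \<le> r i" if "i \<le> n" for i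
    using strict_mono_onD[OF r(2), of 0 i] r(1) that by (cases "i = 0") auto
  have shifted: "\<exists>v\<ge>0. (AE \<sigma> in lebesgue. \<sigma> \<in> (+) h ` I \<longrightarrow> has_metric_speed ?g v \<sigma>)
      \<and> continuous_on ((+) h ` I) (\<lambda>\<sigma>. L (?g \<sigma>) v)"
    if II: "I \<in> pieces r n" for I
  proof -
    obtain w where w: "0 \<le> w" "AE \<sigma> in lebesgue. \<sigma> \<in> I \<longrightarrow> has_metric_speed \<gamma> w \<sigma>" using I[OF II] by blast
    have I0: "I \<subseteq> {0..}" using pieces_nonneg[OF r II] .
    let ?N = "{\<sigma>. \<not> (\<sigma> \<in> I \<longrightarrow> has_metric_speed \<gamma> w \<sigma>)}"
    have N: "negligible ?N" using w(2) unfolding AE_lebesgue_iff_negligible .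
    have "negligible {\<sigma>. \<not> (\<sigma> \<in> (+) h ` I \<longrightarrow> has_metric_speed ?g w \<sigma>)}"
    proof (rule negligible_subset)
      show "negligible ({h} \<union> (+) h ` ?N)" using N by (intro negligible_Un negligible_translation) auto
      show "{\<sigma>. \<not> (\<sigma> \<in> (+) h ` I \<longrightarrow> has_metric_speed ?g w \<sigma>)} \<subseteq> {h} \<union> (+) h ` ?N"
      proof
        fix \<sigma> assume "\<sigma> \<in> {\<sigma>. \<not> (\<sigma> \<in> (+) h ` I \<longrightarrow> has_metric_speed ?g w \<sigma>)}"
        then obtain s where s: "s \<in> I" "\<sigma> = h + s" "\<not> has_metric_speed ?g w \<sigma>" by auto
        show "\<sigma> \<in> {h} \<union> (+) h ` ?N"
        proof (cases "s = 0")
          case False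
          then have "h < \<sigma>" using s I0 by auto
          then have "\<not> has_metric_speed \<gamma> w s"
            using s prepend_has_metric_speed_right[of h \<sigma> c \<gamma> w] h by simp
          then show ?thesis using s by auto
        qed (use s in auto)
      qed
    qed
    moreover have "continuous_on ((+) h ` I) (\<lambda>\<sigma>. L (?g \<sigma>) w)"
      using I0 h w(1) by (intro continuous_on_L gcont) auto
    ultimately show ?thesis using w(1) unfolding AE_lebesgue_iff_negligible by blast
  qed
  define r' where "r' = (\<lambda>i. case i of 0 \<Rightarrow> 0 | Suc j \<Rightarrow> h + r j)"
  have sm: "strict_mono_on {..Suc n} r'"
  proof (rule strict_mono_onI)
    fix i j assume ij: "i \<in> {..Suc n}" "j \<in> {..Suc n}" "i < j"
    then obtain j' where j': "j = Suc j'" "j' \<le> n" by (cases j) auto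
    show "r' i < r' j"
    proof (cases i)
      case 0 then show ?thesis using j' r_nonneg[of j'] h by (simp add: r'_def)
    next
      case (Suc i') then show ?thesis using ij j' strict_mono_onD[OF r(2), of i' j'] by (simp add: r'_def)
    qed
  qed
  have r'0: "r' 0 = 0" by (simp add: r'_def)
  have pieces: "\<exists>v\<ge>0. (AE \<sigma> in lebesgue. \<sigma> \<in> J \<longrightarrow> has_metric_speed ?g v \<sigma>)
               \<and> continuous_on J (\<lambda>\<sigma>. L (?g \<sigma>) v)"
    if J: "J \<in> pieces r' (Suc n)" for J
  proof -
    have "J = {0..h} \<or> (\<exists>I \<in> pieces r n. J = (+) h ` I)"
    proof (cases "J = {r' (Suc n)..}")
      case True
      then have "J = (+) h ` {r n..}" by (simp add: r'_def)
      then show ?thesis by blast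
    next
      case False
      then obtain i where i: "i < Suc n" "J = {r' i..r' (Suc i)}" using J by auto
      show ?thesis
      proof (cases i)
        case 0 then show ?thesis using i r(1) by (simp add: r'_def)
      next
        case (Suc j)
        then have "J = (+) h ` {r j..r (Suc j)}" "j < n" using i by (auto simp: r'_def)
        then show ?thesis by blast
      qed
    qed
    moreover have "continuous_on {0..h} (\<lambda>\<sigma>. L (?g \<sigma>) v)" by (intro continuous_on_L gcont v) auto
    ultimately show ?thesis using shifted v sp0 unfolding AE_lebesgue_iff_negligible by blast
  qed
  show mem: "?g \<in> admissible_curves L (c 0)"
    unfolding admissible_curves_def mem_Collect_eq
  proof (intro conjI exI)
    show "?g 0 = c 0" using h by (simp add: prepend_def)
    show "abs_cont_on {0..} ?g" by (rule abs_cont_on_lipschitz[OF Lip])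
    show "r' 0 = 0" "strict_mono_on {..Suc n} r'" by (fact r'0, fact sm)
  qed (rule ballI, erule pieces)
  show "integral {0..h + d} (integrand ?g) =
      integral {0..h} (\<lambda>\<sigma>. L (c \<sigma>) v) + integral {0..d} (integrand \<gamma>)" if d: "0 \<le> d"
  proof -
    have "integral {0..h + d} (integrand ?g) = integral {0..h} (integrand ?g) + integral {h..h + d} (integrand ?g)"
      using integral_integrand_split[OF mem, of 0 h "h + d"] h d by simp
    also have "integral {0..h} (integrand ?g) = integral {0..h} (\<lambda>\<sigma>. L (c \<sigma>) v)"
      by (rule integral_spike[OF sp0]) (auto simp: prepend_def metric_speed_eq)
    also have "integral {h..h + d} (integrand ?g) = integral {0..d} (integrand \<gamma>)"
    proof -
      have "(integrand \<gamma> has_integral integral {0..d} (integrand \<gamma>)) {0..d}"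
        using admissible_integrable[OF \<gamma> order_refl d]
        by (intro integrable_integral set_lebesgue_integral_eq_integral(1))
      from has_integral_affinity[OF this[folded box_real(2)], of 1 "- h"]
      have "((\<lambda>\<sigma>. integrand \<gamma> (\<sigma> - h)) has_integral integral {0..d} (integrand \<gamma>)) {h..h + d}"
        by (simp add: image_add_atLeastAtMost add.commute[of _ h] cong: image_cong_simp)
      then have "(integrand ?g has_integral integral {0..d} (integrand \<gamma>)) {h..h + d}"
        by (rule has_integral_spike[of "{h}", rotated 2])
           (use h in \<open>auto simp: prepend_def metric_speed_prepend\<close>)
      then show ?thesis by (rule integral_unique)
    qed
    finally show ?thesis .
  qed
qed

end

section \<open>Propagation of local inequalities\<close>

text \<open>
  At the largest point up to which the inequality with slope \<open>\<epsilon>\<close> holds, the hypothesis would allow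
  going further.
\<close>
lemma nondecreasing_if_right_Dini:
  fixes \<phi> :: "real \<Rightarrow> real"
  assumes ab: "a \<le> b" and cont: "continuous_on {a..b} \<phi>"
    and dini: "\<And>\<sigma> \<epsilon>. \<lbrakk>a \<le> \<sigma>; \<sigma> < b; 0 < \<epsilon>\<rbrakk> \<Longrightarrow> \<exists>\<tau>\<in>{\<sigma><..b}. \<phi> \<sigma> - \<epsilon> * (\<tau> - \<sigma>) \<le> \<phi> \<tau>"
  shows "\<phi> a \<le> \<phi> b"
proof -
  have eps: "\<phi> a - \<epsilon> * (b - a) \<le> \<phi> b" if \<epsilon>: "0 < \<epsilon>" for \<epsilon>
  proof -
    define S where "S = {a..b} \<inter> (\<lambda>\<tau>. \<phi> \<tau> - \<phi> a + \<epsilon> * (\<tau> - a)) -` {0..}"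
    have "closed S" unfolding S_def
      by (intro continuous_closed_preimage continuous_intros cont)
    then have "compact S" unfolding S_def by (metis Int_lower1 bounded_closed_interval bounded_subset compact_eq_bounded_closed)
    moreover have "a \<in> S" using ab by (simp add: S_def)
    ultimately obtain \<sigma> where \<sigma>: "\<sigma> \<in> S" "\<And>\<tau>. \<tau> \<in> S \<Longrightarrow> \<tau> \<le> \<sigma>"
      using compact_attains_sup[of S] by blast
    have "\<sigma> = b"
    proof (rule ccontr)
      assume "\<sigma> \<noteq> b"
      then have "a \<le> \<sigma>" "\<sigma> < b" using \<sigma>(1) by (auto simp: S_def)
      then obtain \<tau> where "\<tau> \<in> {\<sigma><..b}" "\<phi> \<sigma> - \<epsilon> * (\<tau> - \<sigma>) \<le> \<phi> \<tau>" using dini \<epsilon> by blast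
      then have "\<tau> \<in> S" "\<sigma> < \<tau>" using \<sigma>(1) by (auto simp: S_def algebra_simps)
      then show False using \<sigma>(2)[of \<tau>] by simp
    qed
    then show ?thesis using \<sigma>(1) by (simp add: S_def)
  qed
  show ?thesis
  proof (cases "a = b")
    case False
    then have "a < b" using ab by simp
    show ?thesis
    proof (rule field_le_epsilon)
      fix e :: real assume "0 < e"
      then show "\<phi> a \<le> \<phi> b + e" using eps[of "e / (b - a)"] \<open>a < b\<close> by simp
    qed
  qed simp
qed

text \<open>
  A point \<open>Q\<close> is below \<open>P\<close> if \<open>F P - F Q\<close> is at least the cost of moving from \<open>P\<close> to \<open>Q\<close>, with the
  cost written as a supremum of the affine functions \<open>p * dist - time * h p\<close>. For \<open>h = H x + c\<close> and
  positive time \<open>\<tau>\<close> this cost is \<open>\<tau> * (L x (dist / \<tau>) - c)\<close>. In the form chosen here the relation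
  also makes sense for \<open>\<tau> = 0\<close>, and it is transitive by the triangle inequality alone.
\<close>
definition descends :: "('a::metric_space \<Rightarrow> real \<Rightarrow> real) \<Rightarrow> (real \<Rightarrow> real) \<Rightarrow> 'a \<times> real \<Rightarrow> 'a \<times> real \<Rightarrow> bool" where
  "descends F h P Q \<longleftrightarrow> snd Q \<le> snd P \<and>
    (\<forall>p\<ge>0. p * dist (fst P) (fst Q) \<le> F (fst P) (snd P) - F (fst Q) (snd Q) + (snd P - snd Q) * h p)"

lemma descends_refl: "descends F h P P"
  by (simp add: descends_def)

lemma descends_trans:
  assumes "descends F h P Q" "descends F h Q R"
  shows "descends F h P R"
  unfolding descends_def
proof (intro conjI allI impI)
  show "snd R \<le> snd P" using assms by (simp add: descends_def)
  fix p :: real assume p: "0 \<le> p"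
  have "p * dist (fst P) (fst R) \<le> p * (dist (fst P) (fst Q) + dist (fst Q) (fst R))"
    using p dist_triangle by (intro mult_left_mono)
  also have "\<dots> = p * dist (fst P) (fst Q) + p * dist (fst Q) (fst R)" by (rule distrib_left)
  also have "\<dots> \<le> (F (fst P) (snd P) - F (fst Q) (snd Q) + (snd P - snd Q) * h p)
      + (F (fst Q) (snd Q) - F (fst R) (snd R) + (snd Q - snd R) * h p)"
    using assms p by (intro add_mono) (simp_all add: descends_def)
  also have "\<dots> = F (fst P) (snd P) - F (fst R) (snd R) + (snd P - snd R) * h p"
    by (simp add: algebra_simps)
  finally show "p * dist (fst P) (fst R) \<le> F (fst P) (snd P) - F (fst R) (snd R) + (snd P - snd R) * h p" .
qed

text \<open>
  An Ekeland type argument. The relation is a closed preorder, and the case \<open>p = 1\<close> bounds distances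
  by the decrease of \<open>F z r + r * h 1\<close>, so a descending sequence converges. If each member
  of the sequence drops almost as far as possible, no strictly earlier point is below the limit, which
  therefore sits at time \<open>a\<close>.
\<close>
lemma descend_to_bottom:
  fixes F :: "'a::complete_space \<Rightarrow> real \<Rightarrow> real"
  assumes ab: "a \<le> b" and cont: "continuous_on (UNIV \<times> {a..b}) (\<lambda>(x, t). F x t)"
    and below: "\<And>x t. t \<in> {a..b} \<Longrightarrow> - B \<le> F x t"
    and step: "\<And>z r. \<lbrakk>a < r; r \<le> b; descends F h (x0, b) (z, r)\<rbrakk> \<Longrightarrow>
      \<exists>y s. a \<le> s \<and> s < r \<and> descends F h (z, r) (y, s)"
  shows "\<exists>y. descends F h (x0, b) (y, a)"
proof -
  \<comment> \<open>The times that can be reached from \<open>P\<close>.\<close>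
  define A where "A = (\<lambda>P. {s. a \<le> s \<and> (\<exists>y. descends F h P (y, s))})"
  have bdd: "bdd_below (A P)" for P by (auto simp: A_def intro!: bdd_belowI[of _ a])
  have "\<exists>Z. Z 0 = (x0, b) \<and> (\<forall>n. a \<le> snd (Z n) \<and> snd (Z n) \<le> b) \<and>
    (\<forall>n. descends F h (Z n) (Z (Suc n)) \<and> snd (Z (Suc n)) < Inf (A (Z n)) + 1 / Suc n)"
  proof -
    have "\<exists>Z. \<forall>n. ((a \<le> snd (Z n) \<and> snd (Z n) \<le> b) \<and> (n = 0 \<longrightarrow> Z n = (x0, b))) \<and>
      (descends F h (Z n) (Z (Suc n)) \<and> snd (Z (Suc n)) < Inf (A (Z n)) + 1 / Suc n)"
    proof (rule dependent_nat_choice)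
      show "\<exists>P. (a \<le> snd P \<and> snd P \<le> b) \<and> (0 = 0 \<longrightarrow> P = (x0, b))"
        using ab by (intro exI[of _ "(x0, b)"]) auto
      fix P :: "'a \<times> real" and n :: nat
      assume P: "(a \<le> snd P \<and> snd P \<le> b) \<and> (n = 0 \<longrightarrow> P = (x0, b))"
      then have "snd P \<in> A P" using descends_refl[of F h P] by (auto simp: A_def intro!: exI[of _ "fst P"])
      moreover have "Inf (A P) < Inf (A P) + 1 / Suc n" by simp
      ultimately obtain s where s: "s \<in> A P" "s < Inf (A P) + 1 / Suc n"
        using cInf_lessD[of "A P" "Inf (A P) + 1 / Suc n"] by blast
      then obtain y where "a \<le> s" "descends F h P (y, s)" by (auto simp: A_def)
      moreover from this(2) have "s \<le> b" using P by (auto simp: descends_def)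
      ultimately show "\<exists>Q. ((a \<le> snd Q \<and> snd Q \<le> b) \<and> (Suc n = 0 \<longrightarrow> Q = (x0, b)))
          \<and> descends F h P Q \<and> snd Q < Inf (A P) + 1 / Suc n"
        using s(2) by (intro exI[of _ "(y, s)"]) auto
    qed
    then show ?thesis by auto
  qed
  then obtain Z where Z0: "Z 0 = (x0, b)" and Zab: "\<And>n. a \<le> snd (Z n)" "\<And>n. snd (Z n) \<le> b"
    and ZS: "\<And>n. descends F h (Z n) (Z (Suc n))" and ZI: "\<And>n. snd (Z (Suc n)) < Inf (A (Z n)) + 1 / Suc n"
    by blast
  have ZR: "descends F h (Z i) (Z j)" if "i \<le> j" for i j
    using that by (induction j rule: dec_induct) (auto intro: descends_refl descends_trans ZS)
  define r where "r = (\<lambda>n. snd (Z n))"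
  define z where "z = (\<lambda>n. fst (Z n))"
  define \<phi> where "\<phi> = (\<lambda>n. F (z n) (r n) + r n * h 1)"
  have Zzr: "Z n = (z n, r n)" for n by (simp add: z_def r_def)
  have rab: "r n \<in> {a..b}" for n using Zab by (simp add: r_def)
  have "decseq r" using ZR unfolding decseq_def r_def descends_def by blast
  then obtain r' where r': "r \<longlonglongrightarrow> r'" "\<forall>i. r' \<le> r i"
    by (rule decseq_convergent[of r a]) (use rab in auto)
  have r'ab: "r' \<in> {a..b}"
    using rab by (intro closed_sequentially[OF closed_atLeastAtMost _ r'(1)]) auto
  have dz: "dist (z i) (z j) \<le> \<phi> i - \<phi> j" if "i \<le> j" for i j
  proof -
    have "\<forall>p\<ge>0. p * dist (z i) (z j) \<le> F (z i) (r i) - F (z j) (r j) + (r i - r j) * h p"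
      using ZR[OF that] by (simp add: descends_def z_def r_def)
    from this[rule_format, of 1] show ?thesis by (simp add: \<phi>_def algebra_simps)
  qed
  have dec\<phi>: "decseq \<phi>" unfolding decseq_def
  proof (intro allI impI)
    fix i j :: nat assume "i \<le> j"
    then show "\<phi> j \<le> \<phi> i" using dz[of i j] zero_le_dist[of "z i" "z j"] by linarith
  qed
  have low\<phi>: "- B - max \<bar>a\<bar> \<bar>b\<bar> * \<bar>h 1\<bar> \<le> \<phi> n" for n
  proof -
    have "\<bar>r n\<bar> \<le> max \<bar>a\<bar> \<bar>b\<bar>" using rab[of n] by auto
    then have "\<bar>r n * h 1\<bar> \<le> max \<bar>a\<bar> \<bar>b\<bar> * \<bar>h 1\<bar>" unfolding abs_mult by (rule mult_right_mono) simp
    then show ?thesis using below[OF rab[of n], of "z n"] unfolding \<phi>_def by linarith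
  qed
  obtain l where "\<phi> \<longlonglongrightarrow> l" "\<forall>i. l \<le> \<phi> i"
    using decseq_convergent[OF dec\<phi>] low\<phi> by blast
  then have "Cauchy \<phi>" by (blast intro: LIMSEQ_imp_Cauchy)
  have "Cauchy z"
  proof (rule metric_CauchyI)
    fix e :: real assume "0 < e"
    with \<open>Cauchy \<phi>\<close> obtain N where N: "\<And>i j. N \<le> i \<Longrightarrow> N \<le> j \<Longrightarrow> dist (\<phi> i) (\<phi> j) < e"
      by (meson metric_CauchyD)
    have "dist (z i) (z j) \<le> dist (\<phi> i) (\<phi> j)" for i j
      using dz[of i j] dz[of j i] dist_commute[of "z i" "z j"]
      by (cases "i \<le> j") (auto simp: dist_real_def)
    then show "\<exists>N. \<forall>i\<ge>N. \<forall>j\<ge>N. dist (z i) (z j) < e"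
      using N by (meson le_less_trans)
  qed
  then obtain z' where z': "z \<longlonglongrightarrow> z'" using Cauchy_convergent convergent_def by blast
  have "(\<lambda>n. (\<lambda>(x, t). F x t) (z n, r n)) \<longlonglongrightarrow> (\<lambda>(x, t). F x t) (z', r')"
    by (rule continuous_on_tendsto_compose[OF cont]) (use r'ab rab in \<open>auto intro!: tendsto_Pair z' r'(1)\<close>)
  then have F': "(\<lambda>n. F (z n) (r n)) \<longlonglongrightarrow> F z' r'" by simp
  have lim: "descends F h (Z n) (z', r')" for n
    unfolding descends_def
  proof (intro conjI allI impI)
    show "snd (z', r') \<le> snd (Z n)" using r'(2) by (simp add: r_def)
    fix p :: real assume p: "0 \<le> p"
    have "p * dist (z n) z' \<le> F (z n) (r n) - F z' r' + (r n - r') * h p"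
    proof (rule tendsto_le[OF sequentially_bot])
      show "(\<lambda>k. p * dist (z n) (z k)) \<longlonglongrightarrow> p * dist (z n) z'" by (intro tendsto_intros z')
      show "(\<lambda>k. F (z n) (r n) - F (z k) (r k) + (r n - r k) * h p)
          \<longlonglongrightarrow> F (z n) (r n) - F z' r' + (r n - r') * h p" by (intro tendsto_intros F' r'(1))
      show "\<forall>\<^sub>F k in sequentially. p * dist (z n) (z k) \<le> F (z n) (r n) - F (z k) (r k) + (r n - r k) * h p"
        using eventually_ge_at_top[of n]
        by eventually_elim (use ZR p in \<open>auto simp: descends_def z_def r_def\<close>)
    qed
    then show "p * dist (fst (Z n)) (fst (z', r'))
        \<le> F (fst (Z n)) (snd (Z n)) - F (fst (z', r')) (snd (z', r')) + (snd (Z n) - snd (z', r')) * h p"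
      by (simp add: z_def r_def)
  qed
  have "r' = a"
  proof (rule ccontr)
    assume "r' \<noteq> a"
    then obtain y s where ys: "a \<le> s" "s < r'" "descends F h (z', r') (y, s)"
      using step[of r' z'] lim[of 0] Z0 r'ab by auto
    have "r (Suc n) \<le> s + 1 / Suc n" for n
    proof -
      have "s \<in> A (Z n)" using ys(1) descends_trans[OF lim ys(3)] by (auto simp: A_def)
      then have "Inf (A (Z n)) \<le> s" by (rule cInf_lower[OF _ bdd])
      then show ?thesis using ZI[of n] by (simp add: r_def)
    qed
    then have "r' \<le> s + 0"
      by (intro LIMSEQ_le[OF LIMSEQ_Suc[OF r'(1)] tendsto_add[OF tendsto_const LIMSEQ_Suc[OF lim_1_over_n]]])
         auto
    then show False using ys(2) by simp
  qed
  then show ?thesis using lim[of 0] Z0 by auto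
qed

section \<open>The Monge condition as a pair of inequalities\<close>

lemma Limsup_ereal_eq_iff:
  fixes f :: "'b \<Rightarrow> real"
  shows "Limsup F (\<lambda>z. ereal (f z)) = ereal k \<longleftrightarrow>
    (\<forall>\<epsilon>>0. \<forall>\<^sub>F z in F. f z < k + \<epsilon>) \<and> (\<forall>\<epsilon>>0. \<exists>\<^sub>F z in F. k - \<epsilon> < f z)"
  (is "?l = _ \<longleftrightarrow> _")
proof (intro iffI conjI allI impI)
  fix \<epsilon> :: real assume eq: "?l = ereal k" and \<epsilon>: "0 < \<epsilon>"
  have "?l < ereal (k + \<epsilon>)" using eq \<epsilon> by simp
  from Limsup_lessD[OF this] show "\<forall>\<^sub>F z in F. f z < k + \<epsilon>" by simp
  show "\<exists>\<^sub>F z in F. k - \<epsilon> < f z"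
  proof (rule ccontr)
    assume "\<not> ?thesis"
    then have "\<forall>\<^sub>F z in F. ereal (f z) \<le> ereal (k - \<epsilon>)" by (simp add: not_frequently not_less)
    from Limsup_bounded[OF this] show False using eq \<epsilon> by simp
  qed
next
  assume A: "(\<forall>\<epsilon>>0. \<forall>\<^sub>F z in F. f z < k + \<epsilon>) \<and> (\<forall>\<epsilon>>0. \<exists>\<^sub>F z in F. k - \<epsilon> < f z)"
  show "?l = ereal k"
  proof (rule antisym)
    show "?l \<le> ereal k"
    proof (rule ereal_le_epsilon2)
      fix e :: real assume "0 < e"
      with A have "\<forall>\<^sub>F z in F. f z < k + e" by blast
      then have "\<forall>\<^sub>F z in F. ereal (f z) \<le> ereal (k + e)" by eventually_elim simp
      from Limsup_bounded[OF this] show "?l \<le> ereal k + ereal e" by simp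
    qed
    show "ereal k \<le> ?l"
    proof (rule ereal_le_epsilon2)
      fix e :: real assume e: "0 < e"
      have "ereal (k - e) \<le> ?l"
      proof (rule ccontr)
        assume "\<not> ?thesis"
        then have "?l < ereal (k - e)" by simp
        from Limsup_lessD[OF this] have "\<forall>\<^sub>F z in F. \<not> k - e < f z" by (simp add: eventually_mono)
        moreover have "\<exists>\<^sub>F z in F. k - e < f z" using A e by blast
        ultimately show False by (simp add: frequently_def)
      qed
      then have "ereal (k - e) + ereal e \<le> ?l + ereal e" by (rule add_right_mono)
      then show "ereal k \<le> ?l + ereal e" by simp
    qed
  qed
qed

text \<open>
  The two halves of the Monge condition, cleared of denominators. The constant \<open>k\<close> that makes
  \<open>u + k t\<close> nondecreasing adds \<open>k\<close> to every difference quotient, so it cancels.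
\<close>
definition monge_subsolution ::
    "('a::metric_space \<Rightarrow> real \<Rightarrow> real) \<Rightarrow> real \<Rightarrow> ('a \<Rightarrow> real \<Rightarrow> real) \<Rightarrow> bool" where
  "monge_subsolution L T u \<longleftrightarrow> (\<forall>x. \<forall>t\<in>{0<..<T}. \<forall>\<epsilon>>0.
    \<forall>\<^sub>F (y, s) in at (x, t) within UNIV \<times> {0<..<t}.
      u x t - u y s \<le> (t - s) * (L x (dist x y / (t - s)) + \<epsilon>))"

definition monge_supersolution ::
    "('a::metric_space \<Rightarrow> real \<Rightarrow> real) \<Rightarrow> real \<Rightarrow> ('a \<Rightarrow> real \<Rightarrow> real) \<Rightarrow> bool" where
  "monge_supersolution L T u \<longleftrightarrow> (\<forall>x. \<forall>t\<in>{0<..<T}. \<forall>\<epsilon>>0.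
    \<exists>\<^sub>F (y, s) in at (x, t) within UNIV \<times> {0<..<t}.
      (t - s) * (L x (dist x y / (t - s)) - \<epsilon>) \<le> u x t - u y s)"

lemma D_L_minus_eq_iff:
  "D_L_minus L (\<lambda>x t. u x t + k * t) x t = ereal k \<longleftrightarrow>
    (\<forall>\<epsilon>>0. \<forall>\<^sub>F (y, s) in at (x, t) within UNIV \<times> {0<..<t}.
      u x t - u y s \<le> (t - s) * (L x (dist x y / (t - s)) + \<epsilon>)) \<and>
    (\<forall>\<epsilon>>0. \<exists>\<^sub>F (y, s) in at (x, t) within UNIV \<times> {0<..<t}.
      (t - s) * (L x (dist x y / (t - s)) - \<epsilon>) \<le> u x t - u y s)"
proof -
  let ?F = "at (x, t) within UNIV \<times> {0<..<t}"
  define f where "f = (\<lambda>(y, s). ((u x t + k * t) - (u y s + k * s)) / (t - s) - L x (dist x y / (t - s)))"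
  have dom: "\<forall>\<^sub>F (y, s) in ?F. s < t"
    by (simp add: eventually_at_filter case_prod_unfold mem_Times_iff)
  have f: "f (y, s) = k + ((u x t - u y s) / (t - s) - L x (dist x y / (t - s)))" if "s < t" for y s
    using that by (simp add: f_def divide_simps) (simp add: algebra_simps)
  have lt: "f (y, s) < k + \<epsilon> \<longleftrightarrow> u x t - u y s < (t - s) * (L x (dist x y / (t - s)) + \<epsilon>)"
    if "s < t" for y s \<epsilon>
    using that by (simp add: f field_simps)
  have gt: "k - \<epsilon> < f (y, s) \<longleftrightarrow> (t - s) * (L x (dist x y / (t - s)) - \<epsilon>) < u x t - u y s"
    if "s < t" for y s \<epsilon>
    using that by (simp add: f field_simps)
  have grow: "(t - s) * (c + \<epsilon> / 2) < (t - s) * (c + \<epsilon>)" "(t - s) * (c - \<epsilon>) < (t - s) * (c - \<epsilon> / 2)"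
    if "s < t" "0 < \<epsilon>" for s c \<epsilon> :: real
    using that by (simp_all add: mult_strict_left_mono)
  have "D_L_minus L (\<lambda>x t. u x t + k * t) x t = Limsup ?F (\<lambda>z. ereal (f z))"
    by (simp add: D_L_minus_def f_def case_prod_unfold)
  moreover have "(\<forall>\<epsilon>>0. \<forall>\<^sub>F z in ?F. f z < k + \<epsilon>) \<longleftrightarrow>
    (\<forall>\<epsilon>>0. \<forall>\<^sub>F (y, s) in ?F. u x t - u y s \<le> (t - s) * (L x (dist x y / (t - s)) + \<epsilon>))" (is "?A \<longleftrightarrow> ?B")
  proof (intro iffI allI impI)
    fix \<epsilon> :: real assume A: ?A and \<epsilon>: "0 < \<epsilon>"
    have "\<forall>\<^sub>F z in ?F. f z < k + \<epsilon>" using A \<epsilon> by blast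
    with dom show "\<forall>\<^sub>F (y, s) in ?F. u x t - u y s \<le> (t - s) * (L x (dist x y / (t - s)) + \<epsilon>)"
      by eventually_elim (auto simp: lt)
  next
    fix \<epsilon> :: real assume B: ?B and \<epsilon>: "0 < \<epsilon>"
    have "\<forall>\<^sub>F (y, s) in ?F. u x t - u y s \<le> (t - s) * (L x (dist x y / (t - s)) + \<epsilon> / 2)"
      using B half_gt_zero[OF \<epsilon>] by blast
    with dom show "\<forall>\<^sub>F z in ?F. f z < k + \<epsilon>"
    proof eventually_elim
      case (elim z)
      then show ?case
        using le_less_trans[OF _ grow(1)[OF _ \<epsilon>]] by (cases z) (simp add: lt)
    qed
  qed
  moreover have "(\<forall>\<epsilon>>0. \<exists>\<^sub>F z in ?F. k - \<epsilon> < f z) \<longleftrightarrow>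
    (\<forall>\<epsilon>>0. \<exists>\<^sub>F (y, s) in ?F. (t - s) * (L x (dist x y / (t - s)) - \<epsilon>) \<le> u x t - u y s)" (is "?A \<longleftrightarrow> ?B")
  proof (intro iffI allI impI)
    fix \<epsilon> :: real assume A: ?A and \<epsilon>: "0 < \<epsilon>"
    have "\<exists>\<^sub>F z in ?F. k - \<epsilon> < f z" using A \<epsilon> by blast
    then show "\<exists>\<^sub>F (y, s) in ?F. (t - s) * (L x (dist x y / (t - s)) - \<epsilon>) \<le> u x t - u y s"
      by (rule frequently_rev_mp) (use dom in \<open>eventually_elim, auto simp: gt\<close>)
  next
    fix \<epsilon> :: real assume B: ?B and \<epsilon>: "0 < \<epsilon>"
    have "\<exists>\<^sub>F (y, s) in ?F. (t - s) * (L x (dist x y / (t - s)) - \<epsilon> / 2) \<le> u x t - u y s"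
      using B half_gt_zero[OF \<epsilon>] by blast
    then show "\<exists>\<^sub>F z in ?F. k - \<epsilon> < f z"
    proof (rule frequently_rev_mp)
      show "\<forall>\<^sub>F z in ?F. (case z of (y, s) \<Rightarrow>
          (t - s) * (L x (dist x y / (t - s)) - \<epsilon> / 2) \<le> u x t - u y s) \<longrightarrow> k - \<epsilon> < f z"
        using dom
      proof eventually_elim
        case (elim z)
        then show ?case
          using less_le_trans[OF grow(2)[OF _ \<epsilon>]] by (cases z) (simp add: gt)
      qed
    qed
  qed
  ultimately show ?thesis by (simp add: Limsup_ereal_eq_iff)
qed

lemma monge_solution_iff:
  "monge_solution L T u \<longleftrightarrow>
    (\<exists>k\<ge>0. u \<in> S_class k T) \<and> monge_subsolution L T u \<and> monge_supersolution L T u"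
  unfolding monge_solution_def monge_subsolution_def monge_supersolution_def D_L_minus_eq_iff
  by blast

section \<open>Lagrangians of uniformly superlinear growth\<close>

text \<open>
  What the equivalence uses about the pair \<open>H\<close>, \<open>L\<close>. With \<open>m\<close> the common lower bound
  of \<open>L\<close>, the constant \<open>K\<close> makes \<open>L + K\<close> at least \<open>1 + |m|\<close>; then the modulus condition on \<open>L\<close> says that the values of \<open>L + K\<close> at nearby
  points are comparable up to a factor close to \<open>1\<close>, uniformly in the speed \<open>q\<close>.
\<close>
locale superlinear_lagrangian = continuous_lagrangian L
  for L :: "'a::complete_space \<Rightarrow> real \<Rightarrow> real" +
  fixes H :: "'a \<Rightarrow> real \<Rightarrow> real" and K :: real and \<omega> :: "real \<Rightarrow> real"
  assumes length: "length_space TYPE('a)"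
    and fenchel: "\<lbrakk>0 \<le> p; 0 \<le> q\<rbrakk> \<Longrightarrow> p * q - H x p \<le> L x q"
    and L_least: "\<lbrakk>0 \<le> q; \<And>p. 0 \<le> p \<Longrightarrow> p * q - H x p \<le> c\<rbrakk> \<Longrightarrow> L x q \<le> c"
    and coercive: "0 \<le> M \<Longrightarrow> \<exists>C\<ge>0. \<forall>x. \<forall>q\<ge>0. M * q - C \<le> L x q"
    and L_bounded: "0 \<le> q \<Longrightarrow> \<exists>C\<ge>0. \<forall>x. L x q \<le> C"
    and \<omega>_nonneg: "0 \<le> d \<Longrightarrow> 0 \<le> \<omega> d"
    and \<omega>_mono: "\<lbrakk>0 \<le> d; d \<le> d'\<rbrakk> \<Longrightarrow> \<omega> d \<le> \<omega> d'"
    and \<omega>_small: "0 < e \<Longrightarrow> \<exists>d>0. \<omega> d \<le> e"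
    and K_nonneg: "0 \<le> K"
    and L_plus_K: "0 \<le> q \<Longrightarrow> 1 \<le> L x q + K"
    and compare: "0 \<le> q \<Longrightarrow> L y q + K \<le> (1 + \<omega> (dist x y)) * (L x q + K)"
begin

lemma L_mono:
  assumes "0 \<le> q" "q \<le> q'"
  shows "L x q \<le> L x q'"
proof (rule L_least[OF assms(1)])
  fix p :: real assume "0 \<le> p"
  then have "p * q - H x p \<le> p * q' - H x p" using assms by (simp add: mult_left_mono)
  also have "\<dots> \<le> L x q'" using fenchel \<open>0 \<le> p\<close> assms by simp
  finally show "p * q - H x p \<le> L x q'" .
qed

lemma compare_within:
  assumes "dist x y \<le> \<rho>" "0 \<le> q"
  shows "L y q + K \<le> (1 + \<omega> \<rho>) * (L x q + K)"
proof -
  have "(1 + \<omega> (dist x y)) * (L x q + K) \<le> (1 + \<omega> \<rho>) * (L x q + K)"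
    using \<omega>_mono[OF zero_le_dist assms(1)] L_plus_K[OF assms(2), of x] by (intro mult_right_mono) auto
  then show ?thesis using compare[OF assms(2), of y x] by linarith
qed

text \<open>
  Along a constant speed curve from \<open>x\<close> to \<open>y\<close> that is hardly longer than \<open>dist x y\<close>, the Lagrangian is
  comparable to its value at \<open>x\<close>, and the speed may be taken so close to \<open>dist x y / h\<close> that
  \<open>L x\<close> changes by at most \<open>\<eta>\<close>.
\<close>
lemma cheap_curve:
  assumes h: "0 < h" and \<eta>: "0 < \<eta>"
  obtains c v where "constant_speed h v c" "c 0 = x" "c h = y"
    "integral {0..h} (\<lambda>\<sigma>. L (c \<sigma>) v) \<le> h * ((1 + \<omega> (dist x y + \<eta>)) * (L x (dist x y / h) + \<eta> + K) - K)"
proof -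
  let ?q = "dist x y / h"
  have "continuous_on {0..} (\<lambda>q. L x q)"
    using continuous_on_compose2[OF cont_L, of "{0..}" "\<lambda>q. (x, q)"]
    by (simp add: continuous_on_Pair image_subset_iff)
  moreover have q0: "0 \<le> ?q" using h by simp
  ultimately obtain \<delta> where \<delta>: "\<delta> > 0" "\<And>q. 0 \<le> q \<Longrightarrow> dist q ?q < \<delta> \<Longrightarrow> dist (L x q) (L x ?q) < \<eta>"
    unfolding continuous_on_iff using \<eta> by (metis atLeast_iff)
  have mn: "0 < min \<eta> (\<delta> * h)" using \<eta> \<delta>(1) h by simp
  obtain c v where c: "constant_speed h v c" "c 0 = x" "c h = y"
      "dist x y \<le> v * h" "v * h < dist x y + min \<eta> (\<delta> * h)"
    by (rule length_space_constant_speed_curve[OF length h mn, of x y])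
  have v: "0 \<le> v" "?q \<le> v" "v < ?q + \<delta>" using c(1,4,5) h by (auto simp: constant_speed_def field_simps)
  then have Lv: "L x v \<le> L x ?q + \<eta>" using \<delta>(2)[of v] by (auto simp: dist_real_def)
  have lip: "dist (c s) (c t) \<le> v * \<bar>s - t\<bar>" if "s \<in> {0..h}" "t \<in> {0..h}" for s t
    using c(1) that by (auto simp: constant_speed_def)
  then have "v-lipschitz_on {0..h} c" using v by (intro lipschitz_onI) (auto simp: dist_real_def)
  then have cont: "continuous_on {0..h} (\<lambda>\<sigma>. L (c \<sigma>) v)"
    using v by (intro continuous_on_L lipschitz_on_continuous_on)
  have "L (c \<sigma>) v \<le> (1 + \<omega> (dist x y + \<eta>)) * (L x ?q + \<eta> + K) - K" if \<sigma>: "\<sigma> \<in> {0..h}" for \<sigma>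
  proof -
    have "dist x (c \<sigma>) \<le> v * \<sigma>" using lip[of 0 \<sigma>] \<sigma> h c(2) by auto
    also have "\<dots> \<le> v * h" using v \<sigma> by (intro mult_left_mono) auto
    finally have "dist x (c \<sigma>) \<le> dist x y + \<eta>" using c(5) by simp
    from compare_within[OF this v(1)] have "L (c \<sigma>) v + K \<le> (1 + \<omega> (dist x y + \<eta>)) * (L x v + K)" .
    also have "\<dots> \<le> (1 + \<omega> (dist x y + \<eta>)) * (L x ?q + \<eta> + K)"
      using Lv \<omega>_nonneg[of "dist x y + \<eta>"] \<eta> by (intro mult_left_mono) auto
    finally show ?thesis by simp
  qed
  then have "integral {0..h} (\<lambda>\<sigma>. L (c \<sigma>) v)
      \<le> integral {0..h} (\<lambda>_. (1 + \<omega> (dist x y + \<eta>)) * (L x ?q + \<eta> + K) - K)"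
    by (intro integral_le integrable_continuous_real cont) auto
  also have "\<dots> = h * ((1 + \<omega> (dist x y + \<eta>)) * (L x ?q + \<eta> + K) - K)" using h by simp
  finally show thesis using that c(1-3) by blast
qed

end

section \<open>From Monge solutions to curve-based solutions\<close>

lemma continuous_imp_arcwise_continuous:
  assumes "continuous_on (UNIV \<times> {0..<T}) (\<lambda>(x, t). u x t)"
  shows "arcwise_continuous T u"
  unfolding arcwise_continuous_def
proof (intro allI impI)
  fix \<gamma> :: "real \<Rightarrow> 'a" assume "abs_cont_on UNIV \<gamma>"
  then have \<gamma>: "continuous_on UNIV \<gamma>" by (rule abs_cont_on_imp_continuous)
  have "continuous_on (UNIV \<times> {0<..<T}) (\<lambda>z. (\<lambda>(x, t). u x t) (\<gamma> (fst z), snd z))"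
    by (rule continuous_on_compose2[OF assms])
       (auto intro!: continuous_intros continuous_on_compose2[OF \<gamma>])
  then show "continuous_on (UNIV \<times> {0<..<T}) (\<lambda>(s, t). u (\<gamma> s) t)"
    by (simp add: case_prod_unfold)
qed

locale cauchy_data = superlinear_lagrangian L H K \<omega>
  for L :: "'a::complete_space \<Rightarrow> real \<Rightarrow> real" and H K \<omega> +
  fixes T :: real and u :: "'a \<Rightarrow> real \<Rightarrow> real"
  assumes cont_u: "continuous_on (UNIV \<times> {0..<T}) (\<lambda>(x, t). u x t)"
begin

text \<open>
  Since \<open>L x\<close> is nondecreasing and the curve is \<open>v\<close>-Lipschitz, the Monge inequality at
  \<open>(\<gamma> \<sigma>, t - \<sigma>)\<close>, read along the curve, bounds the one-sided difference quotients by \<open>L (\<gamma> \<sigma>) v\<close> at every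
  parameter, not just almost everywhere. At the final time \<open>t - b\<close>, which may be \<open>0\<close>, continuity takes over.
\<close>
lemma monge_subsolution_along_lipschitz:
  assumes sub: "monge_subsolution L T u" and lip: "v-lipschitz_on {a..b} \<gamma>"
    and ab: "0 \<le> a" "a \<le> b" "b \<le> t" "t < T"
  shows "u (\<gamma> a) (t - a) \<le> integral {a..b} (\<lambda>\<sigma>. L (\<gamma> \<sigma>) v) + u (\<gamma> b) (t - b)"
proof -
  have v: "0 \<le> v" using lip by (rule lipschitz_on_nonneg)
  define g where "g = (\<lambda>\<sigma>. L (\<gamma> \<sigma>) v)"
  have cont_\<gamma>: "continuous_on {a..b} \<gamma>" using lip by (rule lipschitz_on_continuous_on)
  have cont_g: "continuous_on {a..b} g" unfolding g_def using v cont_\<gamma> by (rule continuous_on_L)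
  have int_g: "g integrable_on {a..b}" using cont_g by (rule integrable_continuous_real)
  define \<phi> where "\<phi> = (\<lambda>\<sigma>. u (\<gamma> \<sigma>) (t - \<sigma>) + integral {a..\<sigma>} g)"
  have "\<phi> a \<le> \<phi> b"
  proof (rule nondecreasing_if_right_Dini[OF ab(2)])
    have "continuous_on {a..b} (\<lambda>\<sigma>. (\<lambda>(x, t). u x t) (\<gamma> \<sigma>, t - \<sigma>))"
      by (rule continuous_on_compose2[OF cont_u])
         (use ab in \<open>auto intro!: continuous_intros cont_\<gamma>\<close>)
    then show "continuous_on {a..b} \<phi>" unfolding \<phi>_def
      by (intro continuous_intros indefinite_integral_continuous_1 int_g) simp
  next
    fix \<sigma> \<epsilon> :: real assume \<sigma>: "a \<le> \<sigma>" "\<sigma> < b" and \<epsilon>: "0 < \<epsilon>"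
    have "t - \<sigma> \<in> {0<..<T}" using \<sigma> ab by auto
    then have "\<forall>\<^sub>F (y, s) in at (\<gamma> \<sigma>, t - \<sigma>) within UNIV \<times> {0<..<t - \<sigma>}.
      u (\<gamma> \<sigma>) (t - \<sigma>) - u y s \<le> (t - \<sigma> - s) * (L (\<gamma> \<sigma>) (dist (\<gamma> \<sigma>) y / (t - \<sigma> - s)) + \<epsilon> / 2)"
      using sub \<epsilon> half_gt_zero unfolding monge_subsolution_def by blast
    then obtain d1 where d1: "d1 > 0" "\<And>y s. \<lbrakk>0 < s; s < t - \<sigma>; dist (y, s) (\<gamma> \<sigma>, t - \<sigma>) < d1\<rbrakk> \<Longrightarrow>
      u (\<gamma> \<sigma>) (t - \<sigma>) - u y s \<le> (t - \<sigma> - s) * (L (\<gamma> \<sigma>) (dist (\<gamma> \<sigma>) y / (t - \<sigma> - s)) + \<epsilon> / 2)"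
      unfolding eventually_at by auto
    obtain d2 where d2: "d2 > 0" "\<And>\<tau>. \<lbrakk>\<tau> \<in> {a..b}; dist \<tau> \<sigma> < d2\<rbrakk> \<Longrightarrow> dist (g \<tau>) (g \<sigma>) < \<epsilon> / 2"
      using cont_g[unfolded continuous_on_iff, rule_format, of \<sigma> "\<epsilon> / 2"] \<sigma> \<epsilon> by auto
    define k0 where "k0 = min (b - \<sigma>) (min (d1 / (v + 1)) d2)"
    have "0 < k0" "k0 \<le> b - \<sigma>" "k0 \<le> d1 / (v + 1)" "k0 \<le> d2"
      using \<sigma> d1(1) d2(1) v by (auto simp: k0_def)
    moreover define k where "k = k0 / 2"
    ultimately have k: "0 < k" "k < b - \<sigma>" "k < d1 / (v + 1)" "k < d2"
      by linarith+
    define \<tau> where "\<tau> = \<sigma> + k"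
    have \<tau>: "\<sigma> < \<tau>" "\<tau> < b" using k by (auto simp: \<tau>_def)
    have dk: "dist (\<gamma> \<sigma>) (\<gamma> \<tau>) \<le> v * k"
      using lipschitz_onD[OF lip, of \<sigma> \<tau>] \<sigma> \<tau> k by (simp add: dist_real_def \<tau>_def)
    have "dist (\<gamma> \<tau>, t - \<tau>) (\<gamma> \<sigma>, t - \<sigma>) \<le> dist (\<gamma> \<tau>) (\<gamma> \<sigma>) + dist (t - \<tau>) (t - \<sigma>)"
      unfolding dist_Pair_Pair by (rule sqrt_sum_squares_le_sum) auto
    also have "\<dots> \<le> v * k + k" using dk k by (simp add: dist_real_def \<tau>_def dist_commute)
    also have "\<dots> = (v + 1) * k" by (simp add: algebra_simps)
    also have "\<dots> < d1" using k v by (simp add: field_simps)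
    finally have "u (\<gamma> \<sigma>) (t - \<sigma>) - u (\<gamma> \<tau>) (t - \<tau>) \<le> k * (L (\<gamma> \<sigma>) (dist (\<gamma> \<sigma>) (\<gamma> \<tau>) / k) + \<epsilon> / 2)"
      using d1(2)[of "t - \<tau>" "\<gamma> \<tau>"] \<tau> ab by (simp add: \<tau>_def)
    also have "\<dots> \<le> k * (g \<sigma> + \<epsilon> / 2)"
      unfolding g_def using dk k v by (intro mult_left_mono add_right_mono L_mono) (auto simp: field_simps)
    finally have 1: "u (\<gamma> \<sigma>) (t - \<sigma>) - u (\<gamma> \<tau>) (t - \<tau>) \<le> k * (g \<sigma> + \<epsilon> / 2)" .
    have "(g \<sigma> - \<epsilon> / 2) * k = integral {\<sigma>..\<tau>} (\<lambda>_. g \<sigma> - \<epsilon> / 2)" using k by (simp add: \<tau>_def)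
    also have "\<dots> \<le> integral {\<sigma>..\<tau>} g"
    proof (rule integral_le)
      show "g integrable_on {\<sigma>..\<tau>}"
        using int_g by (rule integrable_on_subinterval) (use \<sigma> \<tau> in auto)
      show "g \<sigma> - \<epsilon> / 2 \<le> g z" if "z \<in> {\<sigma>..\<tau>}" for z
      proof -
        have "\<bar>g z - g \<sigma>\<bar> < \<epsilon> / 2"
          using d2(2)[of z] that \<sigma> \<tau> k by (auto simp: dist_real_def \<tau>_def)
        then show ?thesis by linarith
      qed
    qed auto
    also have "integral {\<sigma>..\<tau>} g = integral {a..\<tau>} g - integral {a..\<sigma>} g"
      using Henstock_Kurzweil_Integration.integral_combine[of a \<sigma> \<tau> g] \<sigma> \<tau>
        integrable_on_subinterval[OF int_g, of a \<tau>] by auto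
    finally have "\<phi> \<sigma> - \<epsilon> * (\<tau> - \<sigma>) \<le> \<phi> \<tau>"
      using 1 by (simp add: \<phi>_def \<tau>_def algebra_simps)
    then show "\<exists>\<tau>\<in>{\<sigma><..b}. \<phi> \<sigma> - \<epsilon> * (\<tau> - \<sigma>) \<le> \<phi> \<tau>" using \<tau> by (intro bexI[of _ \<tau>]) auto
  qed
  then show ?thesis by (simp add: \<phi>_def g_def)
qed

lemma monge_subsolution_along_admissible:
  assumes sub: "monge_subsolution L T u" and \<gamma>: "\<gamma> \<in> admissible_curves L x"
    and ab: "0 \<le> a" "a \<le> b" "b \<le> t" "t < T"
  shows "u (\<gamma> a) (t - a) \<le> integral {a..b} (integrand \<gamma>) + u (\<gamma> b) (t - b)"
proof -
  have "b \<le> t \<longrightarrow> u (\<gamma> a) (t - a) \<le> integral {a..b} (integrand \<gamma>) + u (\<gamma> b) (t - b)"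
    using \<gamma> ab(1,2)
  proof (rule admissible_induct)
    fix a b v assume "0 \<le> a" "a \<le> b" "v-lipschitz_on {a..b} \<gamma>"
      and eq: "integral {a..b} (integrand \<gamma>) = integral {a..b} (\<lambda>\<sigma>. L (\<gamma> \<sigma>) v)"
    then show "b \<le> t \<longrightarrow> u (\<gamma> a) (t - a) \<le> integral {a..b} (integrand \<gamma>) + u (\<gamma> b) (t - b)"
      unfolding eq using monge_subsolution_along_lipschitz[OF sub] ab(4) by blast
  next
    fix a b c assume abc: "0 \<le> a" "a \<le> b" "b \<le> c"
      "b \<le> t \<longrightarrow> u (\<gamma> a) (t - a) \<le> integral {a..b} (integrand \<gamma>) + u (\<gamma> b) (t - b)"
      "c \<le> t \<longrightarrow> u (\<gamma> b) (t - b) \<le> integral {b..c} (integrand \<gamma>) + u (\<gamma> c) (t - c)"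
    then show "c \<le> t \<longrightarrow> u (\<gamma> a) (t - a) \<le> integral {a..c} (integrand \<gamma>) + u (\<gamma> c) (t - c)"
      using integral_integrand_split[OF \<gamma> abc(1-3)] by auto
  qed
  then show ?thesis using ab by simp
qed

lemma monge_subsolution_imp_curve_subsolution:
  assumes "monge_subsolution L T u"
  shows "curve_subsolution L T u"
  unfolding curve_subsolution_def
proof (intro conjI allI ballI)
  show "arcwise_continuous T u" using cont_u by (rule continuous_imp_arcwise_continuous)
  fix x t \<gamma> \<delta> assume t: "t \<in> {0<..<T}" and \<gamma>: "\<gamma> \<in> admissible_curves L x" and \<delta>: "\<delta> \<in> {0..<t}"
  have "\<gamma> 0 = x" using \<gamma> by (simp add: admissible_curves_def)
  then show "u x t \<le> curve_action L \<gamma> \<delta> + u (\<gamma> \<delta>) (t - \<delta>)"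
    using monge_subsolution_along_admissible[OF assms \<gamma>, of 0 \<delta> t] t \<delta>
      curve_action_eq_integral[OF \<gamma>, of \<delta>] by auto
qed

text \<open>
  Taking the supremum over \<open>p\<close> recovers the Lagrangian from its conjugate.
\<close>
lemma descends_imp_L_bound:
  assumes "descends F (\<lambda>p. H x p + c) (x, t) (z, r)" "r < t"
  shows "(t - r) * (L x (dist x z / (t - r)) - c) \<le> F x t - F z r"
proof -
  have "L x (dist x z / (t - r)) \<le> (F x t - F z r) / (t - r) + c"
  proof (rule L_least)
    show "0 \<le> dist x z / (t - r)" using assms by simp
    fix p :: real assume "0 \<le> p"
    then have "p * dist x z \<le> F x t - F z r + (t - r) * (H x p + c)"
      using assms(1) by (simp add: descends_def)
    then have "p * dist x z / (t - r) \<le> (F x t - F z r + (t - r) * (H x p + c)) / (t - r)"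
      using assms(2) by (intro divide_right_mono) auto
    also have "\<dots> = (F x t - F z r) / (t - r) + (H x p + c)"
      using assms(2) by (simp add: add_divide_distrib)
    finally show "p * (dist x z / (t - r)) - H x p \<le> (F x t - F z r) / (t - r) + c" by simp
  qed
  then have "L x (dist x z / (t - r)) - c \<le> (F x t - F z r) / (t - r)" by simp
  then show ?thesis using assms(2) by (simp add: pos_le_divide_eq mult.commute)
qed

text \<open>
  One time step of length \<open>h\<close>, uniformly in the starting point. The Monge inequality at a
  point near \<open>x\<close> remains true with \<open>L x\<close> in place of the Lagrangian there, at the price of the factor
  \<open>1 + \<omega> \<rho>\<close>. With the single Lagrangian \<open>L x\<close>, the inequalities can be concatenated, so that
  \<open>descend_to_bottom\<close> applies. Superlinear growth keeps the descent within distance \<open>\<rho> / 2\<close> of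
  \<open>x\<close> as long as \<open>h\<close> is small, because \<open>u\<close> is bounded.
\<close>
lemma monge_supersolution_step:
  assumes super: "monge_supersolution L T u" and T: "0 < T"
    and B: "\<And>x t. \<lbrakk>0 \<le> t; t < T\<rbrakk> \<Longrightarrow> \<bar>u x t + K * t\<bar> \<le> B"
    and \<rho>: "0 < \<rho>" "\<omega> \<rho> \<le> 1" and \<epsilon>: "0 < \<epsilon>" "\<epsilon> \<le> 1"
  obtains h0 where "0 < h0" "\<And>x t h. \<lbrakk>0 < h; h \<le> h0; h \<le> t; t < T\<rbrakk> \<Longrightarrow>
    \<exists>y. dist x y \<le> \<rho> / 2 \<and> h * (L x (dist x y / h) + K - (1 + \<omega> \<rho>) * \<epsilon>)
      \<le> (1 + \<omega> \<rho>) * ((u x t + K * t) - (u y (t - h) + K * (t - h)))"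
proof -
  define \<kappa> where "\<kappa> = 1 + \<omega> \<rho>"
  have \<kappa>: "1 \<le> \<kappa>" "\<kappa> \<le> 2" using \<omega>_nonneg[of \<rho>] \<rho> by (auto simp: \<kappa>_def)
  have B0: "0 \<le> B" using B[of 0] T abs_ge_zero order_trans by blast
  \<comment> \<open>With this slope, \<open>M * dist \<le> 4 * B + 1\<close> means \<open>dist \<le> \<rho> / 2\<close>.\<close>
  define M where "M = 2 * (4 * B + 1) / \<rho>"
  have M: "0 < M" using B0 \<rho> by (simp add: M_def)
  obtain C where C: "0 \<le> C" "\<And>x q. 0 \<le> q \<Longrightarrow> M * q - C \<le> L x q" using coercive[of M] M by auto
  define F where "F = (\<lambda>x t. \<kappa> * (u x t + K * t))"
  have Fb: "\<bar>F x t\<bar> \<le> 2 * B" if "0 \<le> t" "t < T" for x t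
    unfolding F_def abs_mult using B[OF that] \<kappa> by (intro mult_mono) auto
  show thesis
  proof (rule that[of "1 / (C + 2)"])
    show "0 < 1 / (C + 2)" using C(1) by simp
    fix x t h assume h: "0 < h" "h \<le> 1 / (C + 2)" "h \<le> t" "t < T"
    let ?D = "descends F (\<lambda>p. H x p + (\<kappa> * \<epsilon> - K))"
    have near: "dist x z \<le> \<rho> / 2"
      if D: "?D (x, t) (z, r)" and r: "t - h \<le> r" for z r
    proof -
      have rt: "r \<le> t" using D by (simp add: descends_def)
      have "M * dist x z \<le> F x t - F z r + (t - r) * (C + 2)"
      proof (cases "r = t")
        case True
        have "M * dist x z \<le> F x t - F z r + (t - r) * (H x M + (\<kappa> * \<epsilon> - K))"
          using D M by (simp add: descends_def)
        then show ?thesis using True by simp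
      next
        case False
        then have rt': "r < t" using rt by simp
        have "M * (dist x z / (t - r)) - C \<le> L x (dist x z / (t - r))" using rt' by (intro C) simp
        then have "(t - r) * (M * (dist x z / (t - r)) - C - (\<kappa> * \<epsilon> - K)) \<le> (t - r) * (L x (dist x z / (t - r)) - (\<kappa> * \<epsilon> - K))"
          using rt' by (intro mult_left_mono) auto
        also have "\<dots> \<le> F x t - F z r" using descends_imp_L_bound[OF D rt'] .
        also have "(t - r) * (M * (dist x z / (t - r)) - C - (\<kappa> * \<epsilon> - K))
            = M * dist x z - (t - r) * (C + \<kappa> * \<epsilon> - K)"
          using rt' by (simp add: right_diff_distrib) (simp add: algebra_simps)
        finally have "M * dist x z \<le> F x t - F z r + (t - r) * (C + \<kappa> * \<epsilon> - K)"
          by simp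
        also have "(t - r) * (C + \<kappa> * \<epsilon> - K) \<le> (t - r) * (C + 2)"
          using rt' \<kappa> \<epsilon> K_nonneg mult_mono[of \<kappa> 2 \<epsilon> 1] by (intro mult_left_mono) auto
        finally show ?thesis by simp
      qed
      also have "F x t - F z r \<le> 4 * B"
        using Fb[of t x] Fb[of r z] h r rt by linarith
      also have "(t - r) * (C + 2) \<le> 1 / (C + 2) * (C + 2)"
        using r h C(1) by (intro mult_right_mono) auto
      finally have "M * dist x z \<le> 4 * B + 1" using C(1) by simp
      also have "\<dots> = M * (\<rho> / 2)" using \<rho> by (simp add: M_def)
      finally show ?thesis using M by simp
    qed
    have "\<exists>y. ?D (x, t) (y, t - h)"
    proof (rule descend_to_bottom)
      show "t - h \<le> t" using h by simp
      have "continuous_on (UNIV \<times> {t - h..t}) (\<lambda>z. (\<lambda>(x, t). u x t) z)"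
        by (rule continuous_on_subset[OF cont_u]) (use h in auto)
      then show "continuous_on (UNIV \<times> {t - h..t}) (\<lambda>(x, t). F x t)"
        unfolding F_def case_prod_unfold by (intro continuous_intros)
      show "- (2 * B) \<le> F x' s" if "s \<in> {t - h..t}" for x' s
        using Fb[of s x'] that h by auto
      fix z r assume r: "t - h < r" "r \<le> t" and D: "?D (x, t) (z, r)"
      have dz: "dist z x \<le> \<rho>" using near[OF D] r \<rho> by (simp add: dist_commute)
      have "r \<in> {0<..<T}" using r h by auto
      then have fr: "\<exists>\<^sub>F (y, s) in at (z, r) within UNIV \<times> {0<..<r}.
          (r - s) * (L z (dist z y / (r - s)) - \<epsilon>) \<le> u z r - u y s"
        using super \<epsilon>(1) unfolding monge_supersolution_def by blast
      have "\<forall>\<^sub>F w in at (z, r) within UNIV \<times> {0<..<r}. t - h < snd w"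
        by (rule order_tendstoD(1)[OF _ r(1)]) (auto intro!: tendsto_eq_intros)
      moreover have "\<forall>\<^sub>F w in at (z, r) within UNIV \<times> {0<..<r}. snd w < r"
        by (auto simp: eventually_at_filter mem_Times_iff)
      ultimately have "\<forall>\<^sub>F w in at (z, r) within UNIV \<times> {0<..<r}. t - h < snd w \<and> snd w < r"
        by (rule eventually_conj)
      from frequently_ex[OF frequently_eventually_conj[OF fr this]]
      obtain y s where ys: "t - h < s" "s < r" "(r - s) * (L z (dist z y / (r - s)) - \<epsilon>) \<le> u z r - u y s"
        by auto
      let ?q = "dist z y / (r - s)"
      have q: "0 \<le> ?q" using ys by simp
      have "?D (z, r) (y, s)"
        unfolding descends_def fst_conv snd_conv
      proof (intro conjI allI impI)
        show "s \<le> r" using ys by simp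
        fix p :: real assume p: "0 \<le> p"
        have "(r - s) * (p * ?q - H x p + K - \<kappa> * \<epsilon>) \<le> (r - s) * (L x ?q + K - \<kappa> * \<epsilon>)"
          using fenchel[OF p q, of x] ys by (intro mult_left_mono) auto
        also have "\<dots> \<le> (r - s) * (\<kappa> * (L z ?q + K) - \<kappa> * \<epsilon>)"
          using compare_within[OF dz q] ys by (intro mult_left_mono) (auto simp: \<kappa>_def)
        also have "\<dots> = \<kappa> * ((r - s) * (L z ?q - \<epsilon>) + K * (r - s))" by (simp add: algebra_simps)
        also have "\<dots> \<le> \<kappa> * ((u z r - u y s) + K * (r - s))"
          using ys \<kappa> by (intro mult_left_mono add_right_mono) auto
        also have "\<dots> = F z r - F y s" by (simp add: F_def algebra_simps)
        also have "(r - s) * (p * ?q - H x p + K - \<kappa> * \<epsilon>)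
            = p * dist z y - (r - s) * (H x p + (\<kappa> * \<epsilon> - K))"
          using ys by (simp add: right_diff_distrib distrib_left)
        finally show "p * dist z y \<le> F z r - F y s + (r - s) * (H x p + (\<kappa> * \<epsilon> - K))"
          by simp
      qed
      then show "\<exists>y s. t - h \<le> s \<and> s < r \<and> ?D (z, r) (y, s)"
        using ys by (intro exI[of _ y] exI[of _ s]) auto
    qed
    then obtain y where y: "?D (x, t) (y, t - h)" by blast
    have "h * (L x (dist x y / h) - (\<kappa> * \<epsilon> - K)) \<le> F x t - F y (t - h)"
      using descends_imp_L_bound[OF y] h by simp
    then show "\<exists>y. dist x y \<le> \<rho> / 2 \<and> h * (L x (dist x y / h) + K - (1 + \<omega> \<rho>) * \<epsilon>)
      \<le> (1 + \<omega> \<rho>) * ((u x t + K * t) - (u y (t - h) + K * (t - h)))"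
      using near[OF y] unfolding \<kappa>_def[symmetric] F_def
      by (intro exI[of _ y]) (simp add: algebra_simps)
  qed
qed

text \<open>
  Each step is realized by a constant speed curve at the cost of one more factor \<open>\<kappa>\<close>. The number
  of steps is finite, hence so is the number of pieces of the resulting curve; it reaches time \<open>0\<close>.
\<close>
lemma monge_supersolution_chain:
  assumes \<rho>: "0 < \<rho>" and \<epsilon>: "0 < \<epsilon>" and h: "0 < h"
    and step: "\<And>x t. \<lbrakk>h \<le> t; t < T\<rbrakk> \<Longrightarrow>
      \<exists>y. dist x y \<le> \<rho> / 2 \<and> h * (L x (dist x y / h) + K - \<kappa> * \<epsilon>)
      \<le> \<kappa> * ((u x t + K * t) - (u y (t - h) + K * (t - h)))"
    and \<kappa>: "\<kappa> = 1 + \<omega> \<rho>" and N: "real N * h < T"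
  shows "\<exists>\<gamma>\<in>admissible_curves L x. (\<exists>V. V-lipschitz_on {0..} \<gamma>) \<and>
    integral {0..real N * h} (integrand \<gamma>) + K * (real N * h)
    \<le> \<kappa>\<^sup>2 * ((u x (real N * h) + K * (real N * h)) - u (\<gamma> (real N * h)) 0) + real N * h * ((\<kappa>\<^sup>2 + \<kappa>) * \<epsilon>)"
  using N
proof (induction N arbitrary: x)
  case 0
  have "\<exists>V. V-lipschitz_on {0..} (\<lambda>_::real. x)" by (intro exI[of _ 0] lipschitz_onI) auto
  then show ?case by (intro bexI[OF _ constant_curve(1)[of x]]) simp
next
  case (Suc N)
  define t where "t = real (Suc N) * h"
  have t: "h \<le> t" "t < T" "t - h = real N * h" using Suc.prems h by (auto simp: t_def algebra_simps)
  have \<kappa>1: "1 \<le> \<kappa>" using \<omega>_nonneg[of \<rho>] \<rho> by (simp add: \<kappa>)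
  obtain y where y: "dist x y \<le> \<rho> / 2" "h * (L x (dist x y / h) + K - \<kappa> * \<epsilon>)
      \<le> \<kappa> * ((u x t + K * t) - (u y (real N * h) + K * (real N * h)))"
    using step[OF t(1,2), of x] t(3) by auto
  define \<eta> where "\<eta> = min \<epsilon> (\<rho> / 2)"
  have \<eta>: "0 < \<eta>" "\<eta> \<le> \<epsilon>" "\<eta> \<le> \<rho> / 2" using \<epsilon> \<rho> by (auto simp: \<eta>_def)
  obtain c v where c: "constant_speed h v c" "c 0 = x" "c h = y"
    "integral {0..h} (\<lambda>\<sigma>. L (c \<sigma>) v) \<le> h * ((1 + \<omega> (dist x y + \<eta>)) * (L x (dist x y / h) + \<eta> + K) - K)"
    by (rule cheap_curve[OF h \<eta>(1)])
  obtain \<gamma> V where \<gamma>: "\<gamma> \<in> admissible_curves L y" "V-lipschitz_on {0..} \<gamma>"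
    "integral {0..real N * h} (integrand \<gamma>) + K * (real N * h)
    \<le> \<kappa>\<^sup>2 * ((u y (real N * h) + K * (real N * h)) - u (\<gamma> (real N * h)) 0) + real N * h * ((\<kappa>\<^sup>2 + \<kappa>) * \<epsilon>)"
    using Suc.IH[of y] t(2,3) h by (auto simp: t_def algebra_simps)
  have \<gamma>0: "\<gamma> 0 = y" using \<gamma>(1) by (simp add: admissible_curves_def)
  let ?g = "prepend h c \<gamma>"
  have g: "?g \<in> admissible_curves L x" "(max v V)-lipschitz_on {0..} ?g"
    "integral {0..t} (integrand ?g) = integral {0..h} (\<lambda>\<sigma>. L (c \<sigma>) v) + integral {0..real N * h} (integrand \<gamma>)"
  proof -
    have join: "c h = \<gamma> 0" "\<gamma> \<in> admissible_curves L (c h)" using c(3) \<gamma>(1) \<gamma>0 by simp_all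
    note P = prepend_admissible[OF h c(1) join \<gamma>(2)]
    show "?g \<in> admissible_curves L x" using P(1) c(2) by simp
    show "(max v V)-lipschitz_on {0..} ?g" by (rule P(2))
    have "t = h + real N * h" using t(3) by simp
    then show "integral {0..t} (integrand ?g) = integral {0..h} (\<lambda>\<sigma>. L (c \<sigma>) v) + integral {0..real N * h} (integrand \<gamma>)"
      using P(3)[of "real N * h"] h by simp
  qed
  have gt: "?g t = \<gamma> (real N * h)"
    using t h \<gamma>0 c(3) by (auto simp: prepend_def)
  let ?l = "L x (dist x y / h)"
  have q: "0 \<le> dist x y / h" using h by simp
  have "integral {0..h} (\<lambda>\<sigma>. L (c \<sigma>) v) + K * h \<le> h * ((1 + \<omega> (dist x y + \<eta>)) * (?l + \<eta> + K))"
    using c(4) by (simp add: algebra_simps)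
  also have "\<dots> \<le> h * (\<kappa> * (?l + \<epsilon> + K))"
  proof (intro mult_left_mono mult_mono)
    show "1 + \<omega> (dist x y + \<eta>) \<le> \<kappa>" unfolding \<kappa> using y(1) \<eta> by (simp add: \<omega>_mono)
    show "0 \<le> ?l + \<eta> + K" using L_plus_K[OF q, of x] \<eta> by simp
  qed (use h \<eta> \<kappa>1 in auto)
  also have "\<dots> = \<kappa> * (h * (?l + K - \<kappa> * \<epsilon>)) + h * ((\<kappa>\<^sup>2 + \<kappa>) * \<epsilon>)"
    by (simp add: algebra_simps power2_eq_square)
  also have "\<dots> \<le> \<kappa> * (\<kappa> * ((u x t + K * t) - (u y (real N * h) + K * (real N * h)))) + h * ((\<kappa>\<^sup>2 + \<kappa>) * \<epsilon>)"
    using y(2) \<kappa>1 by (intro add_right_mono mult_left_mono) auto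
  finally have "integral {0..h} (\<lambda>\<sigma>. L (c \<sigma>) v) + K * h
    \<le> \<kappa>\<^sup>2 * ((u x t + K * t) - (u y (real N * h) + K * (real N * h))) + h * ((\<kappa>\<^sup>2 + \<kappa>) * \<epsilon>)"
    by (simp add: power2_eq_square mult.assoc)
  with \<gamma>(3) have "(integral {0..h} (\<lambda>\<sigma>. L (c \<sigma>) v) + integral {0..real N * h} (integrand \<gamma>)) + K * (h + real N * h)
    \<le> \<kappa>\<^sup>2 * ((u x t + K * t) - u (\<gamma> (real N * h)) 0) + (h + real N * h) * ((\<kappa>\<^sup>2 + \<kappa>) * \<epsilon>)"
    by (simp add: algebra_simps)
  moreover have "h + real N * h = t" by (simp add: t_def algebra_simps)
  ultimately have "integral {0..t} (integrand ?g) + K * t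
    \<le> \<kappa>\<^sup>2 * ((u x t + K * t) - u (?g t) 0) + t * ((\<kappa>\<^sup>2 + \<kappa>) * \<epsilon>)"
    by (simp add: g(3) gt)
  then show ?case using g(1,2) unfolding t_def by blast
qed

text \<open>
  The chain gives an almost optimal curve for the whole time interval \<open>[0, t]\<close>. For intermediate times
  the required inequality follows from the one at time \<open>t\<close> and the subsolution inequality
  on the rest of the curve.
\<close>
lemma monge_imp_curve_supersolution:
  assumes sub: "monge_subsolution L T u" and super: "monge_supersolution L T u"
    and B: "\<And>x t. \<lbrakk>0 \<le> t; t < T\<rbrakk> \<Longrightarrow> \<bar>u x t + K * t\<bar> \<le> B"
  shows "curve_supersolution L T u"
  unfolding curve_supersolution_def
proof (intro conjI allI ballI impI)
  show "arcwise_continuous T u" using cont_u by (rule continuous_imp_arcwise_continuous)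
  fix x t e assume t: "t \<in> {0<..<T}" and e: "0 < (e::real)"
  then have T: "0 < T" by simp
  have B0: "0 \<le> B" using B[of 0] T abs_ge_zero order_trans by blast
  \<comment> \<open>The two errors \<open>(\<kappa>\<^sup>2 - 1) * 2 * B\<close> and \<open>t * (\<kappa>\<^sup>2 + \<kappa>) * \<epsilon>\<close> are each kept below \<open>e / 2\<close>, using \<open>\<kappa>\<^sup>2 - 1 \<le> 3 * \<theta>\<close>.\<close>
  define \<theta> where "\<theta> = min 1 (e / (12 * B + 1) )"
  have \<theta>: "0 < \<theta>" "\<theta> \<le> 1" using e B0 by (auto simp: \<theta>_def)
  obtain \<rho> where \<rho>: "0 < \<rho>" "\<omega> \<rho> \<le> \<theta>" using \<omega>_small[OF \<theta>(1)] by blast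
  define \<kappa> where "\<kappa> = 1 + \<omega> \<rho>"
  have \<kappa>: "1 \<le> \<kappa>" "\<kappa> \<le> 2" using \<omega>_nonneg[of \<rho>] \<rho> \<theta> by (auto simp: \<kappa>_def)
  define \<epsilon> where "\<epsilon> = min 1 (e / (12 * T))"
  have \<epsilon>: "0 < \<epsilon>" "\<epsilon> \<le> 1" using e T by (auto simp: \<epsilon>_def)
  obtain h0 where h0: "0 < h0" "\<And>x t h. \<lbrakk>0 < h; h \<le> h0; h \<le> t; t < T\<rbrakk> \<Longrightarrow>
    \<exists>y. dist x y \<le> \<rho> / 2 \<and> h * (L x (dist x y / h) + K - (1 + \<omega> \<rho>) * \<epsilon>)
      \<le> (1 + \<omega> \<rho>) * ((u x t + K * t) - (u y (t - h) + K * (t - h)))"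
    using monge_supersolution_step[OF super T B \<rho>(1) _ \<epsilon>] \<rho>(2) \<theta>(2) order_trans by blast
  obtain N :: nat where N: "t / h0 < real N" using reals_Archimedean2 by blast
  have "0 < t / h0" using t h0(1) by simp
  then have N0: "0 < real N" using N by linarith
  define h where "h = t / real N"
  have h: "0 < h" "h \<le> h0" "real N * h = t" using N N0 t h0(1) by (auto simp: h_def field_simps)
  obtain \<gamma> where \<gamma>: "\<gamma> \<in> admissible_curves L x"
    "integral {0..t} (integrand \<gamma>) + K * t
      \<le> \<kappa>\<^sup>2 * ((u x t + K * t) - u (\<gamma> t) 0) + t * ((\<kappa>\<^sup>2 + \<kappa>) * \<epsilon>)"
    using monge_supersolution_chain[OF \<rho>(1) \<epsilon>(1) h(1) _ \<kappa>_def, of N x] h0(2)[OF h(1,2)] t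
    unfolding h(3) \<kappa>_def by auto
  have "\<kappa>\<^sup>2 - 1 = (\<kappa> - 1) * (\<kappa> + 1)" by (simp add: power2_eq_square algebra_simps)
  also have "\<dots> \<le> \<theta> * 3" using \<kappa> \<rho>(2) by (intro mult_mono) (auto simp: \<kappa>_def)
  finally have \<kappa>2: "\<kappa>\<^sup>2 - 1 \<le> 3 * \<theta>" by simp
  have "(u x t + K * t) - u (\<gamma> t) 0 \<le> 2 * B" using B[of t x] B[of 0 "\<gamma> t"] t T by auto
  then have "(\<kappa>\<^sup>2 - 1) * ((u x t + K * t) - u (\<gamma> t) 0) \<le> (\<kappa>\<^sup>2 - 1) * (2 * B)"
    using \<kappa> by (intro mult_left_mono) (auto simp: one_le_power)
  also have "\<dots> \<le> (3 * \<theta>) * (2 * B)" using \<kappa>2 B0 by (intro mult_right_mono) auto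
  also have "\<dots> \<le> e / 2"
  proof -
    have "\<theta> \<le> e / (12 * B + 1)" by (simp add: \<theta>_def)
    then have "\<theta> * (12 * B + 1) \<le> e" using B0 by (simp add: pos_le_divide_eq)
    then show ?thesis using \<theta>(1) by (simp add: algebra_simps)
  qed
  finally have 1: "(\<kappa>\<^sup>2 - 1) * ((u x t + K * t) - u (\<gamma> t) 0) \<le> e / 2" .
  have "t * ((\<kappa>\<^sup>2 + \<kappa>) * \<epsilon>) \<le> T * ((2\<^sup>2 + 2) * \<epsilon>)"
    using t \<kappa> \<epsilon> T by (intro mult_mono add_mono power_mono mult_nonneg_nonneg) auto
  also have "\<dots> \<le> e / 2" using T by (simp add: \<epsilon>_def min_def field_simps)
  finally have 2: "t * ((\<kappa>\<^sup>2 + \<kappa>) * \<epsilon>) \<le> e / 2" .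
  have total: "integral {0..t} (integrand \<gamma>) \<le> u x t - u (\<gamma> t) 0 + e"
    using \<gamma>(2) 1 2 by (simp add: algebra_simps)
  show "\<exists>\<gamma>\<in>admissible_curves L x. \<forall>\<delta>\<in>{0..<t}. curve_action L \<gamma> \<delta> + u (\<gamma> \<delta>) (t - \<delta>) - e \<le> u x t"
  proof (intro bexI[OF _ \<gamma>(1)] ballI)
    fix \<delta> assume \<delta>: "\<delta> \<in> {0..<t}"
    have "u (\<gamma> \<delta>) (t - \<delta>) \<le> integral {\<delta>..t} (integrand \<gamma>) + u (\<gamma> t) 0"
      using monge_subsolution_along_admissible[OF sub \<gamma>(1), of \<delta> t t] \<delta> t by simp
    moreover have "integral {0..t} (integrand \<gamma>) = curve_action L \<gamma> \<delta> + integral {\<delta>..t} (integrand \<gamma>)"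
      using integral_integrand_split[OF \<gamma>(1), of 0 \<delta> t] curve_action_eq_integral[OF \<gamma>(1), of \<delta>] \<delta> by simp
    ultimately show "curve_action L \<gamma> \<delta> + u (\<gamma> \<delta>) (t - \<delta>) - e \<le> u x t"
      using total by simp
  qed
qed

lemma monge_solution_imp_curve_solution:
  assumes monge: "monge_solution L T u" and u0: "\<And>x. \<bar>u x 0\<bar> \<le> B0" and T: "0 < T"
  shows "curve_solution L T u"
proof -
  obtain k where k: "0 \<le> k" "u \<in> S_class k T" and sub: "monge_subsolution L T u" and super: "monge_supersolution L T u"
    using monge unfolding monge_solution_iff by blast
  obtain C where C: "0 \<le> C" "\<And>x. L x 0 \<le> C" using L_bounded[of 0] by auto
  have B0: "0 \<le> B0" using u0 abs_ge_zero order_trans by blast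
  have "\<bar>u x t + K * t\<bar> \<le> B0 + (C + k + K) * T" if t: "0 \<le> t" "t < T" for x t
  proof -
    have "u x t \<le> t * L x 0 + u x 0"
      using monge_subsolution_along_admissible[OF sub constant_curve(1)[of x], of 0 t t] constant_curve(2)[of t x] t
      by simp
    also have "t * L x 0 \<le> t * C" using t C by (intro mult_left_mono)
    also have "t * C \<le> T * C" using t C by (intro mult_right_mono) auto
    finally have up: "u x t \<le> T * C + B0" using u0[of x] by simp
    have "u x 0 - k * t \<le> u x t"
    proof (cases "t = 0")
      case False
      then have t0: "0 < t" using t by simp
      have "continuous_on {0..<T} (\<lambda>s. u x s)"
        using continuous_on_compose2[OF cont_u, of "{0..<T}" "\<lambda>s. (x, s)"]
        by (simp add: continuous_on_Pair image_subset_iff)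
      then have "((\<lambda>s. u x s) \<longlongrightarrow> u x 0) (at 0 within {0..<T})"
        using T by (auto simp: continuous_on_def)
      then have lim: "((\<lambda>s. u x s) \<longlongrightarrow> u x 0) (at 0 within {0<..<t})"
        by (rule tendsto_within_subset) (use t in auto)
      have "u x s - k * (t - s) \<le> u x t" if "0 < s" "s < t" for s
      proof -
        have "- k * (t - s) \<le> u x t - u x s"
          using k(2) t that unfolding S_class_def by blast
        then show ?thesis by simp
      qed
      then have "\<forall>\<^sub>F s in at 0 within {0<..<t}. u x s - k * (t - s) \<le> u x t"
        by (auto simp: eventually_at_filter intro!: always_eventually)
      moreover have "((\<lambda>s. u x s - k * (t - s)) \<longlongrightarrow> u x 0 - k * (t - 0)) (at 0 within {0<..<t})"
        by (intro tendsto_intros lim)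
      moreover have "at 0 within {0<..<t} \<noteq> bot"
        using t0 by (simp add: at_within_eq_bot_iff islimpt_greaterThanLessThan1 trivial_limit_within)
      ultimately show ?thesis
        using tendsto_upperbound[of "\<lambda>s. u x s - k * (t - s)"] by fastforce
    qed simp
    moreover have "k * t \<le> k * T" "0 \<le> K * t" "K * t \<le> K * T" "0 \<le> C * T" "0 \<le> k * T"
      using t k C K_nonneg T by (auto intro: mult_left_mono)
    ultimately show ?thesis using up u0[of x] by (simp add: algebra_simps abs_le_iff)
  qed
  then show ?thesis unfolding curve_solution_def
    using monge_subsolution_imp_curve_subsolution[OF sub] monge_imp_curve_supersolution[OF sub super] by blast
qed

section \<open>From curve-based solutions to Monge solutions\<close>

lemma curve_subsolutionD:
  assumes "curve_subsolution L T u" "\<gamma> \<in> admissible_curves L x" "0 \<le> \<delta>" "\<delta> < t" "t < T"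
  shows "u x t \<le> integral {0..\<delta>} (integrand \<gamma>) + u (\<gamma> \<delta>) (t - \<delta>)"
proof -
  have "t \<in> {0<..<T}" "\<delta> \<in> {0..<t}" using assms(3-5) by auto
  then have "u x t \<le> curve_action L \<gamma> \<delta> + u (\<gamma> \<delta>) (t - \<delta>)"
    using assms(1,2) unfolding curve_subsolution_def by blast
  then show ?thesis using curve_action_eq_integral[OF assms(2,3)] by simp
qed

lemma curve_supersolutionD:
  assumes "curve_supersolution L T u" "0 < t" "t < T" "0 < e"
  obtains \<gamma> where "\<gamma> \<in> admissible_curves L x" "\<gamma> 0 = x"
    "\<And>\<delta>. \<lbrakk>0 \<le> \<delta>; \<delta> < t\<rbrakk> \<Longrightarrow> integral {0..\<delta>} (integrand \<gamma>) + u (\<gamma> \<delta>) (t - \<delta>) \<le> u x t + e"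
proof -
  obtain \<gamma> where \<gamma>: "\<gamma> \<in> admissible_curves L x"
    "\<forall>\<delta>\<in>{0..<t}. curve_action L \<gamma> \<delta> + u (\<gamma> \<delta>) (t - \<delta>) - e \<le> u x t"
  proof -
    have "t \<in> {0<..<T}" using assms by simp
    then show thesis using that assms(1,4) unfolding curve_supersolution_def by blast
  qed
  show thesis
  proof (rule that[OF \<gamma>(1)])
    show "\<gamma> 0 = x" using \<gamma>(1) by (simp add: admissible_curves_def)
    fix \<delta> assume "0 \<le> \<delta>" "\<delta> < t"
    then show "integral {0..\<delta>} (integrand \<gamma>) + u (\<gamma> \<delta>) (t - \<delta>) \<le> u x t + e"
      using \<gamma>(2)[rule_format, of \<delta>] curve_action_eq_integral[OF \<gamma>(1), of \<delta>] by simp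
  qed
qed

lemma curve_subsolution_wait:
  assumes sub: "curve_subsolution L T u" and st: "0 < s" "s \<le> t" "t < T"
  shows "u x t \<le> (t - s) * L x 0 + u x s"
  using curve_subsolutionD[OF sub constant_curve(1)[of x], of "t - s" t] constant_curve(2)[of "t - s" x] st
  by simp

text \<open>
  The subsolution inequality along a cheap curve that rests at \<open>y\<close> after its arrival.
\<close>
lemma curve_subsolution_cheap:
  assumes sub: "curve_subsolution L T u" and st: "0 < s" "s < t" "t < T" and \<eta>: "0 < \<eta>"
  shows "u x t - u y s \<le> (t - s) *
    ((1 + \<omega> (dist x y + \<eta>)) * (L x (dist x y / (t - s)) + \<eta> + K) - K)"
proof -
  have h: "0 < t - s" using st by simp
  obtain c v where c: "constant_speed (t - s) v c" "c 0 = x" "c (t - s) = y"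
    "integral {0..t - s} (\<lambda>\<sigma>. L (c \<sigma>) v)
      \<le> (t - s) * ((1 + \<omega> (dist x y + \<eta>)) * (L x (dist x y / (t - s)) + \<eta> + K) - K)"
    by (rule cheap_curve[OF h \<eta>])
  have lip: "0-lipschitz_on {0..} (\<lambda>_::real. y)" by (intro lipschitz_onI) auto
  have join: "c (t - s) = (\<lambda>_. y) (0::real)" "(\<lambda>_. y) \<in> admissible_curves L (c (t - s))"
    using c(3) constant_curve(1)[of y] by simp_all
  note P = prepend_admissible[OF h c(1) join lip]
  have "integral {0..t - s} (integrand (prepend (t - s) c (\<lambda>_. y))) = integral {0..t - s} (\<lambda>\<sigma>. L (c \<sigma>) v)"
    using P(3)[of 0] by simp
  moreover have "prepend (t - s) c (\<lambda>_. y) (t - s) = y" using c(3) by (simp add: prepend_def)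
  ultimately show ?thesis
    using curve_subsolutionD[OF sub P(1), of "t - s" t] c(2,4) st by simp
qed

end

locale initial_value = cauchy_data L H K \<omega> T u
  for L :: "'a::complete_space \<Rightarrow> real \<Rightarrow> real" and H K \<omega> T u +
  fixes u0 :: "'a \<Rightarrow> real" and C0 M0 :: real
  assumes T_pos: "0 < T"
    and u0_bounded: "\<bar>u0 x\<bar> \<le> M0"
    and u0_lipschitz: "0 \<le> C0" "\<bar>u0 x - u0 y\<bar> \<le> C0 * dist x y"
    and attained: "0 < e \<Longrightarrow> \<exists>\<tau>>0. \<forall>t x. 0 < t \<longrightarrow> t < \<tau> \<longrightarrow> \<bar>u x t - u0 x\<bar> \<le> e"
begin

text \<open>
  The Lagrangian bounds \<open>C0 * q\<close> up to a constant, so along a curve the action pays for the possible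
  decrease of the \<open>C0\<close>-Lipschitz initial value.
\<close>
lemma curve_supersolution_ge_initial:
  assumes super: "curve_supersolution L T u"
    and K1: "0 \<le> K1" "\<And>x q. 0 \<le> q \<Longrightarrow> C0 * q - K1 \<le> L x q" and t: "0 < t" "t < T"
  shows "u0 x - K1 * t \<le> u x t"
proof (rule field_le_epsilon)
  fix e :: real assume e: "0 < e"
  obtain \<tau> where \<tau>: "0 < \<tau>" "\<And>t x. \<lbrakk>0 < t; t < \<tau>\<rbrakk> \<Longrightarrow> \<bar>u x t - u0 x\<bar> \<le> e / 2"
    using attained[of "e / 2"] e by auto
  define s where "s = min \<tau> t / 2"
  have s: "0 < s" "s < \<tau>" "s < t" using \<tau>(1) t by (auto simp: s_def)
  obtain \<gamma> where \<gamma>: "\<gamma> \<in> admissible_curves L x" "\<gamma> 0 = x"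
    "\<And>\<delta>. \<lbrakk>0 \<le> \<delta>; \<delta> < t\<rbrakk> \<Longrightarrow> integral {0..\<delta>} (integrand \<gamma>) + u (\<gamma> \<delta>) (t - \<delta>) \<le> u x t + e / 2"
    using curve_supersolutionD[OF super t, of "e / 2" x] e by auto
  let ?y = "\<gamma> (t - s)"
  have "C0 * dist x ?y - K1 * (t - s) \<le> integral {0..t - s} (integrand \<gamma>)"
    using integral_integrand_ge_affine[OF \<gamma>(1), of 0 "t - s" C0 K1] K1(2) u0_lipschitz(1) s \<gamma>(2) by simp
  moreover have "integral {0..t - s} (integrand \<gamma>) + u ?y s \<le> u x t + e / 2"
    using \<gamma>(3)[of "t - s"] s by simp
  moreover have "\<bar>u ?y s - u0 ?y\<bar> \<le> e / 2" using \<tau>(2) s by simp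
  moreover have "\<bar>u0 x - u0 ?y\<bar> \<le> C0 * dist x ?y" by (rule u0_lipschitz)
  moreover have "K1 * (t - s) \<le> K1 * t" using K1(1) s by (intro mult_left_mono) auto
  ultimately show "u0 x - K1 * t \<le> u x t + e" by linarith
qed

text \<open>
  An almost optimal curve for \<open>(x, t)\<close> is used as a competitor for \<open>(x, s)\<close>. The actions cancel, and what
  remains is the comparison of \<open>u\<close> at a time slightly above \<open>t - s\<close> with \<open>u\<close> at a time close to \<open>0\<close>.
\<close>
lemma curve_solution_time_monotone:
  assumes sub: "curve_subsolution L T u" and super: "curve_supersolution L T u"
    and K1: "0 \<le> K1" "\<And>x q. 0 \<le> q \<Longrightarrow> C0 * q - K1 \<le> L x q" and st: "0 < s" "s < t" "t < T"
  shows "- K1 * (t - s) \<le> u x t - u x s"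
proof (rule field_le_epsilon)
  fix e :: real assume e: "0 < e"
  obtain \<tau> where \<tau>: "0 < \<tau>" "\<And>t x. \<lbrakk>0 < t; t < \<tau>\<rbrakk> \<Longrightarrow> \<bar>u x t - u0 x\<bar> \<le> e / 3"
    using attained[of "e / 3"] e by auto
  \<comment> \<open>The curve is stopped at time \<open>\<eta>\<close> before it has used up the time \<open>s\<close>.\<close>
  define \<eta> where "\<eta> = min (min \<tau> s / 2) (e / (3 * (K1 + 1)))"
  have \<eta>: "0 < \<eta>" "\<eta> < \<tau>" "\<eta> < s" using \<tau>(1) st e K1(1) by (auto simp: \<eta>_def)
  have "\<eta> \<le> e / (3 * (K1 + 1))" by (simp add: \<eta>_def)
  then have "\<eta> * (3 * (K1 + 1)) \<le> e" using K1(1) by (simp add: pos_le_divide_eq)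
  then have \<eta>K: "K1 * \<eta> \<le> e / 3" using \<eta>(1) by (simp add: algebra_simps)
  obtain \<gamma> where \<gamma>: "\<gamma> \<in> admissible_curves L x" "\<gamma> 0 = x"
    "\<And>\<delta>. \<lbrakk>0 \<le> \<delta>; \<delta> < t\<rbrakk> \<Longrightarrow> integral {0..\<delta>} (integrand \<gamma>) + u (\<gamma> \<delta>) (t - \<delta>) \<le> u x t + e / 3"
    using curve_supersolutionD[OF super, of t "e / 3" x] st e by auto
  let ?y = "\<gamma> (s - \<eta>)" and ?a = "integral {0..s - \<eta>} (integrand \<gamma>)"
  have "?a + u ?y (t - s + \<eta>) \<le> u x t + e / 3"
    using \<gamma>(3)[of "s - \<eta>"] \<eta> st by (simp add: algebra_simps)
  moreover have "u x s \<le> ?a + u ?y \<eta>"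
    using curve_subsolutionD[OF sub \<gamma>(1), of "s - \<eta>" s] \<eta> st by simp
  moreover have "u0 ?y - K1 * (t - s + \<eta>) \<le> u ?y (t - s + \<eta>)"
    by (rule curve_supersolution_ge_initial[OF super K1]) (use \<eta> st in auto)
  moreover have "\<bar>u ?y \<eta> - u0 ?y\<bar> \<le> e / 3" using \<tau>(2) \<eta> by simp
  moreover have "K1 * (t - s + \<eta>) = K1 * (t - s) + K1 * \<eta>" by (rule distrib_left)
  moreover have "- K1 * (t - s) = - (K1 * (t - s))" by simp
  ultimately show "- K1 * (t - s) \<le> u x t - u x s + e" using \<eta>K by linarith
qed

lemma curve_solution_bounded:
  assumes sub: "curve_subsolution L T u" and super: "curve_supersolution L T u"
  shows "\<exists>B\<ge>0. \<forall>x t. 0 < t \<longrightarrow> t < T \<longrightarrow> \<bar>u x t\<bar> \<le> B"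
proof -
  obtain K1 where K1: "0 \<le> K1" "\<And>x q. 0 \<le> q \<Longrightarrow> C0 * q - K1 \<le> L x q"
    using coercive[OF u0_lipschitz(1)] by auto
  obtain C where C: "0 \<le> C" "\<And>x. L x 0 \<le> C" using L_bounded[of 0] by auto
  obtain \<tau> where \<tau>: "0 < \<tau>" "\<And>t x. \<lbrakk>0 < t; t < \<tau>\<rbrakk> \<Longrightarrow> \<bar>u x t - u0 x\<bar> \<le> 1"
    using attained[of 1] by auto
  have "\<bar>u x t\<bar> \<le> M0 + (K1 + C) * T + 1" if t: "0 < t" "t < T" for x t
  proof -
    define s where "s = min \<tau> t / 2"
    have s: "0 < s" "s < \<tau>" "s \<le> t" using \<tau>(1) t by (auto simp: s_def)
    have "u x t \<le> (t - s) * L x 0 + u x s" by (rule curve_subsolution_wait[OF sub s(1,3) t(2)])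
    also have "(t - s) * L x 0 \<le> (t - s) * C" using s C by (intro mult_left_mono) auto
    also have "(t - s) * C \<le> T * C" using s t C by (intro mult_right_mono) auto
    finally have "u x t \<le> T * C + M0 + 1" using \<tau>(2)[OF s(1,2), of x] u0_bounded[of x] by linarith
    moreover have "u0 x - K1 * t \<le> u x t" by (rule curve_supersolution_ge_initial[OF super K1 t])
    moreover have "K1 * t \<le> K1 * T" "0 \<le> K1 * T" "0 \<le> C * T" using K1 C t T_pos by (auto intro: mult_left_mono)
    ultimately show ?thesis using u0_bounded[of x] by (simp add: algebra_simps abs_le_iff)
  qed
  moreover have "0 \<le> M0" using u0_bounded abs_ge_zero order_trans by blast
  ultimately show ?thesis using K1 C T_pos by (intro exI[of _ "M0 + (K1 + C) * T + 1"]) auto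
qed

text \<open>
  In space, a curve of speed about \<open>1\<close> from \<open>x\<close> to \<open>y\<close> takes the time \<open>dist x y\<close>. It is available while
  \<open>dist x y < t\<close>; for larger distances boundedness suffices, which is why \<open>\<Lambda>\<close> depends on \<open>t0\<close>.
\<close>
lemma curve_solution_lipschitz:
  assumes sub: "curve_subsolution L T u" and super: "curve_supersolution L T u" and t0: "0 < t0"
  shows "\<exists>\<Lambda>\<ge>0. \<forall>x y t s. t0 \<le> t \<longrightarrow> t < T \<longrightarrow> t0 \<le> s \<longrightarrow> s < T \<longrightarrow>
    \<bar>u x t - u y s\<bar> \<le> \<Lambda> * (dist x y + \<bar>t - s\<bar>)"
proof -
  obtain K1 where K1: "0 \<le> K1" "\<And>x q. 0 \<le> q \<Longrightarrow> C0 * q - K1 \<le> L x q"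
    using coercive[OF u0_lipschitz(1)] by auto
  obtain C where C: "0 \<le> C" "\<And>x. L x 0 \<le> C" using L_bounded[of 0] by auto
  obtain C1 where C1: "0 \<le> C1" "\<And>x. L x 1 \<le> C1" using L_bounded[of 1] by auto
  obtain B where B: "0 \<le> B" "\<And>x t. \<lbrakk>0 < t; t < T\<rbrakk> \<Longrightarrow> \<bar>u x t\<bar> \<le> B"
    using curve_solution_bounded[OF sub super] by blast
  note mono = curve_solution_time_monotone[OF sub super K1]
  define A where "A = (1 + \<omega> (T + 1)) * (C1 + 1 + K)"
  define \<Lambda> where "\<Lambda> = A + K1 + C + 2 * B / t0"
  have w0: "0 \<le> \<omega> (T + 1)" using T_pos by (intro \<omega>_nonneg) simp
  have A0: "0 \<le> A" using w0 C1(1) K_nonneg by (simp add: A_def)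
  have B0: "0 \<le> 2 * B / t0" using B(1) t0 by simp
  have space: "u x t - u y t \<le> \<Lambda> * dist x y" if t: "t0 \<le> t" "t < T" for x y t
  proof (cases "dist x y < t")
    case True
    show ?thesis
    proof (cases "x = y")
      case False
      then have d: "0 < dist x y" by simp
      have q: "t - (t - dist x y) = dist x y" "dist x y / dist x y = 1" using d by auto
      have "u x t - u y (t - dist x y) \<le> dist x y * ((1 + \<omega> (dist x y + 1)) * (L x 1 + 1 + K) - K)"
        using curve_subsolution_cheap[OF sub, of "t - dist x y" t 1 x y] d True t q by simp
      also have "\<dots> \<le> dist x y * A"
      proof (rule mult_left_mono)
        have "(1 + \<omega> (dist x y + 1)) * (L x 1 + 1 + K) \<le> A"
          unfolding A_def using True t C1(2)[of x] w0 L_plus_K[of 1 x]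
          by (intro mult_mono add_mono \<omega>_mono) auto
        then show "(1 + \<omega> (dist x y + 1)) * (L x 1 + 1 + K) - K \<le> A" using K_nonneg by simp
      qed simp
      finally have "u x t - u y (t - dist x y) \<le> dist x y * A" .
      moreover have "- K1 * dist x y \<le> u y t - u y (t - dist x y)"
        using mono[of "t - dist x y" t y] d True t by simp
      ultimately have "u x t - u y t \<le> (A + K1) * dist x y" by (simp add: algebra_simps)
      also have "\<dots> \<le> \<Lambda> * dist x y" using C(1) B0 by (intro mult_right_mono) (auto simp: \<Lambda>_def)
      finally show ?thesis .
    qed simp
  next
    case False
    have "u x t - u y t \<le> 2 * B" using B(2)[of t x] B(2)[of t y] t t0 by auto
    also have "\<dots> = 2 * B / t0 * t0" using t0 by simp
    also have "\<dots> \<le> 2 * B / t0 * dist x y" using False t B0 by (intro mult_left_mono) auto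
    also have "\<dots> \<le> \<Lambda> * dist x y" using A0 K1(1) C(1) by (intro mult_right_mono) (auto simp: \<Lambda>_def)
    finally show ?thesis .
  qed
  have time: "\<bar>u y t - u y s\<bar> \<le> \<Lambda> * (t - s)" if ts: "t0 \<le> s" "s \<le> t" "t < T" for y t s
  proof (cases "s = t")
    case False
    have "u y t - u y s \<le> (t - s) * L y 0" using curve_subsolution_wait[OF sub, of s t y] ts t0 by simp
    also have "\<dots> \<le> (t - s) * C" using C ts by (intro mult_left_mono) auto
    also have "\<dots> \<le> (t - s) * \<Lambda>" using ts A0 K1(1) B0 by (intro mult_left_mono) (auto simp: \<Lambda>_def)
    finally have "u y t - u y s \<le> \<Lambda> * (t - s)" by (simp add: mult.commute)
    moreover have "- K1 * (t - s) \<le> u y t - u y s" using mono[of s t y] ts t0 False by simp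
    moreover have "K1 * (t - s) \<le> \<Lambda> * (t - s)" using ts A0 C(1) B0 by (intro mult_right_mono) (auto simp: \<Lambda>_def)
    ultimately show ?thesis by (simp add: abs_le_iff)
  qed simp
  have "\<bar>u x t - u y s\<bar> \<le> \<Lambda> * (dist x y + \<bar>t - s\<bar>)"
    if ts: "t0 \<le> t" "t < T" "t0 \<le> s" "s < T" for x y t s
  proof -
    have "\<bar>u x t - u y t\<bar> \<le> \<Lambda> * dist x y"
      using space[OF ts(1,2), of x y] space[OF ts(1,2), of y x] by (simp add: dist_commute abs_le_iff)
    moreover have "\<bar>u y t - u y s\<bar> \<le> \<Lambda> * \<bar>t - s\<bar>"
      using time[of s t y] time[of t s y] ts by (cases "s \<le> t") (auto simp: abs_minus_commute)
    ultimately show ?thesis by (simp add: distrib_left)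
  qed
  moreover have "0 \<le> \<Lambda>" using A0 K1(1) C(1) B0 by (simp add: \<Lambda>_def)
  ultimately show ?thesis by blast
qed

lemma curve_solution_in_S_class:
  assumes sub: "curve_subsolution L T u" and super: "curve_supersolution L T u"
  shows "\<exists>k\<ge>0. u \<in> S_class k T"
proof -
  obtain K1 where K1: "0 \<le> K1" "\<And>x q. 0 \<le> q \<Longrightarrow> C0 * q - K1 \<le> L x q"
    using coercive[OF u0_lipschitz(1)] by auto
  have "locally_lipschitz_on (UNIV \<times> {0<..<T}) (\<lambda>(x, t). u x t)"
    unfolding locally_lipschitz_on_def
  proof
    fix z :: "'a \<times> real" assume z: "z \<in> UNIV \<times> {0<..<T}"
    define t where "t = snd z"
    have t: "0 < t / 2" using z by (auto simp: t_def)
    obtain \<Lambda> where \<Lambda>: "0 \<le> \<Lambda>" "\<And>x y r s. \<lbrakk>t / 2 \<le> r; r < T; t / 2 \<le> s; s < T\<rbrakk> \<Longrightarrow>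
      \<bar>u x r - u y s\<bar> \<le> \<Lambda> * (dist x y + \<bar>r - s\<bar>)"
      using curve_solution_lipschitz[OF sub super t] by blast
    have "(2 * \<Lambda>)-lipschitz_on (UNIV \<times> {0<..<T} \<inter> ball z (t / 2)) (\<lambda>(x, t). u x t)"
    proof (rule lipschitz_onI)
      fix P Q assume PQ: "P \<in> UNIV \<times> {0<..<T} \<inter> ball z (t / 2)" "Q \<in> UNIV \<times> {0<..<T} \<inter> ball z (t / 2)"
      have late: "t / 2 \<le> snd P \<and> snd P < T" if "P \<in> UNIV \<times> {0<..<T} \<inter> ball z (t / 2)" for P
      proof -
        have "dist (snd z) (snd P) < t / 2" using dist_snd_le[of z P] that by simp
        then have "\<bar>t - snd P\<bar> < t / 2" by (simp add: t_def dist_real_def)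
        moreover have "snd P < T" using that by auto
        ultimately show ?thesis by linarith
      qed
      have "\<bar>u (fst P) (snd P) - u (fst Q) (snd Q)\<bar> \<le> \<Lambda> * (dist (fst P) (fst Q) + \<bar>snd P - snd Q\<bar>)"
        using late[OF PQ(1)] late[OF PQ(2)] by (intro \<Lambda>(2)) auto
      also have "\<dots> \<le> \<Lambda> * (dist P Q + dist P Q)"
        using dist_fst_le[of P Q] dist_snd_le[of P Q] \<Lambda>(1)
        by (intro mult_left_mono add_mono) (auto simp: dist_real_def)
      finally show "dist (case P of (x, t) \<Rightarrow> u x t) (case Q of (x, t) \<Rightarrow> u x t) \<le> 2 * \<Lambda> * dist P Q"
        by (simp add: case_prod_unfold dist_real_def)
    qed (use \<Lambda>(1) in simp)
    then show "\<exists>r>0. \<exists>C. C-lipschitz_on (UNIV \<times> {0<..<T} \<inter> ball z r) (\<lambda>(x, t). u x t)"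
      using t by blast
  qed
  then have "u \<in> S_class K1 T"
    unfolding S_class_def using curve_solution_time_monotone[OF sub super K1] by blast
  then show ?thesis using K1(1) by blast
qed

text \<open>
  For speeds \<open>dist x y / (t - s)\<close> up to \<open>Q\<close> the inequality comes from cheap curves, whose error tends to
  \<open>0\<close> with \<open>t - s\<close>. For larger speeds \<open>L\<close> exceeds the Lipschitz bound for the difference quotient of \<open>u\<close>.
\<close>
lemma curve_solution_imp_monge_subsolution:
  assumes sub: "curve_subsolution L T u" and super: "curve_supersolution L T u"
  shows "monge_subsolution L T u"
  unfolding monge_subsolution_def
proof (intro allI ballI impI)
  fix x t \<epsilon> assume t: "t \<in> {0<..<T}" and \<epsilon>: "0 < (\<epsilon>::real)"
  then have t2: "0 < t / 2" by simp
  let ?F = "at (x :: 'a, t) within UNIV \<times> {0<..<t}"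
  obtain \<Lambda> where \<Lambda>: "0 \<le> \<Lambda>" "\<And>x y r s. \<lbrakk>t / 2 \<le> r; r < T; t / 2 \<le> s; s < T\<rbrakk> \<Longrightarrow>
      \<bar>u x r - u y s\<bar> \<le> \<Lambda> * (dist x y + \<bar>r - s\<bar>)"
    using curve_solution_lipschitz[OF sub super t2] by blast
  obtain C where C: "0 \<le> C" "\<And>x q. 0 \<le> q \<Longrightarrow> (\<Lambda> + 1) * q - C \<le> L x q"
    using coercive[of "\<Lambda> + 1"] \<Lambda>(1) by auto
  \<comment> \<open>For \<open>q \<ge> Q\<close> one has \<open>\<Lambda> * (q + 1) \<le> (\<Lambda> + 1) * q - C\<close>, which is at most \<open>L x q\<close>.\<close>
  define Q where "Q = \<Lambda> + C"
  have Q: "0 \<le> Q" using \<Lambda>(1) C(1) by (simp add: Q_def)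
  define l where "l = L x Q + K + 1"
  have l: "0 < l" using L_plus_K[OF Q, of x] by (simp add: l_def)
  obtain \<rho> where \<rho>: "0 < \<rho>" "\<omega> \<rho> \<le> \<epsilon> / (2 * l)" using \<omega>_small[of "\<epsilon> / (2 * l)"] \<epsilon> l by auto
  define \<eta> where "\<eta> = min (min 1 (\<epsilon> / 2)) (\<rho> / 2)"
  have \<eta>: "0 < \<eta>" "\<eta> \<le> 1" "\<eta> \<le> \<epsilon> / 2" "\<eta> \<le> \<rho> / 2" using \<epsilon> \<rho> by (auto simp: \<eta>_def)
  have bound: "u x t - u y s \<le> (t - s) * (L x (dist x y / (t - s)) + \<epsilon>)"
    if s: "t / 2 \<le> s" "s < t" "(t - s) * Q \<le> \<rho> / 2" for y s
  proof -
    let ?q = "dist x y / (t - s)"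
    have q: "0 \<le> ?q" and dq: "dist x y = (t - s) * ?q" using s by auto
    show ?thesis
    proof (cases "?q \<le> Q")
      case True
      have "(t - s) * ?q \<le> (t - s) * Q" using True s by (intro mult_left_mono) auto
      then have "dist x y \<le> (t - s) * Q" using dq by linarith
      then have d: "dist x y + \<eta> \<le> \<rho>" using s(3) \<eta>(4) by simp
      have Lq: "L x ?q + K + \<eta> \<le> l" using L_mono[OF q True, of x] \<eta>(2) by (simp add: l_def)
      have Lq0: "0 \<le> L x ?q + K + \<eta>" using L_plus_K[OF q, of x] \<eta>(1) by simp
      have "\<omega> (dist x y + \<eta>) * (L x ?q + K + \<eta>) \<le> \<omega> \<rho> * (L x ?q + K + \<eta>)"
        using d \<eta>(1) Lq0 by (intro mult_right_mono \<omega>_mono) auto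
      also have "\<dots> \<le> \<epsilon> / (2 * l) * l" using \<rho>(2) Lq Lq0 \<epsilon> l by (intro mult_mono) auto
      also have "\<dots> = \<epsilon> / 2" using l by simp
      finally have w: "\<omega> (dist x y + \<eta>) * (L x ?q + K + \<eta>) \<le> \<epsilon> / 2" .
      have "u x t - u y s \<le> (t - s) * ((1 + \<omega> (dist x y + \<eta>)) * (L x ?q + \<eta> + K) - K)"
        using curve_subsolution_cheap[OF sub, of s t \<eta> x y] s t t2 \<eta>(1) by simp
      also have "\<dots> \<le> (t - s) * (L x ?q + \<epsilon>)"
        using w \<eta>(3) s by (intro mult_left_mono) (auto simp: algebra_simps)
      finally show ?thesis .
    next
      case False
      have "u x t - u y s \<le> \<Lambda> * (dist x y + (t - s))" using \<Lambda>(2)[of t s x y] s t by auto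
      also have "\<dots> = \<Lambda> * ((t - s) * ?q + (t - s))" by (simp only: dq[symmetric])
      also have "\<dots> = (t - s) * (\<Lambda> * ?q + \<Lambda>)" by (simp add: algebra_simps)
      also have "\<dots> \<le> (t - s) * (L x ?q + \<epsilon>)"
      proof (rule mult_left_mono)
        have "(\<Lambda> + 1) * ?q = \<Lambda> * ?q + ?q" by (simp only: distrib_right mult_1)
        then have "\<Lambda> * ?q + \<Lambda> \<le> (\<Lambda> + 1) * ?q - C" using False unfolding Q_def by linarith
        then show "\<Lambda> * ?q + \<Lambda> \<le> L x ?q + \<epsilon>" using C(2)[OF q, of x] \<epsilon> by simp
      qed (use s in simp)
      finally show ?thesis .
    qed
  qed
  have snd: "(snd \<longlongrightarrow> t) (?F)" by (auto intro!: tendsto_eq_intros)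
  have "((\<lambda>w. (t - snd w) * Q) \<longlongrightarrow> (t - t) * Q) (?F)"
    by (intro tendsto_intros snd)
  then have "\<forall>\<^sub>F w in ?F. (t - snd w) * Q < \<rho> / 2"
    by (rule order_tendstoD(2)) (use \<rho> in simp)
  moreover have "\<forall>\<^sub>F w in ?F. t / 2 < snd w"
    by (rule order_tendstoD(1)[OF snd]) (use t2 in simp)
  moreover have "\<forall>\<^sub>F w in ?F. snd w < t"
    by (auto simp: eventually_at_filter mem_Times_iff)
  ultimately show "\<forall>\<^sub>F (y, s) in ?F.
      u x t - u y s \<le> (t - s) * (L x (dist x y / (t - s)) + \<epsilon>)"
  proof eventually_elim
    case (elim z)
    then show ?case using bound[of "snd z" "fst z"] by (simp add: case_prod_unfold)
  qed
qed

text \<open>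
  The curve is chosen for an error proportional to the short time \<open>\<delta>\<close>. The Lipschitz bound for \<open>u\<close> and the
  superlinear growth of \<open>L\<close> keep it within distance \<open>\<delta> * Q\<close> of \<open>x\<close>, so the Lagrangian along it is
  comparable to \<open>L x\<close>. The affine minorants of \<open>L x\<close> then bound the action from below by
  \<open>\<delta> * L x (dist x y / \<delta>)\<close> up to a small multiple of \<open>\<delta>\<close>, where \<open>y\<close> is the position at time \<open>\<delta>\<close>.
\<close>
lemma curve_solution_imp_monge_supersolution:
  assumes sub: "curve_subsolution L T u" and super: "curve_supersolution L T u"
  shows "monge_supersolution L T u"
  unfolding monge_supersolution_def
proof (intro allI ballI impI)
  fix x t \<epsilon> assume t: "t \<in> {0<..<T}" and \<epsilon>: "0 < (\<epsilon>::real)"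
  then have t2: "0 < t / 2" by simp
  obtain \<Lambda> where \<Lambda>: "0 \<le> \<Lambda>" "\<And>x y r s. \<lbrakk>t / 2 \<le> r; r < T; t / 2 \<le> s; s < T\<rbrakk> \<Longrightarrow>
      \<bar>u x r - u y s\<bar> \<le> \<Lambda> * (dist x y + \<bar>r - s\<bar>)"
    using curve_solution_lipschitz[OF sub super t2] by blast
  obtain C where C: "0 \<le> C" "\<And>x q. 0 \<le> q \<Longrightarrow> (\<Lambda> + 1) * q - C \<le> L x q"
    using coercive[of "\<Lambda> + 1"] \<Lambda>(1) by auto
  define Q where "Q = \<Lambda> + C + 1"
  have Q: "0 < Q" using \<Lambda>(1) C(1) by (simp add: Q_def)
  define l where "l = L x Q + K"
  have l: "0 < l" using L_plus_K[of Q x] Q by (simp add: l_def)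
  obtain \<rho> where \<rho>: "0 < \<rho>" "\<omega> \<rho> \<le> \<epsilon> / (2 * l)" using \<omega>_small[of "\<epsilon> / (2 * l)"] \<epsilon> l by auto
  define w where "w = \<omega> \<rho>"
  have w: "0 \<le> w" "w * l \<le> \<epsilon> / 2" using \<omega>_nonneg[of \<rho>] \<rho> l by (auto simp: w_def field_simps)
  have close: "\<exists>y s. 0 < s \<and> s < t \<and> dist (y, s) (x, t) < d0 \<and>
      (t - s) * (L x (dist x y / (t - s)) - \<epsilon>) \<le> u x t - u y s" if d0: "0 < d0" for d0
  proof -
    define \<delta> where "\<delta> = min (t / 2) (min (\<rho> / Q) (d0 / (2 * (Q + 1))))"
    have \<delta>: "0 < \<delta>" "\<delta> \<le> t / 2" "\<delta> * Q \<le> \<rho>" "\<delta> * (Q + 1) < d0"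
    proof -
      show "0 < \<delta>" using t2 \<rho> Q d0 by (simp add: \<delta>_def)
      show "\<delta> \<le> t / 2" unfolding \<delta>_def by (rule min.cobounded1)
      have "\<delta> \<le> \<rho> / Q" unfolding \<delta>_def by (intro min.coboundedI2 min.cobounded1)
      then show "\<delta> * Q \<le> \<rho>" using Q by (simp add: pos_le_divide_eq)
      have "\<delta> \<le> d0 / (2 * (Q + 1))" unfolding \<delta>_def by (intro min.coboundedI2 min.cobounded2)
      then have "\<delta> * (2 * (Q + 1)) \<le> d0" using Q by (simp add: pos_le_divide_eq)
      moreover have "0 < \<delta> * (Q + 1)" using \<open>0 < \<delta>\<close> Q by simp
      ultimately show "\<delta> * (Q + 1) < d0" by (simp add: algebra_simps)
    qed
    define e where "e = \<delta> * min 1 (\<epsilon> / 2)"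
    have e: "0 < e" "e \<le> \<delta>" "e \<le> \<delta> * (\<epsilon> / 2)" using \<delta>(1) \<epsilon> by (auto simp: e_def mult_left_mono)
    have t': "0 < t" "t < T" using t by auto
    obtain \<gamma> where \<gamma>: "\<gamma> \<in> admissible_curves L x" "\<gamma> 0 = x"
      "\<And>\<sigma>. \<lbrakk>0 \<le> \<sigma>; \<sigma> < t\<rbrakk> \<Longrightarrow> integral {0..\<sigma>} (integrand \<gamma>) + u (\<gamma> \<sigma>) (t - \<sigma>) \<le> u x t + e"
      using curve_supersolutionD[OF super t' e(1), of x] by blast
    have near: "dist x (\<gamma> \<sigma>) \<le> \<delta> * Q" if \<sigma>: "0 \<le> \<sigma>" "\<sigma> \<le> \<delta>" for \<sigma>
    proof -
      have "(\<Lambda> + 1) * dist x (\<gamma> \<sigma>) - C * \<sigma> \<le> integral {0..\<sigma>} (integrand \<gamma>)"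
        using integral_integrand_ge_affine[OF \<gamma>(1), of 0 \<sigma> "\<Lambda> + 1" C] C(2) \<sigma> \<Lambda>(1) \<gamma>(2) by simp
      moreover have "integral {0..\<sigma>} (integrand \<gamma>) + u (\<gamma> \<sigma>) (t - \<sigma>) \<le> u x t + e"
        using \<gamma>(3) \<sigma> \<delta>(1,2) t2 by simp
      moreover have "\<bar>u x t - u (\<gamma> \<sigma>) (t - \<sigma>)\<bar> \<le> \<Lambda> * (dist x (\<gamma> \<sigma>) + \<bar>t - (t - \<sigma>)\<bar>)"
        using \<sigma> \<delta>(2) t' by (intro \<Lambda>(2)) auto
      ultimately have "dist x (\<gamma> \<sigma>) \<le> (\<Lambda> + C) * \<sigma> + e" using \<sigma> by (simp add: algebra_simps abs_le_iff)
      also have "\<dots> \<le> (\<Lambda> + C) * \<delta> + \<delta>" using \<sigma> \<Lambda>(1) C(1) e(2) by (intro add_mono mult_left_mono) auto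
      finally show ?thesis by (simp add: Q_def algebra_simps)
    qed
    let ?y = "\<gamma> \<delta>" and ?I = "integral {0..\<delta>} (integrand \<gamma>)"
    let ?q = "dist x ?y / \<delta>"
    have q: "0 \<le> ?q" "?q \<le> Q" using near[of \<delta>] \<delta>(1) by (auto simp: pos_divide_le_eq mult.commute)
    \<comment> \<open>Comparability turns each affine minorant of \<open>L x\<close> into one for the Lagrangian along the whole curve.\<close>
    have jensen: "L x ?q \<le> (1 + w) * (?I / \<delta> + K) - K"
    proof (rule L_least[OF q(1)])
      fix p :: real assume p: "0 \<le> p"
      have "p / (1 + w) * dist (\<gamma> 0) (\<gamma> \<delta>) - ((H x p - K) / (1 + w) + K) * (\<delta> - 0) \<le> ?I"
      proof (rule integral_integrand_ge_affine[OF \<gamma>(1)])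
        fix \<sigma> q :: real assume \<sigma>: "\<sigma> \<in> {0..\<delta>}" and q: "0 \<le> q"
        have "dist (\<gamma> \<sigma>) x \<le> \<rho>" using near[of \<sigma>] \<sigma> \<delta>(3) by (simp add: dist_commute)
        from compare_within[OF this q] have "L x q + K \<le> (1 + w) * (L (\<gamma> \<sigma>) q + K)" by (simp add: w_def)
        then have "p * q - H x p + K \<le> (1 + w) * (L (\<gamma> \<sigma>) q + K)" using fenchel[OF p q, of x] by simp
        then have "(p * q - H x p + K) / (1 + w) \<le> L (\<gamma> \<sigma>) q + K"
          using w(1) by (simp add: pos_divide_le_eq mult.commute)
        then show "p / (1 + w) * q - ((H x p - K) / (1 + w) + K) \<le> L (\<gamma> \<sigma>) q"
          by (simp add: add_divide_distrib diff_divide_distrib)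
      qed (use p w \<delta> in auto)
      then have "(p * dist x ?y - (H x p - K) * \<delta>) / (1 + w) \<le> ?I + K * \<delta>"
        using \<gamma>(2) by (simp add: diff_divide_distrib add_divide_distrib algebra_simps)
      then have "p * dist x ?y - (H x p - K) * \<delta> \<le> (1 + w) * (?I + K * \<delta>)"
        using w(1) by (simp add: pos_divide_le_eq mult.commute)
      then have "(p * dist x ?y - (H x p - K) * \<delta>) / \<delta> \<le> (1 + w) * (?I + K * \<delta>) / \<delta>"
        using \<delta>(1) by (intro divide_right_mono) auto
      then show "p * ?q - H x p \<le> (1 + w) * (?I / \<delta> + K) - K"
        using \<delta>(1) by (simp add: diff_divide_distrib add_divide_distrib distrib_left)
    qed
    have "L x ?q + K - \<epsilon> / 2 \<le> ?I / \<delta> + K"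
    proof -
      let ?X = "L x ?q + K" and ?Y = "?I / \<delta> + K"
      have X: "0 \<le> ?X" "?X \<le> l" using L_plus_K[OF q(1), of x] L_mono[OF q, of x] by (auto simp: l_def)
      have "(1 + w) * (?X - w * ?X) = ?X - w\<^sup>2 * ?X" by (simp add: algebra_simps power2_eq_square)
      also have "\<dots> \<le> (1 + w) * ?Y"
        using jensen mult_nonneg_nonneg[OF zero_le_power2[of w] X(1)] by linarith
      finally have "?X - w * ?X \<le> ?Y" using w(1) by simp
      moreover have "w * ?X \<le> w * l" using X w by (intro mult_left_mono)
      ultimately show ?thesis using w(2) by linarith
    qed
    then have "\<delta> * (L x ?q - \<epsilon> / 2) \<le> \<delta> * (?I / \<delta>)" using \<delta>(1) by (intro mult_left_mono) auto
    then have "\<delta> * (L x ?q - \<epsilon> / 2) \<le> ?I" using \<delta>(1) by simp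
    moreover have "?I + u ?y (t - \<delta>) \<le> u x t + e" using \<gamma>(3) \<delta>(1,2) t2 by simp
    ultimately have "\<delta> * (L x ?q - \<epsilon>) \<le> u x t - u ?y (t - \<delta>)" using e(3) by (simp add: algebra_simps)
    moreover have "dist (?y, t - \<delta>) (x, t) < d0"
    proof -
      have "dist (?y, t - \<delta>) (x, t) \<le> dist ?y x + dist (t - \<delta>) t"
        unfolding dist_Pair_Pair by (rule sqrt_sum_squares_le_sum) auto
      also have "\<dots> \<le> \<delta> * Q + \<delta>" using near[of \<delta>] \<delta>(1) by (simp add: dist_commute dist_real_def)
      also have "\<dots> < d0" using \<delta>(4) by (simp add: algebra_simps)
      finally show ?thesis .
    qed
    ultimately show ?thesis using \<delta>(1,2) t2 by (intro exI[of _ ?y] exI[of _ "t - \<delta>"]) auto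
  qed
  show "\<exists>\<^sub>F (y, s) in at (x, t) within UNIV \<times> {0<..<t}.
      (t - s) * (L x (dist x y / (t - s)) - \<epsilon>) \<le> u x t - u y s"
    unfolding frequently_def
  proof
    assume "\<forall>\<^sub>F z in at (x, t) within UNIV \<times> {0<..<t}.
      \<not> (case z of (y, s) \<Rightarrow> (t - s) * (L x (dist x y / (t - s)) - \<epsilon>) \<le> u x t - u y s)"
    then obtain d0 where d0: "d0 > 0" "\<And>y s. \<lbrakk>0 < s; s < t; dist (y, s) (x, t) < d0\<rbrakk> \<Longrightarrow>
      \<not> (t - s) * (L x (dist x y / (t - s)) - \<epsilon>) \<le> u x t - u y s"
      unfolding eventually_at by auto
    then show False using close[OF d0(1)] by blast
  qed
qed

lemma monge_solution_iff_curve_solution: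
  assumes u0: "\<And>x. u x 0 = u0 x"
  shows "monge_solution L T u \<longleftrightarrow> curve_solution L T u"
proof
  assume "monge_solution L T u"
  then show "curve_solution L T u"
    using monge_solution_imp_curve_solution[of M0] u0_bounded T_pos by (simp add: u0)
next
  assume "curve_solution L T u"
  then have "curve_subsolution L T u" "curve_supersolution L T u" by (auto simp: curve_solution_def)
  then show "monge_solution L T u"
    unfolding monge_solution_iff
    using curve_solution_in_S_class curve_solution_imp_monge_subsolution curve_solution_imp_monge_supersolution
    by blast
qed

end

section \<open>Consequences of the standing conditions\<close>

lemma H1_superlinear:
  assumes "H1 H"
  obtains R where "0 < R" "\<And>x p. R \<le> p \<Longrightarrow> M * p \<le> H x p"
proof -
  have "\<forall>\<^sub>F R in at_top. ereal M < (INF (x, p) \<in> UNIV \<times> {R..}. ereal (H x p / p))"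
    by (rule order_tendstoD(1)[OF assms[unfolded H1_def, THEN conjunct2]]) simp
  then obtain R where "\<forall>R'\<ge>R. ereal M < (INF (x, p) \<in> UNIV \<times> {R'..}. ereal (H x p / p))"
    unfolding eventually_at_top_linorder by blast
  then have R: "ereal M < (INF (x, p) \<in> UNIV \<times> {max R 1..}. ereal (H x p / p))"
    by (rule allE[of _ "max R 1"]) simp
  show thesis
  proof (rule that[of "max R 1"])
    fix x p assume p: "max R 1 \<le> p"
    have "(INF (x, p) \<in> UNIV \<times> {max R 1..}. ereal (H x p / p)) \<le> ereal (H x p / p)"
      using p by (intro INF_lower2[of "(x, p)"]) auto
    with R have "ereal M < ereal (H x p / p)" by (rule less_le_trans)
    then show "M * p \<le> H x p" using p by (simp add: pos_less_divide_eq)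
  qed simp
qed

text \<open>
  The supremum defining the Lagrangian is a real number because \<open>H\<close> grows superlinearly; these are
  its two characteristic properties.
\<close>
lemma lagrangian_fenchel_dual:
  assumes "H1 H" and q: "0 \<le> q"
  shows "0 \<le> p \<Longrightarrow> p * q - H x p \<le> lagrangian H x q"
    and "(\<And>p. 0 \<le> p \<Longrightarrow> p * q - H x p \<le> c) \<Longrightarrow> lagrangian H x q \<le> c"
proof -
  obtain R where R: "0 < R" "\<And>x p. R \<le> p \<Longrightarrow> q * p \<le> H x p"
    using H1_superlinear[OF assms(1), of q] by blast
  have mono: "mono_on {0..} (H x)" using assms(1) by (simp add: H1_def)
  have "p * q - H x p \<le> R * q + \<bar>H x 0\<bar>" if p: "0 \<le> p" for p
  proof (cases "R \<le> p")
    case True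
    then have "p * q - H x p \<le> 0" using R(2)[of p x] by (simp add: mult.commute)
    also have "0 \<le> R * q + \<bar>H x 0\<bar>" using R(1) q by simp
    finally show ?thesis .
  next
    case False
    then have "p * q \<le> R * q" using q by (intro mult_right_mono) auto
    moreover have "H x 0 \<le> H x p" using mono p by (intro mono_onD[OF mono]) auto
    ultimately show ?thesis by linarith
  qed
  then have "bdd_above ((\<lambda>p. p * q - H x p) ` {0..})"
    by (intro bdd_aboveI2[of _ _ "R * q + \<bar>H x 0\<bar>"]) simp
  then show "0 \<le> p \<Longrightarrow> p * q - H x p \<le> lagrangian H x q"
    unfolding lagrangian_def using cSUP_upper[of p "{0..}" "\<lambda>p. p * q - H x p"] by simp
  show "(\<And>p. 0 \<le> p \<Longrightarrow> p * q - H x p \<le> c) \<Longrightarrow> lagrangian H x q \<le> c"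
    unfolding lagrangian_def by (rule cSUP_least) auto
qed

text \<open>
  For \<open>p \<ge> R\<close> the Hamiltonian is at least \<open>q * p\<close>. For smaller \<open>p\<close> it is at least \<open>H x 0\<close>, and hence
  at least minus the Lagrangian at speed \<open>0\<close>, which is bounded above uniformly in \<open>x\<close>.
\<close>
lemma lagrangian_uniformly_bounded:
  assumes "H1 H" "H3 (lagrangian H)" "0 \<le> q"
  shows "\<exists>C\<ge>0. \<forall>x. lagrangian H x q \<le> C"
proof -
  obtain R where R: "0 < R" "\<And>x p. R \<le> p \<Longrightarrow> q * p \<le> H x p"
    using H1_superlinear[OF assms(1), of q] by blast
  obtain C where C: "\<And>x. lagrangian H x 0 \<le> C"
  proof -
    define S where "S = (SUP x. ereal (lagrangian H x 0))"
    have "ereal (lagrangian H x 0) \<le> S" for x unfolding S_def by (rule SUP_upper) simp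
    moreover from this have "S \<noteq> - \<infinity>" by force
    moreover have "S < \<infinity>" using assms(2) by (simp add: H3_def S_def)
    ultimately obtain C where "S = ereal C" by (cases S) auto
    then show thesis using \<open>\<And>x. ereal (lagrangian H x 0) \<le> S\<close> by (intro that[of C]) simp
  qed
  have "lagrangian H x q \<le> max 0 (R * q + C)" for x
  proof (rule lagrangian_fenchel_dual(2)[OF assms(1,3)])
    have mono: "mono_on {0..} (H x)" using assms(1) by (simp add: H1_def)
    fix p :: real assume p: "0 \<le> p"
    show "p * q - H x p \<le> max 0 (R * q + C)"
    proof (cases "R \<le> p")
      case True
      then show ?thesis using R(2)[of p x] by (simp add: mult.commute)
    next
      case False
      then have "p * q \<le> R * q" using assms(3) by (intro mult_right_mono) auto
      moreover have "H x 0 \<le> H x p" using mono p by (intro mono_onD[OF mono]) auto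
      moreover have "0 * 0 - H x 0 \<le> lagrangian H x 0"
        by (rule lagrangian_fenchel_dual(1)[OF assms(1)]) auto
      ultimately show ?thesis using C[of x] by simp
    qed
  qed
  then show ?thesis by (intro exI[of _ "max 0 (R * q + C)"]) auto
qed

lemma H2_coercive:
  assumes "H2 L m" "0 \<le> M"
  obtains C where "0 \<le> C" "\<And>q. 0 \<le> q \<Longrightarrow> M * q - C \<le> m q"
proof -
  have "\<forall>\<^sub>F q in at_top. M \<le> m q / q"
    using assms(1) unfolding H2_def filterlim_at_top by blast
  then obtain Q0 where Q0: "\<And>q. Q0 \<le> q \<Longrightarrow> M \<le> m q / q" unfolding eventually_at_top_linorder by blast
  define Q where "Q = max Q0 1"
  have "continuous_on {0..Q} m" using assms(1) unfolding H2_def by (meson continuous_on_subset subset_UNIV)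
  moreover have "{0..Q} \<noteq> {}" by (simp add: Q_def)
  ultimately obtain q0 where q0: "\<And>q. q \<in> {0..Q} \<Longrightarrow> m q0 \<le> m q"
    using continuous_attains_inf[OF compact_Icc] by blast
  show thesis
  proof (rule that[of "max 0 (M * Q - m q0)"])
    fix q :: real assume q: "0 \<le> q"
    show "M * q - max 0 (M * Q - m q0) \<le> m q"
    proof (cases "Q \<le> q")
      case True
      then have "M \<le> m q / q" "0 < q" using Q0 by (auto simp: Q_def)
      then show ?thesis by (simp add: pos_le_divide_eq)
    next
      case False
      then have "M * q \<le> M * Q" "m q0 \<le> m q" using q assms(2) q0 by (auto intro: mult_left_mono)
      then show ?thesis by linarith
    qed
  qed simp
qed

lemma superlinear_lagrangian_of_conditions:
  fixes H :: "'a::complete_space \<Rightarrow> real \<Rightarrow> real"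
  assumes len: "length_space TYPE('a)" and H1: "H1 H"
    and cont: "continuous_on (UNIV \<times> {0..}) (\<lambda>(x, q). lagrangian H x q)"
    and H2: "H2 (lagrangian H) m" and H3: "H3 (lagrangian H)" and H4: "H4 (lagrangian H) m"
  obtains K \<omega> where "superlinear_lagrangian (lagrangian H) H K \<omega>"
proof -
  let ?L = "lagrangian H"
  obtain \<omega> where \<omega>: "modulus_of_continuity \<omega>"
    "\<And>x y q. 0 \<le> q \<Longrightarrow> \<bar>?L x q - ?L y q\<bar> \<le> \<omega> (dist x y) * (1 + \<bar>m q\<bar>)"
    using H4 unfolding H4_def by blast
  have \<omega>_mono: "\<omega> d \<le> \<omega> d'" if "0 \<le> d" "d \<le> d'" for d d'
    using \<omega>(1) that unfolding modulus_of_continuity_def by (auto intro: mono_onD)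
  have \<omega>_nonneg: "0 \<le> \<omega> d" if "0 \<le> d" for d
    using \<omega>_mono[of 0 d] \<omega>(1) that by (simp add: modulus_of_continuity_def)
  have mL: "m q \<le> ?L x q" if "0 \<le> q" for x q
  proof -
    have "ereal (m q) \<le> (INF x. ereal (?L x q))" using H2 that unfolding H2_def by blast
    also have "\<dots> \<le> ereal (?L x q)" by (rule INF_lower) simp
    finally show ?thesis by simp
  qed
  obtain C where C: "0 \<le> C" "\<And>q. 0 \<le> q \<Longrightarrow> 0 * q - C \<le> m q" using H2_coercive[OF H2, of 0] by auto
  define K where "K = 2 * C + 1"
  have K: "1 + \<bar>m q\<bar> \<le> ?L x q + K" if "0 \<le> q" for x q
    using C(2)[OF that] mL[OF that, of x] C(1) by (simp add: K_def abs_le_iff)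
  have "superlinear_lagrangian ?L H K \<omega>"
  proof
    show "continuous_on (UNIV \<times> {0..}) (\<lambda>(x, q). ?L x q)" by (fact cont)
    show "length_space TYPE('a)" by (fact len)
    show "p * q - H x p \<le> ?L x q" if "0 \<le> p" "0 \<le> q" for x p q
      using lagrangian_fenchel_dual(1)[OF H1] that by blast
    show "?L x q \<le> c" if "0 \<le> q" "\<And>p. 0 \<le> p \<Longrightarrow> p * q - H x p \<le> c" for x q c
      using lagrangian_fenchel_dual(2)[OF H1 that(1)] that(2) by blast
    show "\<exists>C\<ge>0. \<forall>x. \<forall>q\<ge>0. M * q - C \<le> ?L x q" if M: "0 \<le> M" for M
    proof -
      obtain C where "0 \<le> C" "\<And>q. 0 \<le> q \<Longrightarrow> M * q - C \<le> m q" using H2_coercive[OF H2 M] by blast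
      then show ?thesis using mL by (intro exI[of _ C]) (auto intro: order_trans)
    qed
    show "\<exists>C\<ge>0. \<forall>x. ?L x q \<le> C" if "0 \<le> q" for q by (rule lagrangian_uniformly_bounded[OF H1 H3 that])
    show "0 \<le> \<omega> d" if "0 \<le> d" for d by (rule \<omega>_nonneg[OF that])
    show "\<omega> d \<le> \<omega> d'" if "0 \<le> d" "d \<le> d'" for d d' by (rule \<omega>_mono[OF that])
    show "\<exists>d>0. \<omega> d \<le> e" if e: "0 < e" for e
    proof -
      have "\<forall>\<^sub>F d in at_right 0. \<omega> d < e"
        using \<omega>(1) e unfolding modulus_of_continuity_def by (auto intro: order_tendstoD(2))
      then obtain b where b: "0 < b" "\<And>d. 0 < d \<Longrightarrow> d < b \<Longrightarrow> \<omega> d < e"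
        unfolding eventually_at_right_field by blast
      then show ?thesis by (intro exI[of _ "b / 2"]) (auto intro: less_imp_le)
    qed
    show "0 \<le> K" using C(1) by (simp add: K_def)
    show "1 \<le> ?L x q + K" if "0 \<le> q" for x q using K[OF that, of x] by simp
    show "?L y q + K \<le> (1 + \<omega> (dist x y)) * (?L x q + K)" if "0 \<le> q" for x y q
    proof -
      have "?L y q - ?L x q \<le> \<omega> (dist x y) * (1 + \<bar>m q\<bar>)" using \<omega>(2)[OF that, of x y] by linarith
      also have "\<dots> \<le> \<omega> (dist x y) * (?L x q + K)" using K[OF that] \<omega>_nonneg by (intro mult_left_mono) auto
      finally show ?thesis by (simp add: algebra_simps)
    qed
  qed
  then show thesis by (rule that)
qed

lemma uniform_initial_limit:
  assumes "((\<lambda>t. SUP x. ereal \<bar>u x t - u0 x\<bar>) \<longlongrightarrow> 0) (at_right (0::real))" and e: "0 < e"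
  shows "\<exists>\<tau>>0. \<forall>t x. 0 < t \<longrightarrow> t < \<tau> \<longrightarrow> \<bar>u x t - u0 x\<bar> \<le> e"
proof -
  have "\<forall>\<^sub>F t in at_right 0. (SUP x. ereal \<bar>u x t - u0 x\<bar>) < ereal e"
    using assms by (intro order_tendstoD(2)) auto
  then obtain \<tau> where \<tau>: "0 < \<tau>" "\<And>t. 0 < t \<Longrightarrow> t < \<tau> \<Longrightarrow> (SUP x. ereal \<bar>u x t - u0 x\<bar>) < ereal e"
    unfolding eventually_at_right_field by blast
  have "\<bar>u x t - u0 x\<bar> \<le> e" if "0 < t" "t < \<tau>" for x t
  proof -
    have "ereal \<bar>u x t - u0 x\<bar> \<le> (SUP x. ereal \<bar>u x t - u0 x\<bar>)" by (rule SUP_upper) simp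
    also have "\<dots> < ereal e" using \<tau>(2) that by blast
    finally show ?thesis by simp
  qed
  then show ?thesis using \<tau>(1) by blast
qed

theorem theorem5p1:
  fixes H :: "'a::complete_space \<Rightarrow> real \<Rightarrow> real"
    and m :: "real \<Rightarrow> real" and T :: real
    and u0 :: "'a \<Rightarrow> real" and u :: "'a \<Rightarrow> real \<Rightarrow> real"
  assumes "length_space TYPE('a)" and "T > 0"
    and "continuous_on (UNIV \<times> {0..}) (\<lambda>(x, p). H x p)" and "H1 H"
    and "continuous_on (UNIV \<times> {0..}) (\<lambda>(x, q). lagrangian H x q)"
    and "H2 (lagrangian H) m" and "H3 (lagrangian H)" and "H4 (lagrangian H) m"
    and "bounded (range u0)" and "\<exists>C. C-lipschitz_on UNIV u0"
    and "continuous_on (UNIV \<times> {0..<T}) (\<lambda>(x, t). u x t)"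
    and "((\<lambda>t. SUP x. ereal \<bar>u x t - u0 x\<bar>) \<longlongrightarrow> 0) (at_right 0)"
  shows "monge_solution (lagrangian H) T u \<longleftrightarrow> curve_solution (lagrangian H) T u"
proof -
  obtain K \<omega> where "superlinear_lagrangian (lagrangian H) H K \<omega>"
    using superlinear_lagrangian_of_conditions[OF assms(1,4,5,6,7,8)] by blast
  then interpret superlinear_lagrangian "lagrangian H" H K \<omega> .
  obtain M0 where M0: "\<And>x. \<bar>u0 x\<bar> \<le> M0" using assms(9) by (auto simp: bounded_iff)
  obtain C0 where C0: "C0-lipschitz_on UNIV u0" using assms(10) by blast
  note attained = uniform_initial_limit[OF assms(12)]
  interpret initial_value "lagrangian H" H K \<omega> T u u0 C0 M0
  proof
    show "0 \<le> C0" using C0 by (rule lipschitz_on_nonneg)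
    show "\<bar>u0 x - u0 y\<bar> \<le> C0 * dist x y" for x y
      using lipschitz_onD[OF C0, of x y] by (simp add: dist_real_def)
  qed (use assms(2,11) M0 attained in auto)
  have "u x 0 = u0 x" for x
  proof (rule tendsto_unique[OF trivial_limit_at_right_real[of 0]])
    have "continuous_on {0..<T} (\<lambda>t. u x t)"
      using continuous_on_compose2[OF assms(11), of "{0..<T}" "\<lambda>t. (x, t)"]
      by (simp add: continuous_on_Pair image_subset_iff)
    then have "((\<lambda>t. u x t) \<longlongrightarrow> u x 0) (at 0 within {0..<T})"
      using assms(2) by (auto simp: continuous_on_def)
    then have "((\<lambda>t. u x t) \<longlongrightarrow> u x 0) (at 0 within {0..T / 2})"
      by (rule tendsto_within_subset) (use assms(2) in auto)
    then show "((\<lambda>t. u x t) \<longlongrightarrow> u x 0) (at_right 0)"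
      using at_within_Icc_at_right[of 0 "T / 2"] assms(2) by simp
    show "((\<lambda>t. u x t) \<longlongrightarrow> u0 x) (at_right 0)"
    proof (rule tendstoI)
      fix e :: real assume e: "0 < e"
      obtain \<tau> where \<tau>: "0 < \<tau>" "\<And>t x. 0 < t \<Longrightarrow> t < \<tau> \<Longrightarrow> \<bar>u x t - u0 x\<bar> \<le> e / 2"
        using attained[of "e / 2"] e by auto
      have "dist (u x t) (u0 x) < e" if "0 < t" "t < \<tau>" for t
        using \<tau>(2)[OF that, of x] e unfolding dist_real_def by linarith
      then show "\<forall>\<^sub>F t in at_right 0. dist (u x t) (u0 x) < e"
        unfolding eventually_at_right_field using \<tau>(1) by blast
    qed
  qed
  then show ?thesis by (rule monge_solution_iff_curve_solution)
qed

end
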